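(* Let $d\ge 3$ and let $\{S_n\}$ be a symmetric aperiodic random walk on $\mathbb{Z}^d$ satisfying the moment condition stated in the context. Let $r_n>0$ and $\delta_n>0$ be deterministic sequences such that $\delta_n$ is non-increasing, $r_n$ is non-decreasing, for every $c>0$ there is a constant $C>0$ with $r_{[cn]}/r_n<C$ (for all $n$ with $[cn]\ge 1$), and, with $$\beta_n:=r_n^{2d-4}\,\frac{\log\log n}{\log n},$$ $$\lim_{n\to\infty}\beta_n=0,\qquad \lim_{n\to\infty}\delta_n r_n^{2d-4}=0 .$$ Put $k_n=(1-\delta_n)\lambda\log n$ and define the random set of indices $$\mathcal{B}_n=\{0\le j\le n:\ \xi(S_j,\infty)\ge k_n\}.$$ Then $$\lim_{n\to\infty}\ \sup_{j\in\mathcal{B}_n}\ \sup_{x\in B(r_n)}\left|\frac{\xi(S_j+x,\infty)}{m_x\lambda\log n}-1\right|=0\quad\text{almost surely},$$ where $\sup_{j\in\mathcal{B}_n}$ is taken to be $0$ whenever $\mathcal{B}_n$ is empty.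
   Context: $S_0=0$, $S_n=\sum_{k=1}^n X_k$, where $X_1,X_2,\dots$ are i.i.d. $\mathbb{Z}^d$-valued with $\mathbf{P}(X_1=x)=p(x)$. Symmetric means $p(x)=p(-x)$ for all $x$. Aperiodic means: with $R^+=\{x\in\mathbb{Z}^d:\mathbf{P}(S_n=x)>0\text{ for some }n\ge0\}$, one has $\{y-z:\ y\in R^+,\,z\in R^+\}=\mathbb{Z}^d$. Moment condition (with $|x|$ the Euclidean norm): $\sum_x|x|^2p(x)<\infty$ if $d=3$; $\sum_x|x|^2\log(|x|+1)p(x)<\infty$ if $d=4$; $\sum_x|x|^{d-2}p(x)<\infty$ if $d\ge5$. $Q$ is the covariance matrix of $X_1$, $\Vert x\Vert^2:=xQ^{-1}x$, and $B(r)=\{x\in\mathbb{Z}^d:\Vert x\Vert\le r\}$. $\gamma:=\mathbf{P}(S_i\ne0,\ i=1,2,\dots)$ (which is $>0$ for $d\ge3$), $\gamma_x:=\mathbf{P}(S_i\ne x,\ i=1,2,\dots)$, $\lambda:=-1/\log(1-\gamma)$. $m_0=1$ and $m_x=(1-\gamma_x)^2/(1-\gamma)$ for $x\ne0$. Local time: $\xi(x,n):=\sum_{k=1}^n I\{S_k=x\}$ and $\xi(x,\infty):=\sum_{k=1}^\infty I\{S_k=x\}$. $[\cdot]$ denotes the integer part. *)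

theory Defs
  imports "HOL-Probability.Probability"
begin

text \<open>
  The lattice \<open>\<int>\<^sup>d\<close> is the type \<open>int ^ 'd\<close>, with \<open>d = CARD('d)\<close>.
  The steps are \<open>X 1, X 2, \<dots>\<close>; the value \<open>X 0\<close> plays no role.
\<close>

definition real_vec :: "int ^ 'd \<Rightarrow> real ^ 'd" where
  "real_vec x = (\<chi> i. real_of_int (x $ i))"

definition walk :: "(nat \<Rightarrow> 'a \<Rightarrow> int ^ 'd) \<Rightarrow> nat \<Rightarrow> 'a \<Rightarrow> int ^ 'd" where
  "walk X n \<omega> = (\<Sum>k=1..n. X k \<omega>)"

definition symmetric_step :: "(int ^ 'd) pmf \<Rightarrow> bool" where
  "symmetric_step p \<longleftrightarrow> (\<forall>x. pmf p x = pmf p (- x))"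

definition reachable :: "'a measure \<Rightarrow> (nat \<Rightarrow> 'a \<Rightarrow> int ^ 'd) \<Rightarrow> (int ^ 'd) set" where
  "reachable M S = {x. \<exists>n. measure M {\<omega> \<in> space M. S n \<omega> = x} > 0}"

definition aperiodic :: "'a measure \<Rightarrow> (nat \<Rightarrow> 'a \<Rightarrow> int ^ 'd) \<Rightarrow> bool" where
  "aperiodic M S \<longleftrightarrow> {y - z | y z. y \<in> reachable M S \<and> z \<in> reachable M S} = UNIV"

text \<open>
  All terms below are nonnegative, so summability over \<open>UNIV\<close> says exactly that the sum is finite.
\<close>

definition moment_condition :: "(int ^ 'd) pmf \<Rightarrow> bool" where
  "moment_condition p \<longleftrightarrow>
     (CARD('d) = 3 \<longrightarrow> (\<lambda>x. norm (real_vec x) ^ 2 * pmf p x) summable_on UNIV) \<and>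
     (CARD('d) = 4 \<longrightarrow>
        (\<lambda>x. norm (real_vec x) ^ 2 * ln (norm (real_vec x) + 1) * pmf p x) summable_on UNIV) \<and>
     (CARD('d) \<ge> 5 \<longrightarrow>
        (\<lambda>x. norm (real_vec x) ^ (CARD('d) - 2) * pmf p x) summable_on UNIV)"

definition covariance_matrix :: "'a measure \<Rightarrow> ('a \<Rightarrow> int ^ 'd) \<Rightarrow> real ^ 'd ^ 'd" where
  "covariance_matrix M Y =
     (let \<mu> = (\<lambda>i. \<integral>\<omega>. real_of_int (Y \<omega> $ i) \<partial>M)
      in \<chi> i j. \<integral>\<omega>. (real_of_int (Y \<omega> $ i) - \<mu> i) * (real_of_int (Y \<omega> $ j) - \<mu> j) \<partial>M)"

definition cov_norm :: "real ^ 'd ^ 'd \<Rightarrow> int ^ 'd \<Rightarrow> real" where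
  "cov_norm Q x = sqrt (real_vec x \<bullet> (matrix_inv Q *v real_vec x))"

definition cov_ball :: "real ^ 'd ^ 'd \<Rightarrow> real \<Rightarrow> (int ^ 'd) set" where
  "cov_ball Q r = {x. cov_norm Q x \<le> r}"

text \<open>\<open>\<gamma>\<^sub>x\<close>; the escape probability \<open>\<gamma>\<close> is the case \<open>x = 0\<close>.\<close>

definition avoid_prob :: "'a measure \<Rightarrow> (nat \<Rightarrow> 'a \<Rightarrow> int ^ 'd) \<Rightarrow> int ^ 'd \<Rightarrow> real" where
  "avoid_prob M S x = measure M {\<omega> \<in> space M. \<forall>i\<ge>1. S i \<omega> \<noteq> x}"

definition lambda_const :: "'a measure \<Rightarrow> (nat \<Rightarrow> 'a \<Rightarrow> int ^ 'd) \<Rightarrow> real" where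
  "lambda_const M S = - 1 / ln (1 - avoid_prob M S 0)"

definition m_const :: "'a measure \<Rightarrow> (nat \<Rightarrow> 'a \<Rightarrow> int ^ 'd) \<Rightarrow> int ^ 'd \<Rightarrow> real" where
  "m_const M S x = (if x = 0 then 1 else (1 - avoid_prob M S x)\<^sup>2 / (1 - avoid_prob M S 0))"

text \<open>
  The total local time \<open>\<xi>(x,\<infinity>)\<close> of a path \<open>s\<close>.  It is extended-real valued, so that a site
  visited infinitely often really has local time \<open>\<infinity>\<close>.  The sum starts at time \<open>1\<close>.
\<close>

definition total_local_time :: "(nat \<Rightarrow> int ^ 'd) \<Rightarrow> int ^ 'd \<Rightarrow> ereal" where
  "total_local_time s x = (\<Sum>k. of_bool (s (Suc k) = x))"

definition heavy_times :: "(nat \<Rightarrow> int ^ 'd) \<Rightarrow> nat \<Rightarrow> real \<Rightarrow> nat set" where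
  "heavy_times s n k = {j \<in> {0..n}. total_local_time s (s j) \<ge> ereal k}"

text \<open>Supremum of nonnegative quantities, with value \<open>0\<close> (not \<open>-\<infinity>\<close>) over the empty set.\<close>

definition sup0 :: "'b set \<Rightarrow> ('b \<Rightarrow> ereal) \<Rightarrow> ereal" where
  "sup0 A f = (if A = {} then 0 else (SUP a\<in>A. f a))"

end

theory Submission
  imports Defs "HOL-Real_Asymp.Real_Asymp"
begin

text \<open>
  Write \<open>G(x) = \<Sum>n\<ge>1. P(S\<^sub>n = x)\<close>, \<open>g = G(0)\<close> and \<open>h = G(x)\<close> for \<open>x \<noteq> 0\<close>.  By the first-passage
  identity \<open>P(hit x) = G(x) / (1 + g)\<close> (\<open>hit_prob_LIMSEQ\<close>) the constants of the theorem are
  \<open>1 / \<lambda> = ln (1 + 1 / g)\<close> and \<open>m\<^sub>x = h\<^sup>2 / (g (1 + g))\<close>.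

  Seen from time \<open>j\<close>, the future of the walk and its time-reversed past are independent walks with
  the same step law, so the local times of \<open>S\<^sub>j\<close> and \<open>S\<^sub>j + x\<close> are, up to one visit, the numbers of
  visits of a two-sided walk to \<open>0\<close> and \<open>x\<close>.  Their joint exponential moment
  \<open>E (u ^ N\<^sub>0 * z ^ N\<^sub>x)\<close> is computed by a Feynman-Kac argument: the function
  \<open>\<psi> = 1 + A G + B G(\<cdot> + x)\<close> is invariant under one weighted step as soon as \<open>A\<close> and \<open>B\<close> solve a linear
  \<open>2 \<times> 2\<close> system, and this needs only the Green function (\<open>exponential_moment_visits\<close>).
  With \<open>z = 1 + \<theta>\<close> the moment is finite up to a critical \<open>u\<close> whose logarithm is, by convexity, at
  least \<open>1 / \<lambda> - m\<^sub>x \<theta> / (1 - \<theta> g)\<close>.  Chernoff's bound then shows that for a site with at least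
  \<open>k \<approx> \<lambda> log n\<close> visits the event that its neighbour at \<open>x\<close> deviates from \<open>m\<^sub>x \<lambda> log n\<close> by a factor
  \<open>1 \<plusminus> \<epsilon>\<close> has probability at most \<open>exp (- k / \<lambda> - c m\<^sub>x log n)\<close> times a power of \<open>log n\<close>
  (\<open>local_time_deviation\<close>).

  To use this uniformly for \<open>x\<close> in the ball of radius \<open>r\<^sub>n\<close> one needs \<open>m\<^sub>x \<ge> c / r\<^sub>n ^ (2 d - 4)\<close>, that is
  \<open>G(x) \<ge> c \<bar>x\<bar> ^ (2 - d)\<close> (\<open>green_lower_bound\<close>).  This one-sided bound follows from second moments.
  Let \<open>\<phi>\<close> be the characteristic function and \<open>\<chi> = (1 + \<phi>) / 2\<close> the one of the lazy walk, which has
  no periodicity: \<open>1 - C \<bar>t\<bar>\<^sup>2 \<le> \<chi>(t) \<le> exp (- c \<bar>t\<bar>\<^sup>2)\<close> on the torus.  Hence \<open>\<integral> \<chi>\<^sup>n\<close> is of order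
  \<open>n ^ (- d / 2)\<close>, which gives transience, and replacing \<open>1\<close> by \<open>cos (x \<cdot> t)\<close> costs only
  \<open>\<bar>x\<bar>\<^sup>2 \<integral> \<chi>\<^sup>n \<bar>t\<bar>\<^sup>2 \<le> C \<bar>x\<bar>\<^sup>2 n ^ (- 1 - d / 2)\<close>; so the times \<open>n\<close> between \<open>N\<close> and \<open>2 N\<close> with
  \<open>N \<approx> K \<bar>x\<bar>\<^sup>2\<close> already contribute \<open>\<bar>x\<bar> ^ (2 - d)\<close>.

  Finally the events are summed over \<open>j \<le> n\<close> and over the ball for \<open>n = 2 ^ i\<close>.  The factor \<open>n\<close>
  cancels against \<open>exp (- k / \<lambda>)\<close> up to \<open>exp (\<delta>\<^sub>n log n)\<close>; this and all powers of \<open>log n\<close> are beaten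
  by \<open>exp (- c log n / r\<^sub>n ^ (2 d - 4))\<close>, which is exactly what the two limits in the hypotheses provide.
  The sum over \<open>i\<close> converges, the Borel-Cantelli lemma applies, and monotonicity in \<open>n\<close> of all
  quantities fills in the indices between consecutive powers of two.
\<close>

section \<open>Visits, hitting probabilities and the Green function\<close>

text \<open>
  Finite paths are lists of steps distributed according to \<open>replicate_pmf\<close>, so that all statements
  about finitely many steps become recursions on the first step.  Position \<open>0\<close> at time \<open>0\<close> does not
  count as a visit, matching the convention for local times.
\<close>

primrec visits :: "'v::ab_group_add \<Rightarrow> 'v list \<Rightarrow> nat" where
  "visits a [] = 0"
| "visits a (v # xs) = of_bool (v = a) + visits (a - v) xs"

abbreviation expect :: "'v pmf \<Rightarrow> ('v \<Rightarrow> real) \<Rightarrow> real" where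
  "expect p \<equiv> measure_pmf.expectation p"

definition walk_prob :: "'v::ab_group_add pmf \<Rightarrow> nat \<Rightarrow> 'v \<Rightarrow> real" where
  "walk_prob p n a = measure_pmf.prob (replicate_pmf n p) {xs. sum_list xs = a}"

definition hit_prob :: "'v::ab_group_add pmf \<Rightarrow> nat \<Rightarrow> 'v \<Rightarrow> real" where
  "hit_prob p n a = measure_pmf.prob (replicate_pmf n p) {xs. visits a xs \<noteq> 0}"

text \<open>
  The sum starts at time \<open>1\<close>; the usual Green function is \<open>of_bool (a = 0) + green p a\<close>.
\<close>

definition green :: "'v::ab_group_add pmf \<Rightarrow> 'v \<Rightarrow> real" where
  "green p a = (\<Sum>n. walk_prob p (Suc n) a)"

lemma replicate_pmf_Suc_map:
  "replicate_pmf (Suc n) p = bind_pmf p (\<lambda>v. map_pmf ((#) v) (replicate_pmf n p))"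
  by (simp add: map_pmf_def)

lemma nn_integral_replicate_Suc:
  "(\<integral>\<^sup>+xs. f xs \<partial>replicate_pmf (Suc n) p) = (\<integral>\<^sup>+v. (\<integral>\<^sup>+xs. f (v # xs) \<partial>replicate_pmf n p) \<partial>p)"
  unfolding replicate_pmf_Suc_map by simp

lemma integrable_pmf_bounded:
  fixes f :: "'v \<Rightarrow> real"
  assumes "\<And>v. \<bar>f v\<bar> \<le> B"
  shows "integrable (measure_pmf p) f"
  using assms by (intro measure_pmf.integrable_const_bound[where B = B]) auto

lemma prob_replicate_Suc:
  "measure_pmf.prob (replicate_pmf (Suc n) p) A =
   expect p (\<lambda>v. measure_pmf.prob (replicate_pmf n p) {xs. v # xs \<in> A})"
proof -
  have "ennreal (measure_pmf.prob (replicate_pmf (Suc n) p) A) =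
        (\<integral>\<^sup>+v. emeasure (replicate_pmf n p) {xs. v # xs \<in> A} \<partial>p)"
    unfolding measure_pmf.emeasure_eq_measure[symmetric] replicate_pmf_Suc_map
    by (simp add: vimage_def)
  also have "\<dots> = (\<integral>\<^sup>+v. ennreal (measure_pmf.prob (replicate_pmf n p) {xs. v # xs \<in> A}) \<partial>p)"
    by (simp add: measure_pmf.emeasure_eq_measure)
  also have "\<dots> = ennreal (expect p (\<lambda>v. measure_pmf.prob (replicate_pmf n p) {xs. v # xs \<in> A}))"
    by (intro nn_integral_eq_integral integrable_pmf_bounded[where B = 1]) (auto simp: measure_pmf.prob_le_1)
  finally show ?thesis by simp
qed

lemma walk_prob_nonneg [simp]: "walk_prob p n a \<ge> 0"
  by (simp add: walk_prob_def)

lemma walk_prob_le_1: "walk_prob p n a \<le> 1"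
  by (simp add: walk_prob_def measure_pmf.prob_le_1)

lemma hit_prob_nonneg [simp]: "hit_prob p n a \<ge> 0"
  by (simp add: hit_prob_def)

lemma hit_prob_le_1: "hit_prob p n a \<le> 1"
  by (simp add: hit_prob_def measure_pmf.prob_le_1)

lemma walk_prob_0: "walk_prob p 0 a = of_bool (a = 0)"
  by (simp add: walk_prob_def indicator_def)

lemma walk_prob_Suc: "walk_prob p (Suc n) a = expect p (\<lambda>v. walk_prob p n (a - v))"
  unfolding walk_prob_def prob_replicate_Suc by (simp add: algebra_simps eq_diff_eq)

lemma walk_prob_pos_iff:
  "walk_prob p n a > 0 \<longleftrightarrow> (\<exists>xs. set xs \<subseteq> set_pmf p \<and> length xs = n \<and> sum_list xs = a)"
proof -
  have "walk_prob p n a > 0 \<longleftrightarrow> set_pmf (replicate_pmf n p) \<inter> {xs. sum_list xs = a} \<noteq> {}"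
    unfolding walk_prob_def using measure_pmf_zero_iff[of "replicate_pmf n p"] by (simp add: zero_less_measure_iff)
  then show ?thesis by (auto simp: set_replicate_pmf)
qed

lemma hit_prob_0: "hit_prob p 0 a = 0"
  by (simp add: hit_prob_def)

lemma hit_prob_Suc: "hit_prob p (Suc n) a = expect p (\<lambda>v. if v = a then 1 else hit_prob p n (a - v))"
  unfolding hit_prob_def prob_replicate_Suc by (intro Bochner_Integration.integral_cong) auto

lemma partial_green_Suc:
  "(\<Sum>k<Suc n. walk_prob p (Suc k) a) =
   expect p (\<lambda>v. of_bool (v = a) + (\<Sum>k<n. walk_prob p (Suc k) (a - v)))"
proof -
  have int: "integrable p (\<lambda>v. walk_prob p k (a - v))" for k
    by (rule integrable_pmf_bounded[where B = 1]) (simp add: walk_prob_le_1)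
  have "(\<Sum>k<Suc n. walk_prob p (Suc k) a) = expect p (\<lambda>v. \<Sum>k<Suc n. walk_prob p k (a - v))"
    by (simp only: walk_prob_Suc Bochner_Integration.integral_sum int)
  also have "(\<lambda>v. \<Sum>k<Suc n. walk_prob p k (a - v)) =
      (\<lambda>v. of_bool (v = a) + (\<Sum>k<n. walk_prob p (Suc k) (a - v)))"
    unfolding sum.lessThan_Suc_shift by (auto simp: walk_prob_0)
  finally show ?thesis .
qed

lemma partial_green_nonneg: "0 \<le> (\<Sum>k<n. walk_prob p (Suc k) a)"
  by (intro sum_nonneg) auto

lemma partial_green_le: "(\<Sum>k<n. walk_prob p (Suc k) a) \<le> real n"
  using sum_bounded_above[of "{..<n}" "\<lambda>k. walk_prob p (Suc k) a" 1] walk_prob_le_1 by auto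

text \<open>
  At the first visit to \<open>a\<close> the walk starts afresh, so at most \<open>1 + \<Sum>\<close> (returns to \<open>0\<close>) further visits
  are expected.  Conditioning on the first step turns this into an induction on \<open>n\<close> and avoids
  first-passage times.
\<close>

lemma partial_green_le_hit:
  "(\<Sum>k<n. walk_prob p (Suc k) a) \<le> hit_prob p n a * (1 + (\<Sum>k<n. walk_prob p (Suc k) 0))"
proof (induction n arbitrary: a)
  case 0
  then show ?case by (simp add: hit_prob_0)
next
  case (Suc n)
  let ?G = "\<lambda>n a. \<Sum>k<n. walk_prob p (Suc k) a"
  have "?G (Suc n) a = expect p (\<lambda>v. of_bool (v = a) + ?G n (a - v))"
    by (rule partial_green_Suc)
  also have "\<dots> \<le> expect p (\<lambda>v. (if v = a then 1 else hit_prob p n (a - v)) * (1 + ?G n 0))"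
  proof (rule integral_mono)
    show "integrable p (\<lambda>v. of_bool (v = a) + ?G n (a - v))"
      by (rule integrable_pmf_bounded[where B = "1 + n"])
         (use partial_green_nonneg[of p _ n] partial_green_le[of p _ n] in \<open>auto simp: of_bool_def intro: order_trans[of _ "real n"]\<close>)
    show "integrable p (\<lambda>v. (if v = a then 1 else hit_prob p n (a - v)) * (1 + ?G n 0))"
      by (intro integrable_mult_left integrable_pmf_bounded[where B = 1]) (auto simp: hit_prob_le_1)
    show "of_bool (v = a) + ?G n (a - v) \<le> (if v = a then 1 else hit_prob p n (a - v)) * (1 + ?G n 0)" for v
      using Suc.IH[of "a - v"] by auto
  qed
  also have "\<dots> = hit_prob p (Suc n) a * (1 + ?G n 0)"
    by (simp add: hit_prob_Suc)
  also have "\<dots> \<le> hit_prob p (Suc n) a * (1 + ?G (Suc n) 0)"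
    by (intro mult_left_mono) auto
  finally show ?case .
qed

locale transient_walk =
  fixes p :: "'v::ab_group_add pmf"
  assumes transient: "summable (\<lambda>n. walk_prob p (Suc n) 0)"
begin

lemma partial_green_le_bound: "(\<Sum>k<n. walk_prob p (Suc k) a) \<le> 1 + green p 0"
proof -
  have le: "(\<Sum>k<n. walk_prob p (Suc k) 0) \<le> green p 0"
    unfolding green_def by (intro sum_le_suminf transient) auto
  have "(\<Sum>k<n. walk_prob p (Suc k) a) \<le> hit_prob p n a * (1 + (\<Sum>k<n. walk_prob p (Suc k) 0))"
    by (rule partial_green_le_hit)
  also have "\<dots> \<le> 1 * (1 + (\<Sum>k<n. walk_prob p (Suc k) 0))"
    by (intro mult_right_mono hit_prob_le_1) (auto intro!: add_nonneg_nonneg sum_nonneg)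
  finally show ?thesis using le by simp
qed

lemma summable_walk_prob: "summable (\<lambda>n. walk_prob p (Suc n) a)"
  by (rule bounded_imp_summable[where B = "1 + green p 0"])
     (auto simp: lessThan_Suc_atMost[symmetric] intro!: partial_green_le_bound simp del: sum.lessThan_Suc)

lemma partial_green_LIMSEQ: "(\<lambda>n. \<Sum>k<n. walk_prob p (Suc k) a) \<longlonglongrightarrow> green p a"
  unfolding green_def by (rule summable_LIMSEQ[OF summable_walk_prob])

lemma green_nonneg [simp]: "green p a \<ge> 0"
  unfolding green_def by (intro suminf_nonneg summable_walk_prob) auto

lemma green_le: "green p a \<le> 1 + green p 0"
  by (rule LIMSEQ_le_const2[OF partial_green_LIMSEQ]) (use partial_green_le_bound in auto)

lemma integrable_green: "integrable p (\<lambda>v. green p (f v))"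
  by (rule integrable_pmf_bounded[where B = "1 + green p 0"]) (simp add: green_le)

lemma integrable_of_bool: "integrable (measure_pmf p) (\<lambda>v. of_bool (P v) :: real)"
  by (rule integrable_pmf_bounded[where B = 1]) simp

lemma green_rec: "green p a = expect p (\<lambda>v. of_bool (v = a) + green p (a - v))"
proof (rule LIMSEQ_unique)
  show "(\<lambda>n. \<Sum>k<Suc n. walk_prob p (Suc k) a) \<longlonglongrightarrow> green p a"
    using partial_green_LIMSEQ by (rule LIMSEQ_Suc)
  show "(\<lambda>n. \<Sum>k<Suc n. walk_prob p (Suc k) a) \<longlonglongrightarrow> expect p (\<lambda>v. of_bool (v = a) + green p (a - v))"
    unfolding partial_green_Suc
  proof (rule integral_dominated_convergence[where w = "\<lambda>_. 2 + green p 0"])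
    show "AE x in measure_pmf p. (\<lambda>i. of_bool (x = a) + (\<Sum>k<i. walk_prob p (Suc k) (a - x)))
          \<longlonglongrightarrow> of_bool (x = a) + green p (a - x)"
      by (intro AE_I2 tendsto_intros partial_green_LIMSEQ)
    show "AE x in measure_pmf p. norm (of_bool (x = a) + (\<Sum>k<i. walk_prob p (Suc k) (a - x))) \<le> 2 + green p 0" for i
    proof (intro AE_I2)
      fix x
      show "norm (of_bool (x = a) + (\<Sum>k<i. walk_prob p (Suc k) (a - x))) \<le> 2 + green p 0"
        using partial_green_le_bound[of "a - x" i] partial_green_nonneg[of p "a - x" i] by (auto simp: of_bool_def)
    qed
  qed auto
qed

text \<open>
  Counting only the visits to \<open>a\<close> after the first visit to \<open>b\<close> gives a lower bound for all visits.
  For \<open>a = b\<close> this is the converse of \<open>partial_green_le_hit\<close>.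
\<close>

lemma green_ge_hit: "hit_prob p n b * (of_bool (a = b) + green p (a - b)) \<le> green p a"
proof (induction n arbitrary: a b)
  case 0
  then show ?case by (simp add: hit_prob_0)
next
  case (Suc n)
  let ?c = "of_bool (a = b) + green p (a - b)"
  have "hit_prob p (Suc n) b * ?c = expect p (\<lambda>v. (if v = b then 1 else hit_prob p n (b - v)) * ?c)"
    by (simp add: hit_prob_Suc)
  also have "\<dots> \<le> expect p (\<lambda>v. of_bool (v = a) + green p (a - v))"
  proof (rule integral_mono)
    show "integrable p (\<lambda>v. (if v = b then 1 else hit_prob p n (b - v)) * ?c)"
      by (intro integrable_mult_left integrable_pmf_bounded[where B = 1]) (auto simp: hit_prob_le_1)
    show "integrable p (\<lambda>v. of_bool (v = a) + green p (a - v))"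
      by (intro Bochner_Integration.integrable_add integrable_green integrable_of_bool)
    show "(if v = b then 1 else hit_prob p n (b - v)) * ?c \<le> of_bool (v = a) + green p (a - v)" for v
      using Suc.IH[of "b - v" "a - v"] by (auto simp: algebra_simps)
  qed
  also have "\<dots> = green p a" by (rule green_rec[symmetric])
  finally show ?case .
qed

text \<open>
  The first-passage identity: the probability of ever hitting \<open>a\<close> is \<open>G(a) / (1 + G(0))\<close>.
\<close>

lemma hit_prob_LIMSEQ: "(\<lambda>n. hit_prob p n a) \<longlonglongrightarrow> green p a / (1 + green p 0)"
proof (rule real_tendsto_sandwich)
  have pos: "0 < 1 + (\<Sum>k<n. walk_prob p (Suc k) 0)" for n
    by (intro add_pos_nonneg partial_green_nonneg) auto
  show "(\<lambda>n. (\<Sum>k<n. walk_prob p (Suc k) a) / (1 + (\<Sum>k<n. walk_prob p (Suc k) 0))) \<longlonglongrightarrow> green p a / (1 + green p 0)"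
    by (intro tendsto_intros partial_green_LIMSEQ) (use green_nonneg[of 0] in linarith)
  show "\<forall>\<^sub>F n in sequentially. (\<Sum>k<n. walk_prob p (Suc k) a) / (1 + (\<Sum>k<n. walk_prob p (Suc k) 0)) \<le> hit_prob p n a"
    using partial_green_le_hit[of p a] pos by (auto simp: divide_le_eq)
  show "\<forall>\<^sub>F n in sequentially. hit_prob p n a \<le> green p a / (1 + green p 0)"
    using green_ge_hit[where b = a and a = a] green_nonneg[of 0] by (intro always_eventually allI) (simp add: pos_le_divide_eq add_pos_nonneg)
qed auto

lemma green_ge_green: "green p b * green p (a - b) \<le> green p a * (1 + green p 0)"
proof -
  have "(\<lambda>n. hit_prob p n b * green p (a - b)) \<longlonglongrightarrow> green p b / (1 + green p 0) * green p (a - b)"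
    by (intro tendsto_intros hit_prob_LIMSEQ)
  moreover have "hit_prob p n b * green p (a - b) \<le> green p a" for n
    by (rule order_trans[OF _ green_ge_hit[where n = n and b = b and a = a]]) (intro mult_left_mono, auto)
  ultimately have "green p b / (1 + green p 0) * green p (a - b) \<le> green p a"
    by (intro LIMSEQ_le_const2) auto
  then show ?thesis using green_nonneg[of 0] by (simp add: field_simps)
qed

lemma green_mult_green_uminus_le: "green p b * green p (- b) \<le> green p 0 * (1 + green p 0)"
  using green_ge_green[of b 0] by simp

end

section \<open>Exponential moments of the visits to two sites\<close>

text \<open>
  The Feynman-Kac principle.  A visit to \<open>a\<close> is weighted by \<open>u\<close> and one to \<open>a + x\<close> by \<open>z\<close>; a function \<open>\<psi>\<close>
  that is invariant under one weighted step and bounded below by \<open>c\<close> dominates the expected weight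
  of a path, whatever its length, up to the factor \<open>1 / c\<close>.
\<close>

lemma weighted_visits_le:
  fixes p :: "'v::ab_group_add pmf"
  assumes x: "x \<noteq> 0" and u: "u \<ge> 0" and z: "z \<ge> 0"
    and rec: "\<And>a. \<psi> a = expect p
               (\<lambda>v. (if v = a then u else if v = a + x then z else 1) * \<psi> (a - v))"
    and lower: "\<And>a. c \<le> \<psi> a" and c: "c > 0" and upper: "\<And>a. \<psi> a \<le> K"
  shows "(\<integral>\<^sup>+xs. ennreal (u ^ visits a xs * z ^ visits (a + x) xs) \<partial>replicate_pmf n p) \<le> ennreal (\<psi> a / c)"
proof (induction n arbitrary: a)
  case 0
  then show ?case using lower[of a] c by (simp add: pmf_expectation_bind)
next
  case (Suc n)
  define w where "w v = (if v = a then u else if v = a + x then z else 1)" for v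
  have w0: "w v \<ge> 0" for v using u z by (simp add: w_def)
  have \<psi>0: "\<psi> b \<ge> 0" for b using lower[of b] c by simp
  have "(\<integral>\<^sup>+xs. ennreal (u ^ visits a xs * z ^ visits (a + x) xs) \<partial>replicate_pmf (Suc n) p)
      = (\<integral>\<^sup>+v. (\<integral>\<^sup>+xs. ennreal (w v) * ennreal (u ^ visits (a - v) xs * z ^ visits (a - v + x) xs) \<partial>replicate_pmf n p) \<partial>p)"
    unfolding nn_integral_replicate_Suc
  proof (intro nn_integral_cong)
    fix v xs
    show "ennreal (u ^ visits a (v # xs) * z ^ visits (a + x) (v # xs)) =
          ennreal (w v) * ennreal (u ^ visits (a - v) xs * z ^ visits (a - v + x) xs)"
      using x u z by (simp add: w_def ennreal_mult[symmetric] algebra_simps)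
  qed
  also have "\<dots> = (\<integral>\<^sup>+v. ennreal (w v) * (\<integral>\<^sup>+xs. ennreal (u ^ visits (a - v) xs * z ^ visits (a - v + x) xs) \<partial>replicate_pmf n p) \<partial>p)"
    by (intro nn_integral_cong nn_integral_cmult) auto
  also have "\<dots> \<le> (\<integral>\<^sup>+v. ennreal (w v) * ennreal (\<psi> (a - v) / c) \<partial>p)"
    by (intro nn_integral_mono mult_left_mono Suc.IH) auto
  also have "\<dots> = (\<integral>\<^sup>+v. ennreal (w v * \<psi> (a - v) / c) \<partial>p)"
    using w0 \<psi>0 c by (intro nn_integral_cong) (simp add: ennreal_mult[symmetric])
  also have "\<dots> = ennreal (expect p (\<lambda>v. w v * \<psi> (a - v) / c))"
  proof (rule nn_integral_eq_integral)
    show "integrable p (\<lambda>v. w v * \<psi> (a - v) / c)"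
    proof (rule integrable_pmf_bounded[where B = "max 1 (max u z) * K / c"])
      fix v
      have "w v * \<psi> (a - v) / c \<le> max 1 (max u z) * K / c"
        using c upper[of "a - v"] \<psi>0[of "a - v"] u by (intro divide_right_mono mult_mono) (auto simp: w_def)
      then show "\<bar>w v * \<psi> (a - v) / c\<bar> \<le> max 1 (max u z) * K / c"
        using w0[of v] \<psi>0[of "a - v"] c by simp
    qed
    show "AE v in p. 0 \<le> w v * \<psi> (a - v) / c" using w0 \<psi>0 c by simp
  qed
  also have "expect p (\<lambda>v. w v * \<psi> (a - v) / c) = \<psi> a / c"
    unfolding rec[of a] w_def by simp
  finally show ?case .
qed

locale symmetric_transient_walk = transient_walk p for p :: "'v::ab_group_add pmf" +
  assumes symm: "map_pmf uminus p = p"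
begin

lemma walk_prob_uminus: "walk_prob p n (- a) = walk_prob p n a"
proof (induction n arbitrary: a)
  case (Suc n)
  have "walk_prob p (Suc n) (- a) = expect (map_pmf uminus p) (\<lambda>v. walk_prob p n (- a - v))"
    by (simp add: walk_prob_Suc symm)
  also have "\<dots> = expect p (\<lambda>v. walk_prob p n (- (a - v)))"
    by (simp add: algebra_simps)
  also have "\<dots> = walk_prob p (Suc n) a"
    by (simp only: Suc.IH walk_prob_Suc)
  finally show ?case .
qed (simp add: walk_prob_0)

lemma green_uminus: "green p (- a) = green p a"
  by (simp add: green_def walk_prob_uminus)

text \<open>
  Since \<open>G = E (1 + G)\<close> with the \<open>1\<close> present only on the site itself, the ansatz
  \<open>\<psi>(a) = 1 + A G(a) + B G(a + x)\<close> is invariant exactly if \<open>A = (u - 1) \<psi>(0)\<close> and \<open>B = \<theta> \<psi>(- x)\<close>.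
  Eliminating \<open>B\<close> leaves \<open>\<psi>(0) (1 - (u - 1) \<kappa>) = 1 + \<theta> h / (1 - \<theta> g)\<close>, so \<open>u\<close> is critical when
  \<open>(u - 1) \<kappa> = 1\<close>; the parameter \<open>\<eta>\<close> is the relative distance to criticality.
\<close>

lemma exponential_moment_visits:
  fixes x :: 'v and \<theta> \<eta> :: real
  defines "g \<equiv> green p 0" and "h \<equiv> green p x"
  defines "\<kappa> \<equiv> g + \<theta> * h\<^sup>2 / (1 - \<theta> * g)"
  defines "u \<equiv> 1 + (1 - \<eta>) / \<kappa>"
  assumes x: "x \<noteq> 0" and g: "g > 0" and \<theta>: "\<bar>\<theta>\<bar> * (1 + g) \<le> 1 / 2" and \<eta>: "0 < \<eta>" "\<eta> < 1"
  shows "\<kappa> > 0"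
    and "(\<integral>\<^sup>+xs. ennreal (u ^ visits 0 xs * (1 + \<theta>) ^ visits x xs) \<partial>replicate_pmf n p) \<le> ennreal (4 / \<eta>)"
proof -
  have h0: "h \<ge> 0" and hg: "h \<le> 1 + g" by (simp_all add: h_def g_def green_le)
  have h2: "h\<^sup>2 \<le> g * (1 + g)"
    using green_mult_green_uminus_le[of x] by (simp add: h_def g_def green_uminus power2_eq_square)
  have tg: "\<bar>\<theta>\<bar> * g \<le> 1/2" and th: "\<bar>\<theta>\<bar> * h \<le> 1/2" and t1: "\<bar>\<theta>\<bar> \<le> 1/2"
    using \<theta> g hg mult_left_mono[of g "1 + g" "\<bar>\<theta>\<bar>"] mult_left_mono[of h "1 + g" "\<bar>\<theta>\<bar>"] mult_left_mono[of 1 "1 + g" "\<bar>\<theta>\<bar>"]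
    by auto
  have "\<bar>\<theta> * g\<bar> \<le> 1/2" "\<bar>\<theta> * h\<bar> \<le> 1/2" using tg th g h0 by (simp_all add: abs_mult)
  then have atg: "\<theta> * g \<le> 1/2" "- (\<theta> * g) \<le> 1/2" and ath: "\<theta> * h \<le> 1/2" "- (\<theta> * h) \<le> 1/2"
    by linarith+
  define d where "d = 1 - \<theta> * g"
  have d: "d \<ge> 1/2" using atg by (simp add: d_def)
  show \<kappa>0: "\<kappa> > 0"
  proof (cases "\<theta> \<ge> 0")
    case True
    then show ?thesis using d g by (auto simp: \<kappa>_def d_def[symmetric] intro!: add_pos_nonneg)
  next
    case False
    have "d \<ge> 1" using False g by (auto simp: d_def mult_nonpos_nonneg)
    have "\<bar>\<theta>\<bar> * h\<^sup>2 / d \<le> \<bar>\<theta>\<bar> * h\<^sup>2"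
      using divide_left_mono[of 1 d "\<bar>\<theta>\<bar> * h\<^sup>2"] \<open>d \<ge> 1\<close> by simp
    also have "\<dots> \<le> \<bar>\<theta>\<bar> * (g * (1 + g))" by (intro mult_left_mono h2) auto
    also have "\<dots> = (\<bar>\<theta>\<bar> * (1 + g)) * g" by simp
    also have "\<dots> \<le> 1/2 * g" using \<theta> g by (intro mult_right_mono) auto
    finally show ?thesis using False g by (simp add: \<kappa>_def d_def[symmetric])
  qed
  define \<psi>0 where "\<psi>0 = (1 + \<theta> * h / d) / \<eta>"
  define A where "A = (1 - \<eta>) / \<kappa> * \<psi>0"
  define \<psi>x where "\<psi>x = (1 + A * h) / d"
  define \<psi> where "\<psi> a = 1 + A * green p a + \<theta> * \<psi>x * green p (a + x)" for a
  have "\<theta> * h / d \<le> 1" using ath d by (auto simp: divide_le_eq)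
  moreover have "\<theta> * h / d \<ge> - 1" using ath d by (auto simp: le_divide_eq)
  ultimately have \<psi>0: "0 \<le> \<psi>0" "\<psi>0 \<le> 2 / \<eta>" using \<eta> unfolding \<psi>0_def by (auto intro!: divide_right_mono divide_nonneg_pos)
  have A: "A \<ge> 0" using \<psi>0 \<eta> \<kappa>0 by (simp add: A_def)
  have \<psi>x: "\<psi>x \<ge> 0" using A h0 d by (simp add: \<psi>x_def)
  \<comment> \<open>\<open>\<psi>0\<close> and \<open>\<psi>x\<close> were defined as the solution of the linear system; now they are values of \<open>\<psi>\<close>.\<close>
  have e1: "\<theta> * \<psi>x = \<theta> / d * (1 + A * h)" by (simp add: \<psi>x_def)
  have "A * \<kappa> = (1 - \<eta>) * \<psi>0" using \<kappa>0 by (simp add: A_def)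
  then have "A * g + \<theta> * h * (A * h) / d = \<psi>0 - \<eta> * \<psi>0"
    by (simp add: \<kappa>_def d_def[symmetric] algebra_simps power2_eq_square)
  moreover have "\<eta> * \<psi>0 = 1 + \<theta> * h / d" using \<eta> by (simp add: \<psi>0_def)
  ultimately have eq0: "\<psi> 0 = \<psi>0"
    unfolding \<psi>_def e1 by (simp add: g_def[symmetric] h_def[symmetric] algebra_simps add_divide_distrib)
  have eqx: "\<psi> (- x) = \<psi>x"
  proof -
    have "\<psi>x * d = 1 + A * h" using d by (simp add: \<psi>x_def)
    then show ?thesis unfolding \<psi>_def by (simp add: g_def[symmetric] h_def[symmetric] green_uminus d_def algebra_simps)
  qed
  have rec: "\<psi> a = expect p (\<lambda>v. (if v = a then u else if v = a + x then 1 + \<theta> else 1) * \<psi> (a - v))" for a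
  proof -
    have "\<psi> a = 1 + A * expect p (\<lambda>v. of_bool (v = a) + green p (a - v))
              + \<theta> * \<psi>x * expect p (\<lambda>v. of_bool (v = a + x) + green p (a + x - v))"
      by (simp only: \<psi>_def green_rec[symmetric])
    also have "\<dots> = expect p (\<lambda>v. 1 + A * (of_bool (v = a) + green p (a - v))
              + \<theta> * \<psi>x * (of_bool (v = a + x) + green p (a + x - v)))"
      by (simp add: integrable_green integrable_of_bool)
    also have "\<dots> = expect p (\<lambda>v. (if v = a then u else if v = a + x then 1 + \<theta> else 1) * \<psi> (a - v))"
    proof (intro Bochner_Integration.integral_cong refl)
      fix v
      have Au: "A = (u - 1) * \<psi> 0" by (simp add: eq0 A_def u_def)
      have s: "\<psi> (a - v) = 1 + A * green p (a - v) + \<theta> * \<psi>x * green p (a + x - v)"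
        by (simp add: \<psi>_def algebra_simps)
      have "1 + A * (of_bool (v = a) + green p (a - v)) + \<theta> * \<psi>x * (of_bool (v = a + x) + green p (a + x - v))
            = \<psi> (a - v) + A * of_bool (v = a) + \<theta> * \<psi>x * of_bool (v = a + x)"
        unfolding s by (simp add: algebra_simps)
      also have "\<dots> = (if v = a then u else if v = a + x then 1 + \<theta> else 1) * \<psi> (a - v)"
        using x by (auto simp: Au eqx algebra_simps)
      finally show "1 + A * (of_bool (v = a) + green p (a - v)) + \<theta> * \<psi>x * (of_bool (v = a + x) + green p (a + x - v))
            = (if v = a then u else if v = a + x then 1 + \<theta> else 1) * \<psi> (a - v)" .
    qed
    finally show ?thesis .
  qed
  \<comment> \<open>For negative \<open>\<theta>\<close> the last term of \<open>\<psi>\<close> is absorbed by the second one because \<open>G(- x) G(a + x) \<le> G(a) (1 + g)\<close>.\<close>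
  have lower: "1/2 \<le> \<psi> a" for a
  proof (cases "\<theta> \<ge> 0")
    case True
    then show ?thesis using A \<psi>x by (simp add: \<psi>_def)
  next
    case False
    have d1: "d \<ge> 1" using False g by (auto simp: d_def mult_nonpos_nonneg)
    have "\<psi>x \<le> 1 + A * h" using divide_left_mono[of 1 d "1 + A * h"] d1 A h0 by (simp add: \<psi>x_def)
    then have "\<bar>\<theta>\<bar> * \<psi>x * green p (a + x) \<le> \<bar>\<theta>\<bar> * (1 + A * h) * green p (a + x)"
      by (intro mult_left_mono mult_right_mono) auto
    also have "\<dots> = \<bar>\<theta>\<bar> * green p (a + x) + A * (\<bar>\<theta>\<bar> * (h * green p (a + x)))"
      by (simp add: algebra_simps)
    also have "\<bar>\<theta>\<bar> * green p (a + x) \<le> 1/2"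
      using \<theta> mult_left_mono[OF green_le[of "a + x"], of "\<bar>\<theta>\<bar>"] by (simp add: g_def)
    also have "\<bar>\<theta>\<bar> * (h * green p (a + x)) \<le> \<bar>\<theta>\<bar> * (green p a * (1 + g))"
      using green_ge_green[of "- x" a] by (intro mult_left_mono) (auto simp: h_def g_def green_uminus)
    also have "\<dots> = (\<bar>\<theta>\<bar> * (1 + g)) * green p a" by simp
    also have "\<dots> \<le> 1 * green p a" using \<theta> by (intro mult_right_mono) auto
    finally have "\<bar>\<theta>\<bar> * \<psi>x * green p (a + x) \<le> 1/2 + A * green p a" using A by (simp add: mult_left_mono)
    then show ?thesis using False by (simp add: \<psi>_def)
  qed
  have upper: "\<psi> a \<le> 1 + A * (1 + g) + \<bar>\<theta>\<bar> * \<psi>x * (1 + g)" for a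
    unfolding \<psi>_def using A \<psi>x green_le by (intro add_mono mult_mono) (auto simp: g_def intro!: mult_right_mono)
  have "(\<integral>\<^sup>+xs. ennreal (u ^ visits 0 xs * (1 + \<theta>) ^ visits (0 + x) xs) \<partial>replicate_pmf n p) \<le> ennreal (\<psi> 0 / (1/2))"
  proof (rule weighted_visits_le[OF x _ _ rec lower _ upper])
    show "u \<ge> 0" using \<kappa>0 \<eta> by (simp add: u_def)
    show "1 + \<theta> \<ge> 0" using t1 by linarith
  qed auto
  also have "\<dots> \<le> ennreal (4 / \<eta>)" using \<psi>0 by (intro ennreal_leI) (simp add: eq0)
  finally show "(\<integral>\<^sup>+xs. ennreal (u ^ visits 0 xs * (1 + \<theta>) ^ visits x xs) \<partial>replicate_pmf n p) \<le> ennreal (4 / \<eta>)"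
    by simp
qed

end

section \<open>The two-sided walk\<close>

lemma pmf_replicate_pmf:
  "pmf (replicate_pmf n p) xs = (if length xs = n then prod_list (map (pmf p) xs) else 0)"
proof (induction n arbitrary: xs)
  case 0
  then show ?case by auto
next
  case (Suc n)
  show ?case
  proof (cases xs)
    case Nil
    then show ?thesis by (simp add: pmf_eq_0_set_pmf set_replicate_pmf del: replicate_pmf.simps)
  next
    case (Cons x ys)
    have "pmf (replicate_pmf (Suc n) p) xs = expect p (\<lambda>v. measure_pmf.prob (replicate_pmf n p) {zs. v # zs \<in> {xs}})"
      by (simp only: prob_replicate_Suc[symmetric] pmf.rep_eq)
    also have "(\<lambda>v. measure_pmf.prob (replicate_pmf n p) {zs. v # zs \<in> {xs}}) = (\<lambda>v. indicator {x} v * pmf (replicate_pmf n p) ys)"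
    proof
      fix v
      have "{zs. v # zs \<in> {xs}} = (if v = x then {ys} else {})" using Cons by auto
      then show "measure_pmf.prob (replicate_pmf n p) {zs. v # zs \<in> {xs}} = indicator {x} v * pmf (replicate_pmf n p) ys"
        by (simp add: measure_pmf_single)
    qed
    also have "expect p (\<lambda>v. indicator {x} v * pmf (replicate_pmf n p) ys) = pmf p x * pmf (replicate_pmf n p) ys"
      by (simp add: measure_pmf_single)
    finally show ?thesis using Cons by (simp add: Suc.IH)
  qed
qed

lemma map_rev_replicate_pmf: "map_pmf rev (replicate_pmf n p) = replicate_pmf n p"
proof (rule pmf_eqI)
  fix xs
  have "pmf (map_pmf rev (replicate_pmf n p)) xs = pmf (map_pmf rev (replicate_pmf n p)) (rev (rev xs))" by simp
  also have "\<dots> = pmf (replicate_pmf n p) (rev xs)" by (rule pmf_map_inj') (simp add: inj_def)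
  also have "\<dots> = pmf (replicate_pmf n p) xs"
    by (simp add: pmf_replicate_pmf rev_map[symmetric] prod_list.rev)
  finally show "pmf (map_pmf rev (replicate_pmf n p)) xs = pmf (replicate_pmf n p) xs" .
qed

text \<open>
  The steps before and after time \<open>j\<close> are independent, and reversing the order of the former does not
  change their law.
\<close>

lemma nn_integral_replicate_split:
  "(\<integral>\<^sup>+xs. f (drop j xs) * h (rev (take j xs)) \<partial>replicate_pmf (j + n) p)
   = (\<integral>\<^sup>+ys. h ys \<partial>replicate_pmf j p) * (\<integral>\<^sup>+zs. f zs \<partial>replicate_pmf n p)"
proof -
  have "(\<integral>\<^sup>+xs. f (drop j xs) * h (rev (take j xs)) \<partial>replicate_pmf (j + n) p)
      = (\<integral>\<^sup>+ys. (\<integral>\<^sup>+zs. f (drop j (ys @ zs)) * h (rev (take j (ys @ zs))) \<partial>replicate_pmf n p) \<partial>replicate_pmf j p)"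
    by (simp add: replicate_pmf_distrib)
  also have "\<dots> = (\<integral>\<^sup>+ys. (\<integral>\<^sup>+zs. h (rev ys) * f zs \<partial>replicate_pmf n p) \<partial>replicate_pmf j p)"
    by (intro nn_integral_cong_AE AE_pmfI nn_integral_cong) (auto simp: set_replicate_pmf mult.commute)
  also have "\<dots> = (\<integral>\<^sup>+ys. h (rev ys) \<partial>replicate_pmf j p) * (\<integral>\<^sup>+zs. f zs \<partial>replicate_pmf n p)"
    by (simp add: nn_integral_cmult nn_integral_multc)
  also have "(\<integral>\<^sup>+ys. h (rev ys) \<partial>replicate_pmf j p) = (\<integral>\<^sup>+ys. h ys \<partial>map_pmf rev (replicate_pmf j p))"
    by simp
  finally show ?thesis by (simp only: map_rev_replicate_pmf)
qed

text \<open>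
  The second summand follows the path backwards from time \<open>j\<close>.  Its steps enter with the opposite
  sign, hence the target \<open>- x\<close>.
\<close>

definition two_sided_visits :: "nat \<Rightarrow> 'v::ab_group_add \<Rightarrow> 'v list \<Rightarrow> nat" where
  "two_sided_visits j x xs = visits x (drop j xs) + visits (- x) (rev (take j xs))"

text \<open>
  The tangent of the convex function \<open>ln (1 + 1 / \<kappa>)\<close> at \<open>g\<close>.
\<close>

lemma ln_one_plus_inverse_ge:
  fixes g \<kappa> :: real
  assumes "g > 0" "\<kappa> > 0"
  shows "ln (1 + 1 / g) - (\<kappa> - g) / (g * (1 + g)) \<le> ln (1 + 1 / \<kappa>)"
proof -
  have eq: "(1 + 1 / g) / (1 + 1 / \<kappa>) - 1 = (\<kappa> - g) / (g * (1 + \<kappa>))"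
  proof -
    have "1 + 1 / g = (1 + g) / g" "1 + 1 / \<kappa> = (1 + \<kappa>) / \<kappa>" "1 + \<kappa> \<noteq> 0" using assms by (auto simp: field_simps)
    then show ?thesis using assms by (simp add: divide_simps) (simp add: algebra_simps)
  qed
  have "ln (1 + 1 / g) - ln (1 + 1 / \<kappa>) = ln ((1 + 1 / g) / (1 + 1 / \<kappa>))"
    using assms by (subst ln_div) (auto simp: add_pos_pos add_nonneg_eq_0_iff)
  also have "\<dots> \<le> (1 + 1 / g) / (1 + 1 / \<kappa>) - 1"
    using assms by (intro ln_le_minus_one divide_pos_pos add_pos_pos) auto
  also have "\<dots> = (\<kappa> - g) / (g * (1 + \<kappa>))" by (rule eq)
  also have "\<dots> \<le> (\<kappa> - g) / (g * (1 + g))"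
  proof (cases "\<kappa> \<ge> g")
    case True
    then show ?thesis using assms by (intro divide_left_mono mult_left_mono) auto
  next
    case False
    then show ?thesis using assms by (intro divide_left_mono_neg mult_left_mono) auto
  qed
  finally show ?thesis by simp
qed

context symmetric_transient_walk
begin

text \<open>
  Chernoff's bound with the exponential moment above for future and past.  The choice
  \<open>\<eta> = 1 / (k + 1)\<close> loses only the factor \<open>e\<close> in \<open>u ^ (k - 1)\<close> and costs a quadratic factor in \<open>k\<close>.
  For \<open>\<theta> \<ge> 0\<close> the bound concerns many visits to \<open>x\<close>, for \<open>\<theta> < 0\<close> few.
\<close>

lemma two_sided_tail:
  fixes x :: 'v and \<theta> k y :: real
  defines "g \<equiv> green p 0" and "h \<equiv> green p x"
  defines "m \<equiv> h\<^sup>2 / (g * (1 + g))"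
  assumes x: "x \<noteq> 0" and g: "g > 0" and \<theta>: "\<bar>\<theta>\<bar> * (1 + g) \<le> 1 / 2" and k: "k \<ge> 1"
  shows "measure_pmf.prob (replicate_pmf (j + n) p)
           {xs. k - 1 \<le> two_sided_visits j 0 xs \<and>
                (if \<theta> \<ge> 0 then y \<le> two_sided_visits j x xs else two_sided_visits j x xs \<le> y)}
         \<le> 16 * exp 1 * (k + 1)\<^sup>2 * exp (- (k - 1) * (ln (1 + 1 / g) - m * \<theta> / (1 - \<theta> * g)) - y * ln (1 + \<theta>))"
    (is "measure_pmf.prob ?P ?E \<le> _")
proof -
  define \<eta> where "\<eta> = 1 / (k + 1)"
  have \<eta>: "0 < \<eta>" "\<eta> < 1" using k by (auto simp: \<eta>_def)
  define \<kappa> where "\<kappa> = g + \<theta> * h\<^sup>2 / (1 - \<theta> * g)"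
  define u where "u = 1 + (1 - \<eta>) / \<kappa>"
  note wv = exponential_moment_visits[OF x g[unfolded g_def] \<theta>[unfolded g_def] \<eta>, folded g_def h_def, folded \<kappa>_def, folded u_def]
  have x': "- x \<noteq> 0" using x by simp
  note wv' = exponential_moment_visits[OF x' g[unfolded g_def] \<theta>[unfolded g_def] \<eta>, unfolded green_uminus, folded g_def h_def, folded \<kappa>_def, folded u_def]
  have \<kappa>: "\<kappa> > 0" by (rule wv(1))
  have u: "u \<ge> 1" using \<kappa> \<eta> by (simp add: u_def)
  have "\<bar>\<theta>\<bar> \<le> 1/2" using \<theta> g mult_left_mono[of 1 "1 + g" "\<bar>\<theta>\<bar>"] by auto
  then have z: "1 + \<theta> > 0" by linarith
  define c where "c = u powr (k - 1) * (1 + \<theta>) powr y"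
  have c: "c > 0" using u z by (simp add: c_def)
  define F where "F xs = u ^ visits 0 xs * (1 + \<theta>) ^ visits x xs" for xs
  define F' where "F' xs = u ^ visits 0 xs * (1 + \<theta>) ^ visits (- x) xs" for xs
  have nonneg: "F xs \<ge> 0" "F' xs \<ge> 0" for xs using u z by (auto simp: F_def F'_def)
  have "ennreal c * emeasure ?P ?E = (\<integral>\<^sup>+xs. ennreal c * indicator ?E xs \<partial>?P)"
    by (rule nn_integral_cmult_indicator[symmetric]) simp
  also have "\<dots> \<le> (\<integral>\<^sup>+xs. ennreal (F (drop j xs)) * ennreal (F' (rev (take j xs))) \<partial>?P)"
  proof (rule nn_integral_mono)
    fix xs
    have "c \<le> F (drop j xs) * F' (rev (take j xs))" if "xs \<in> ?E"
    proof -
      have "F (drop j xs) * F' (rev (take j xs)) = u ^ two_sided_visits j 0 xs * (1 + \<theta>) ^ two_sided_visits j x xs"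
        by (simp add: F_def F'_def two_sided_visits_def power_add)
      also have "\<dots> = u powr two_sided_visits j 0 xs * (1 + \<theta>) powr two_sided_visits j x xs"
        using u z by (simp add: powr_realpow)
      also have "\<dots> \<ge> c" unfolding c_def
      proof (intro mult_mono)
        show "u powr (k - 1) \<le> u powr two_sided_visits j 0 xs" using that u by (intro powr_mono) auto
        show "(1 + \<theta>) powr y \<le> (1 + \<theta>) powr two_sided_visits j x xs"
        proof (cases "\<theta> \<ge> 0")
          case True
          then show ?thesis using that by (intro powr_mono) auto
        next
          case False
          then show ?thesis using that z by (intro powr_mono') auto
        qed
      qed auto
      finally show ?thesis .
    qed
    then show "ennreal c * indicator ?E xs \<le> ennreal (F (drop j xs)) * ennreal (F' (rev (take j xs)))"
      using nonneg c by (auto simp: indicator_def ennreal_mult[symmetric] intro!: ennreal_leI)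
  qed
  also have "\<dots> = (\<integral>\<^sup>+ys. ennreal (F' ys) \<partial>replicate_pmf j p) * (\<integral>\<^sup>+zs. ennreal (F zs) \<partial>replicate_pmf n p)"
    by (rule nn_integral_replicate_split)
  also have "\<dots> \<le> ennreal (4 / \<eta>) * ennreal (4 / \<eta>)"
    unfolding F_def F'_def by (intro mult_mono wv(2) wv'(2)) auto
  also have "\<dots> = ennreal ((4 / \<eta>)\<^sup>2)" using \<eta> by (simp add: ennreal_mult[symmetric] power2_eq_square)
  finally have "c * measure_pmf.prob ?P ?E \<le> (4 / \<eta>)\<^sup>2"
    using c \<eta> by (simp add: measure_pmf.emeasure_eq_measure ennreal_mult[symmetric])
  then have "measure_pmf.prob ?P ?E \<le> (4 / \<eta>)\<^sup>2 / c" using c by (simp only: pos_le_divide_eq mult.commute)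
  also have "\<dots> = 16 * (k + 1)\<^sup>2 / c" using k by (simp add: \<eta>_def power2_eq_square algebra_simps)
  also have "\<dots> \<le> 16 * (k + 1)\<^sup>2 / exp ((k - 1) * (ln (1 + 1 / g) - m * \<theta> / (1 - \<theta> * g)) - 1 + y * ln (1 + \<theta>))"
  proof (intro divide_left_mono)
    define B where "B = ln (1 + 1 / g) - m * \<theta> / (1 - \<theta> * g)"
    have "B \<le> ln (1 + 1 / \<kappa>)"
      using ln_one_plus_inverse_ge[OF g \<kappa>] by (simp add: B_def \<kappa>_def m_def field_simps)
    moreover have "(k - 1) * ln (1 - \<eta>) \<ge> -1"
    proof -
      have e: "1 - \<eta> = k / (k + 1)" "1 + 1 / k = (k + 1) / k" using k by (auto simp: \<eta>_def field_simps)
      have "ln (1 - \<eta>) = - ln (1 + 1 / k)"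
        unfolding e using k by (simp add: ln_div)
      moreover have "ln (1 + 1 / k) \<le> 1 / k" using k by (intro ln_add_one_self_le_self) auto
      ultimately have "(k - 1) * (- (1/k)) \<le> (k - 1) * ln (1 - \<eta>)" using k by (intro mult_left_mono) auto
      moreover have "(k - 1) * (- (1/k)) \<ge> -1" using k by (simp add: field_simps)
      ultimately show ?thesis by linarith
    qed
    ultimately have "(k - 1) * B - 1 \<le> (k - 1) * (ln (1 - \<eta>) + ln (1 + 1 / \<kappa>))"
      using k mult_left_mono[of B "ln (1 + 1 / \<kappa>)" "k - 1"] by (simp add: algebra_simps)
    also have "ln (1 - \<eta>) + ln (1 + 1 / \<kappa>) = ln ((1 - \<eta>) * (1 + 1 / \<kappa>))"
      using \<eta> \<kappa> by (subst ln_mult) (auto simp: add_pos_pos add_nonneg_eq_0_iff)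
    also have "(k - 1) * \<dots> \<le> (k - 1) * ln u"
    proof (intro mult_left_mono ln_mono)
      show "(1 - \<eta>) * (1 + 1 / \<kappa>) \<le> u" using \<eta> by (simp add: u_def algebra_simps)
      show "0 < (1 - \<eta>) * (1 + 1 / \<kappa>)" using \<eta> \<kappa> by (auto intro!: mult_pos_pos add_pos_pos)
    qed (use k in auto)
    finally have "exp ((k - 1) * B - 1 + y * ln (1 + \<theta>)) \<le> exp ((k - 1) * ln u + y * ln (1 + \<theta>))" by simp
    also have "\<dots> = c" using u z by (simp add: c_def powr_def exp_add)
    finally show "exp ((k - 1) * (ln (1 + 1 / g) - m * \<theta> / (1 - \<theta> * g)) - 1 + y * ln (1 + \<theta>)) \<le> c"
      by (simp add: B_def)
  qed (use c k in auto)
  also have "\<dots> = 16 * exp 1 * (k + 1)\<^sup>2 * exp (- (k - 1) * (ln (1 + 1 / g) - m * \<theta> / (1 - \<theta> * g)) - y * ln (1 + \<theta>))"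
  proof -
    have "16 * K / exp (a - 1 + b) = 16 * exp 1 * K * exp (- a - b)" for a b K :: real
      by (simp add: exp_diff exp_add exp_minus field_simps)
    then show ?thesis by (simp only: minus_mult_left)
  qed
  finally show ?thesis .
qed

end

section \<open>Local times of a path\<close>

definition local_count :: "(nat \<Rightarrow> int ^ 'd) \<Rightarrow> nat \<Rightarrow> int ^ 'd \<Rightarrow> nat" where
  "local_count s N a = (\<Sum>k<N. of_bool (s (Suc k) = a))"

lemma total_local_time_eq_SUP: "total_local_time s a = (SUP N. ereal (local_count s N a))"
proof -
  have "(\<Sum>k<N. of_bool (s (Suc k) = a) :: ereal) = ereal (local_count s N a)" for N
    unfolding local_count_def by (induction N) (auto simp: zero_ereal_def one_ereal_def)
  then show ?thesis
    unfolding total_local_time_def by (subst suminf_ereal_eq_SUP) (auto simp: of_bool_def)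
qed

lemma local_count_mono: "N \<le> N' \<Longrightarrow> local_count s N a \<le> local_count s N' a"
  unfolding local_count_def by (intro sum_mono2) auto

lemma local_count_le_total: "ereal (local_count s N a) \<le> total_local_time s a"
  unfolding total_local_time_eq_SUP by (rule SUP_upper) simp

text \<open>
  Counts are integers, so a supremum that reaches \<open>k\<close> is already reached by a finite count even if
  \<open>k\<close> is the supremum itself.
\<close>

lemma eventually_le_local_count:
  assumes "ereal k \<le> total_local_time s a"
  shows "\<forall>\<^sub>F N in sequentially. k \<le> local_count s N a"
proof -
  have "\<exists>N. k \<le> local_count s N a"
  proof (rule ccontr)
    assume "\<not> ?thesis"
    then have less: "real (local_count s N a) < k" for N by (auto simp: not_le)
    have "real (local_count s N a) \<le> of_int (\<lceil>k\<rceil> - 1)" for N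
    proof -
      have "int (local_count s N a) \<le> \<lceil>k\<rceil> - 1" using less[of N] by (simp add: less_ceiling_iff zle_diff1_eq)
      then have "of_int (int (local_count s N a)) \<le> (of_int (\<lceil>k\<rceil> - 1) :: real)" by (rule of_int_le_iff[THEN iffD2])
      then show ?thesis by simp
    qed
    then have "total_local_time s a \<le> ereal (of_int (\<lceil>k\<rceil> - 1))"
      unfolding total_local_time_eq_SUP by (intro SUP_least) simp
    with assms have "ereal k \<le> ereal (of_int (\<lceil>k\<rceil> - 1))" by (rule order_trans)
    then have "k \<le> of_int (\<lceil>k\<rceil> - 1)" by (simp only: ereal_less_eq)
    then show False by linarith
  qed
  then obtain N where "k \<le> local_count s N a" ..
  then show ?thesis
    using local_count_mono[of N _ s a] by (intro eventually_sequentiallyI[of N]) (meson of_nat_mono order_trans)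
qed

lemma visits_eq_sum: "visits a xs = (\<Sum>k<length xs. of_bool (sum_list (take (Suc k) xs) = a))"
proof (induction xs arbitrary: a)
  case (Cons v xs)
  have "(v + s = a) = (s = a - v)" for s :: 'a by (auto simp: algebra_simps)
  then show ?case by (simp add: Cons.IH sum.lessThan_Suc_shift del: sum.lessThan_Suc)
qed simp

text \<open>
  Local times count the times \<open>1, \<dots>, j + n\<close>, the two-sided walk the times \<open>0, \<dots>, j + n\<close> except \<open>j\<close>;
  the two corrections account for the times \<open>0\<close> and \<open>j\<close>.
\<close>

lemma local_count_two_sided:
  fixes s :: "nat \<Rightarrow> int ^ 'd"
  assumes s: "\<And>k. k \<le> j + n \<Longrightarrow> s k = sum_list (take k xs)" and len: "length xs = j + n"
  shows "local_count s (j + n) (s j + x) + of_bool (s 0 = s j + x) = two_sided_visits j x xs + of_bool (x = 0)"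
proof -
  let ?b = "\<lambda>i. of_bool (s i = s j + x) :: nat"
  have fw: "visits x (drop j xs) = (\<Sum>k<n. ?b (Suc (j + k)))"
  proof -
    have "(sum_list (take (Suc k) (drop j xs)) = x) = (s (Suc (j + k)) = s j + x)" if "k < n" for k
    proof -
      have "take (j + Suc k) xs = take j xs @ take (Suc k) (drop j xs)" by (rule take_add)
      then have "sum_list (take (j + Suc k) xs) = sum_list (take j xs) + sum_list (take (Suc k) (drop j xs))"
        by simp
      then show ?thesis using s[of "j + Suc k"] s[of j] that by auto
    qed
    then show ?thesis using len unfolding visits_eq_sum
      by (intro sum.cong) auto
  qed
  have bw: "visits (- x) (rev (take j xs)) = (\<Sum>i<j. ?b i)"
  proof -
    have "sum_list (take (Suc k) (rev (take j xs))) = s j - s (j - Suc k)" if "k < j" for k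
    proof -
      have l: "length (take j xs) = j" using len by simp
      have "take j xs = take (j - Suc k) (take j xs) @ drop (j - Suc k) (take j xs)" by (rule append_take_drop_id[symmetric])
      moreover have "take (j - Suc k) (take j xs) = take (j - Suc k) xs" by simp
      ultimately have "sum_list (take j xs) = sum_list (take (j - Suc k) xs) + sum_list (drop (j - Suc k) (take j xs))"
        by (metis sum_list.append)
      moreover have "take (Suc k) (rev (take j xs)) = rev (drop (j - Suc k) (take j xs))"
        by (simp add: take_rev len)
      ultimately show ?thesis using s[of j] s[of "j - Suc k"] by (simp add: sum_list.rev)
    qed
    moreover have "(a - b = - x) = (b = a + x)" for a b :: "int ^ 'd"
    proof
      assume "a - b = - x"
      then have "a - (a - b) = a - (- x)" by (rule arg_cong)
      then show "b = a + x" by simp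
    qed simp
    ultimately have "visits (- x) (rev (take j xs)) = (\<Sum>k<j. ?b (j - Suc k))"
      using len unfolding visits_eq_sum by (intro sum.cong) auto
    also have "\<dots> = (\<Sum>i<j. ?b i)" by (rule sum.nat_diff_reindex)
    finally show ?thesis .
  qed
  have l: "local_count s (j + n) (s j + x) = (\<Sum>k<j. ?b (Suc k)) + (\<Sum>k<n. ?b (Suc (j + k)))"
    unfolding local_count_def by (induction n) simp_all
  have shift: "(\<Sum>k<j. f (Suc k)) + f 0 = (\<Sum>i<j. f i) + f j" for f :: "nat \<Rightarrow> nat"
    by (induction j) simp_all
  have t: "(\<Sum>k<j. ?b (Suc k)) + ?b 0 = (\<Sum>i<j. ?b i) + of_bool (x = 0)"
    by (subst shift) simp
  have comb: "a + b = c + e \<Longrightarrow> a + f + b = f + c + e" for a b c e f :: nat by linarith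
  show ?thesis unfolding two_sided_visits_def fw bw l by (rule comb[OF t])
qed

section \<open>From the walk to lists of steps\<close>

locale lattice_walk = prob_space M
  for M :: "'a measure" and X :: "nat \<Rightarrow> 'a \<Rightarrow> int ^ 'd" and p :: "(int ^ 'd) pmf" +
  assumes indep: "indep_vars (\<lambda>_. count_space UNIV) X {1..}"
    and step_distr: "\<And>k. k \<ge> 1 \<Longrightarrow> distr M (count_space UNIV) (X k) = measure_pmf p"
begin

definition steps :: "nat \<Rightarrow> 'a \<Rightarrow> (int ^ 'd) list" where
  "steps n \<omega> = map (\<lambda>i. X i \<omega>) [1..<Suc n]"

lemma measurable_X [measurable]: "k \<ge> 1 \<Longrightarrow> X k \<in> measurable M (count_space UNIV)"
  using indep by (auto simp: indep_vars_def)

lemma steps_eq_iff: "length xs = n \<Longrightarrow> steps n \<omega> = xs \<longleftrightarrow> (\<forall>i<n. X (Suc i) \<omega> = xs ! i)"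
  by (auto simp: steps_def list_eq_iff_nth_eq simp del: upt_Suc)

lemma length_steps [simp]: "length (steps n \<omega>) = n"
  by (simp add: steps_def)

lemma measurable_steps [measurable]: "steps n \<in> measurable M (count_space UNIV)"
proof (rule measurable_count_space_eq_countable[THEN iffD2])
  show "countable (UNIV :: (int ^ 'd) list set)" by simp
  show "steps n \<in> space M \<rightarrow> UNIV \<and> (\<forall>xs\<in>UNIV. steps n -` {xs} \<inter> space M \<in> sets M)"
  proof (intro conjI ballI)
    fix xs :: "(int ^ 'd) list"
    show "steps n -` {xs} \<inter> space M \<in> sets M"
    proof (cases "length xs = n")
      case True
      have "steps n -` {xs} \<inter> space M = {\<omega>\<in>space M. \<forall>i<n. X (Suc i) \<omega> = xs ! i}"
        using True by (auto simp: steps_eq_iff)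
      also have "\<dots> \<in> sets M"
      proof -
        have [measurable]: "X (Suc i) \<in> measurable M (count_space UNIV)" for i by (rule measurable_X) simp
        show ?thesis by measurable
      qed
      finally show ?thesis .
    next
      case False
      then have "steps n -` {xs} \<inter> space M = {}" by auto
      then show ?thesis by simp
    qed
  qed auto
qed

lemma distr_steps: "distr M (count_space UNIV) (steps n) = measure_pmf (replicate_pmf n p)"
proof (rule measure_eqI_countable[where A = UNIV])
  fix xs :: "(int ^ 'd) list"
  have "prob (steps n -` {xs} \<inter> space M) = pmf (replicate_pmf n p) xs"
  proof (cases "length xs = n \<and> n > 0")
    case True
    have "steps n -` {xs} \<inter> space M = (\<Inter>i\<in>{1..n}. X i -` {xs ! (i - 1)} \<inter> space M)"
    proof -
      have "(\<forall>i<n. X (Suc i) \<omega> = xs ! i) \<longleftrightarrow> (\<forall>i\<in>{1..n}. X i \<omega> = xs ! (i - 1))" for \<omega>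
        unfolding image_Suc_lessThan[symmetric] by auto
      then show ?thesis using True by (auto simp: steps_eq_iff)
    qed
    then have "prob (steps n -` {xs} \<inter> space M) = prob (\<Inter>i\<in>{1..n}. X i -` {xs ! (i - 1)} \<inter> space M)"
      by simp
    also have "\<dots> = (\<Prod>i\<in>{1..n}. prob (X i -` {xs ! (i - 1)} \<inter> space M))"
      using True by (intro indep_varsD[OF indep]) auto
    also have "\<dots> = (\<Prod>i\<in>{1..n}. pmf p (xs ! (i - 1)))"
    proof (intro prod.cong refl)
      fix i assume i: "i \<in> {1..n}"
      have "prob (X i -` {xs ! (i - 1)} \<inter> space M) = measure (distr M (count_space UNIV) (X i)) {xs ! (i - 1)}"
        using i by (subst measure_distr) (auto intro: measurable_X)
      then show "prob (X i -` {xs ! (i - 1)} \<inter> space M) = pmf p (xs ! (i - 1))"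
        using i step_distr[of i] by (simp add: measure_pmf_single)
    qed
    also have "\<dots> = (\<Prod>i<n. pmf p (xs ! i))"
      by (rule prod.reindex_bij_witness[of _ Suc "\<lambda>i. i - 1"]) auto
    also have "\<dots> = prod_list (map (pmf p) xs)"
      using True by (simp add: prod.list_conv_set_nth atLeast0LessThan)
    finally show ?thesis using True by (simp add: pmf_replicate_pmf)
  next
    case False
    then consider "length xs \<noteq> n" | "n = 0" "xs = []" by auto
    then show ?thesis
    proof cases
      case 1
      then have "steps n -` {xs} \<inter> space M = {}" by auto
      then show ?thesis using 1 by (simp add: pmf_replicate_pmf)
    next
      case 2
      then have "steps n -` {xs} \<inter> space M = space M" by (auto simp: steps_def)
      then show ?thesis using 2 by (simp add: prob_space)
    qed
  qed
  then show "emeasure (distr M (count_space UNIV) (steps n)) {xs} = emeasure (replicate_pmf n p) {xs}"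
    by (simp add: emeasure_distr emeasure_eq_measure emeasure_pmf_single)
qed auto

lemma prob_steps: "prob {\<omega>\<in>space M. steps n \<omega> \<in> A} = measure_pmf.prob (replicate_pmf n p) A"
proof -
  have "measure_pmf.prob (replicate_pmf n p) A = prob (steps n -` A \<inter> space M)"
    unfolding distr_steps[symmetric] by (rule measure_distr) auto
  then show ?thesis by (simp add: vimage_def Int_def conj_commute)
qed

lemma walk_eq_sum_list: "k \<le> n \<Longrightarrow> walk X k \<omega> = sum_list (take k (steps n \<omega>))"
proof -
  assume "k \<le> n"
  then have "take k [1..<Suc n] = [1..<Suc k]" by (simp add: take_upt del: upt_Suc)
  then have "take k (steps n \<omega>) = map (\<lambda>i. X i \<omega>) [1..<Suc k]" by (simp add: steps_def take_map)
  then have "sum_list (take k (steps n \<omega>)) = (\<Sum>i\<in>set [1..<Suc k]. X i \<omega>)"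
    by (simp only: sum_list_distinct_conv_sum_set distinct_upt)
  also have "set [1..<Suc k] = {1..k}" by auto
  finally show ?thesis by (simp add: walk_def)
qed

lemma measurable_walk [measurable]: "walk X n \<in> measurable M (count_space UNIV)"
proof -
  have "walk X n = sum_list \<circ> steps n" using walk_eq_sum_list[of n n] by (auto simp: fun_eq_iff)
  then show ?thesis by simp
qed

lemma prob_walk: "prob {\<omega>\<in>space M. walk X n \<omega> = a} = walk_prob p n a"
  unfolding walk_prob_def prob_steps[symmetric] using walk_eq_sum_list[of n n] by simp

lemma avoid_prob_eq:
  assumes "transient_walk p"
  shows "avoid_prob M (walk X) a = 1 - green p a / (1 + green p 0)"
proof -
  interpret transient_walk p by fact
  define A where "A n = {\<omega>\<in>space M. \<forall>i\<in>{1..n}. walk X i \<omega> \<noteq> a}" for n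
  have "visits a (steps n \<omega>) = 0 \<longleftrightarrow> (\<forall>i\<in>{1..n}. walk X i \<omega> \<noteq> a)" for n \<omega>
  proof -
    have "visits a (steps n \<omega>) = 0 \<longleftrightarrow> (\<forall>k<n. walk X (Suc k) \<omega> \<noteq> a)"
      by (auto simp: visits_eq_sum walk_eq_sum_list[of "Suc _" n])
    also have "\<dots> \<longleftrightarrow> (\<forall>i\<in>{1..n}. walk X i \<omega> \<noteq> a)"
      unfolding image_Suc_lessThan[symmetric] by auto
    finally show ?thesis .
  qed
  then have "A n = {\<omega>\<in>space M. steps n \<omega> \<in> - {xs. visits a xs \<noteq> 0}}" for n by (auto simp: A_def)
  then have "prob (A n) = measure_pmf.prob (replicate_pmf n p) (- {xs. visits a xs \<noteq> 0})" for n
    by (simp only: prob_steps)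
  then have pA: "prob (A n) = 1 - hit_prob p n a" for n
    unfolding hit_prob_def
    using measure_pmf.prob_compl[of "{xs. visits a xs \<noteq> 0}" "replicate_pmf n p"] by (simp add: Compl_eq_Diff_UNIV)
  have "(\<lambda>n. prob (A n)) \<longlonglongrightarrow> prob (\<Inter>n. A n)"
    by (rule finite_Lim_measure_decseq) (auto simp: A_def decseq_def)
  moreover have "(\<Inter>n. A n) = {\<omega> \<in> space M. \<forall>i\<ge>1. walk X i \<omega> \<noteq> a}"
    by (auto simp: A_def) (metis One_nat_def atLeastAtMost_iff order_refl)
  moreover have "(\<lambda>n. prob (A n)) \<longlonglongrightarrow> 1 - green p a / (1 + green p 0)"
    unfolding pA by (intro tendsto_intros hit_prob_LIMSEQ)
  ultimately show ?thesis unfolding avoid_prob_def using LIMSEQ_unique by metis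
qed

lemma measurable_local_time [measurable]:
  "(\<lambda>\<omega>. total_local_time (\<lambda>k. walk X k \<omega>) (walk X j \<omega> + x)) \<in> borel_measurable M"
proof -
  have [measurable]: "Measurable.pred M (\<lambda>\<omega>. walk X (Suc i) \<omega> = walk X j \<omega> + x)" for i by measurable
  show ?thesis
    unfolding total_local_time_eq_SUP local_count_def of_bool_def by measurable
qed

text \<open>
  Passing to infinite time: total local times above a level are eventually reached by finite counts,
  and those below a level have all finite counts below it.  The shift by one for \<open>\<theta> < 0\<close> is the
  possible visit at time \<open>0\<close>, which the two-sided walk counts.
\<close>

lemma local_time_pair_tail:
  fixes x :: "int ^ 'd" and \<theta> k y :: real
  defines "g \<equiv> green p 0" and "h \<equiv> green p x"
  defines "m \<equiv> h\<^sup>2 / (g * (1 + g))"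
  assumes walk: "symmetric_transient_walk p"
  assumes x: "x \<noteq> 0" and g: "g > 0" and \<theta>: "\<bar>\<theta>\<bar> * (1 + g) \<le> 1 / 2" and k: "k \<ge> 1"
  shows "prob {\<omega>\<in>space M. ereal k \<le> total_local_time (\<lambda>i. walk X i \<omega>) (walk X j \<omega>) \<and>
           (if \<theta> \<ge> 0 then ereal y \<le> total_local_time (\<lambda>i. walk X i \<omega>) (walk X j \<omega> + x)
            else total_local_time (\<lambda>i. walk X i \<omega>) (walk X j \<omega> + x) \<le> ereal y)}
         \<le> 16 * exp 1 * (k + 1)\<^sup>2 * exp (- (k - 1) * (ln (1 + 1 / g) - m * \<theta> / (1 - \<theta> * g))
              - (if \<theta> \<ge> 0 then y else y + 1) * ln (1 + \<theta>))"
    (is "prob ?E \<le> ?B")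
proof -
  interpret symmetric_transient_walk p by fact
  define y' where "y' = (if \<theta> \<ge> 0 then y else y + 1)"
  define E where "E n = {xs. k - 1 \<le> two_sided_visits j 0 xs \<and>
                (if \<theta> \<ge> 0 then y' \<le> two_sided_visits j x xs else two_sided_visits j x xs \<le> y')}" for n :: nat
  define A where "A N = {\<omega>\<in>space M. \<forall>n\<ge>N. steps (j + n) \<omega> \<in> E n}" for N
  have meas: "A N \<in> sets M" for N unfolding A_def by measurable
  have "prob (A N) \<le> ?B" for N
  proof -
    have "prob (A N) \<le> prob {\<omega>\<in>space M. steps (j + N) \<omega> \<in> E N}"
      by (intro finite_measure_mono) (auto simp: A_def)
    also have "\<dots> \<le> ?B"
      unfolding prob_steps E_def y'_def[symmetric] using two_sided_tail[of x \<theta> k j N y'] assms by simp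
    finally show ?thesis .
  qed
  moreover have "(\<lambda>N. prob (A N)) \<longlonglongrightarrow> prob (\<Union>N. A N)"
    by (rule finite_Lim_measure_incseq) (use meas in \<open>auto simp: A_def incseq_def\<close>)
  ultimately have "prob (\<Union>N. A N) \<le> ?B" by (intro LIMSEQ_le_const2) auto
  moreover have "?E \<subseteq> (\<Union>N. A N)"
  proof
    fix \<omega> assume \<omega>: "\<omega> \<in> ?E"
    define s where "s = (\<lambda>i. walk X i \<omega>)"
    have s: "s i = sum_list (take i (steps (j + n) \<omega>))" if "i \<le> j + n" for i n
      unfolding s_def using that by (rule walk_eq_sum_list)
    have id: "local_count s (j + n) (s j + b) + of_bool (s 0 = s j + b)
               = two_sided_visits j b (steps (j + n) \<omega>) + of_bool (b = 0)" for b n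
      by (rule local_count_two_sided) (use s in auto)
    have "\<forall>\<^sub>F n in sequentially. k \<le> local_count s n (s j)"
      using \<omega> by (intro eventually_le_local_count) (simp add: s_def)
    moreover have "\<forall>\<^sub>F n in sequentially. if \<theta> \<ge> 0 then y \<le> local_count s n (s j + x) else local_count s n (s j + x) \<le> y"
    proof (cases "\<theta> \<ge> 0")
      case True
      then show ?thesis using \<omega> eventually_le_local_count[of y s "s j + x"] by (simp add: s_def)
    next
      case False
      then have "total_local_time s (s j + x) \<le> ereal y" using \<omega> by (simp add: s_def)
      then have "ereal (local_count s n (s j + x)) \<le> ereal y" for n
        using local_count_le_total order_trans by blast
      then show ?thesis using False by simp
    qed
    ultimately have "\<forall>\<^sub>F n in sequentially. k \<le> local_count s n (s j) \<and>
        (if \<theta> \<ge> 0 then y \<le> local_count s n (s j + x) else local_count s n (s j + x) \<le> y)"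
      by eventually_elim auto
    then obtain N where N: "\<And>n. n \<ge> N \<Longrightarrow> k \<le> local_count s n (s j) \<and>
        (if \<theta> \<ge> 0 then y \<le> local_count s n (s j + x) else local_count s n (s j + x) \<le> y)"
      by (auto simp: eventually_sequentially)
    have "steps (j + n) \<omega> \<in> E n" if "n \<ge> N" for n
    proof -
      have "k \<le> local_count s (j + n) (s j)" using N[of "j + n"] that by simp
      moreover have "local_count s (j + n) (s j) \<le> two_sided_visits j 0 (steps (j + n) \<omega>) + 1" using id[of n 0] by auto
      moreover have "local_count s (j + n) (s j + x) \<le> two_sided_visits j x (steps (j + n) \<omega>)"
        "two_sided_visits j x (steps (j + n) \<omega>) \<le> local_count s (j + n) (s j + x) + 1"
        using id[of n x] x by (auto simp: of_bool_def split: if_splits)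
      ultimately show ?thesis using N[of "j + n"] that unfolding E_def y'_def by (auto split: if_splits)
    qed
    then show "\<omega> \<in> (\<Union>N. A N)" using \<omega> by (auto simp: A_def)
  qed
  ultimately show ?thesis
    using finite_measure_mono[of ?E "\<Union>N. A N"] meas by (auto intro: order_trans)
qed

end

section \<open>Fourier analysis on the torus\<close>

text \<open>
  Points of the torus are functions \<open>'d \<Rightarrow> real\<close> under the product of uniform distributions on
  \<open>[-\<pi>, \<pi>]\<close>; so integrals of products over the coordinates factor.
\<close>

definition circle :: "real measure" where
  "circle = density lborel (\<lambda>s. ennreal (indicator {-pi..pi} s / (2 * pi)))"

definition torus :: "('d::finite \<Rightarrow> real) measure" where
  "torus = PiM UNIV (\<lambda>_. circle)"

definition phase :: "int ^ 'd \<Rightarrow> ('d::finite \<Rightarrow> real) \<Rightarrow> real" where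
  "phase x t = (\<Sum>i\<in>UNIV. real_of_int (x $ i) * t i)"

definition norm2 :: "('d::finite \<Rightarrow> real) \<Rightarrow> real" where
  "norm2 t = (\<Sum>i\<in>UNIV. (t i)\<^sup>2)"

lemma sets_circle [measurable_cong, simp]: "sets circle = sets borel"
  by (simp add: circle_def)

lemma space_circle [simp]: "space circle = UNIV"
  by (simp add: circle_def)

lemma prob_space_circle: "prob_space circle"
proof
  have "emeasure circle (space circle) = (\<integral>\<^sup>+s. ennreal (1 / (2 * pi)) * indicator {-pi..pi} s \<partial>lborel)"
    unfolding circle_def by (subst emeasure_density) (auto intro!: nn_integral_cong simp: indicator_def)
  also have "\<dots> = 1"
    by (subst nn_integral_cmult_indicator) (auto simp: ennreal_mult[symmetric])
  finally show "emeasure circle (space circle) = 1" .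
qed

interpretation circle: prob_space circle by (rule prob_space_circle)
interpretation circles: product_prob_space "\<lambda>_. circle" "UNIV :: 'd::finite set" by standard

lemma prob_space_torus: "prob_space torus"
  unfolding torus_def by (rule prob_space_PiM) (rule prob_space_circle)

interpretation torus: prob_space torus by (rule prob_space_torus)

lemma integral_circle:
  fixes f :: "real \<Rightarrow> 'b::{banach, second_countable_topology}"
  assumes [measurable]: "f \<in> borel_measurable borel"
  shows "integral\<^sup>L circle f = (\<integral>s. (indicator {-pi..pi} s / (2 * pi)) *\<^sub>R f s \<partial>lborel)"
  unfolding circle_def by (subst integral_density) auto

lemma integral_circle_character:
  "(\<integral>s. exp (\<i> * of_int k * of_real s) \<partial>circle) = of_bool (k = 0)"
proof (cases "k = 0")
  case True
  then show ?thesis using circle.prob_space by simp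
next
  case False
  define F where "F s = exp (\<i> * of_int k * of_real s) / (\<i> * of_int k)" for s :: real
  have "(\<integral>s. indicator {-pi..pi} s *\<^sub>R exp (\<i> * of_int k * of_real s) \<partial>lborel) = F pi - F (- pi)"
  proof (rule integral_FTC_Icc)
    show "(F has_vector_derivative exp (\<i> * of_int k * of_real s)) (at s within {-pi..pi})" for s
    proof -
      have "((\<lambda>z. exp (\<i> * of_int k * z) / (\<i> * of_int k)) has_field_derivative exp (\<i> * of_int k * of_real s)) (at (of_real s))"
        using False by (auto intro!: derivative_eq_intros)
      then show ?thesis unfolding F_def by (rule has_vector_derivative_real_field)
    qed
  qed (auto intro!: continuous_intros)
  also have "F pi = F (- pi)"
  proof -
    have "exp (\<i> * of_int k * of_real pi) = exp (\<i> * of_int k * of_real (- pi)) * exp ((2 * of_int k * pi) * \<i>)"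
      by (subst exp_add[symmetric]) (simp add: algebra_simps)
    also have "exp ((2 * of_int k * pi) * \<i>) = 1" by (rule exp_integer_2pi) simp
    finally show ?thesis by (simp add: F_def)
  qed
  finally have "(\<integral>s. indicator {-pi..pi} s *\<^sub>R exp (\<i> * of_int k * of_real s) \<partial>lborel) = 0" by simp
  then have "(\<integral>s. (1 / (2 * pi)) *\<^sub>R (indicator {-pi..pi} s *\<^sub>R exp (\<i> * of_int k * of_real s)) \<partial>lborel) = 0"
    by (simp only: integral_scaleR_right) simp
  then show ?thesis
    using False by (subst integral_circle) (auto simp: mult.commute)
qed

lemma measurable_component: "(\<lambda>t. t i) \<in> borel_measurable torus"
  using measurable_component_singleton[of i UNIV "\<lambda>_. circle"]
  by (simp add: torus_def measurable_cong_sets[OF refl sets_circle])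

lemma measurable_phase [measurable]: "phase x \<in> borel_measurable torus"
  unfolding phase_def by (intro borel_measurable_sum borel_measurable_times measurable_component) auto

lemma measurable_norm2 [measurable]: "norm2 \<in> borel_measurable torus"
  unfolding norm2_def by (intro borel_measurable_sum borel_measurable_power measurable_component)

lemma integral_torus_prod:
  fixes f :: "'d::finite \<Rightarrow> real \<Rightarrow> 'b::{real_normed_field, banach, second_countable_topology}"
  assumes "\<And>i. integrable circle (f i)"
  shows "(\<integral>t. (\<Prod>i\<in>UNIV. f i (t i)) \<partial>torus) = (\<Prod>i\<in>UNIV. integral\<^sup>L circle (f i))"
  unfolding torus_def by (rule circles.product_integral_prod) (use assms in auto)

lemma integral_torus_cos: "(\<integral>t. cos (phase x t) \<partial>torus) = of_bool (x = 0)"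
proof -
  have int: "integrable circle (\<lambda>s. exp (\<i> * of_int k * of_real s))" for k
  proof (rule circle.integrable_const_bound[where B = 1])
    show "AE s in circle. norm (exp (\<i> * of_int k * of_real s)) \<le> 1" by (simp add: norm_exp_eq_Re)
  qed measurable
  have e: "exp (\<i> * of_real (phase x t)) = (\<Prod>i\<in>UNIV. exp (\<i> * of_int (x $ i) * of_real (t i)))" for t
    by (simp add: phase_def exp_sum[symmetric] sum_distrib_left mult.assoc)
  have "(\<integral>t. cos (phase x t) \<partial>torus) = (\<integral>t. Re (exp (\<i> * of_real (phase x t))) \<partial>torus)"
    by (simp add: Re_exp)
  also have "\<dots> = Re (\<integral>t. exp (\<i> * of_real (phase x t)) \<partial>torus)"
    by (intro integral_Re torus.integrable_const_bound[where B = 1]) auto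
  also have "(\<integral>t. exp (\<i> * of_real (phase x t)) \<partial>torus) = (\<Prod>i\<in>UNIV. of_bool (x $ i = 0))"
    unfolding e by (subst integral_torus_prod) (auto simp: int integral_circle_character)
  also have "\<dots> = of_bool (x = 0)"
    by (auto simp: vec_eq_iff)
  finally show ?thesis by simp
qed

lemma phase_diff: "phase (x - y) t = phase x t - phase y t"
  by (simp add: phase_def sum_subtractf algebra_simps)

lemma phase_add: "phase (x + y) t = phase x t + phase y t"
  by (simp add: phase_def sum.distrib algebra_simps)

lemma phase_zero [simp]: "phase 0 t = 0"
  by (simp add: phase_def)

lemma phase_uminus [simp]: "phase (- x) t = - phase x t"
  using phase_diff[of 0 x t] by simp

lemma phase_axis: "phase (axis i 1) t = t i"
  by (simp add: phase_def axis_def if_distrib[of real_of_int] if_distrib[of "\<lambda>a. a * _"] cong: if_cong)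

lemma phase_squared_le: "(phase x t)\<^sup>2 \<le> (norm (real_vec x))\<^sup>2 * norm2 t"
proof -
  have "phase x t = real_vec x \<bullet> (\<chi> i. t i)" by (simp add: phase_def real_vec_def inner_vec_def)
  moreover have "(norm (\<chi> i. t i))\<^sup>2 = norm2 t" unfolding norm2_def power2_norm_eq_inner inner_vec_def by (simp add: power2_eq_square)
  ultimately show ?thesis
    using Cauchy_Schwarz_ineq[of "real_vec x" "\<chi> i. t i"] by (simp add: power2_norm_eq_inner)
qed

lemma norm2_nonneg [simp]: "norm2 t \<ge> 0"
  by (simp add: norm2_def sum_nonneg)

lemma one_minus_cos_eq: "1 - cos (a::real) = 2 * (sin (a / 2))\<^sup>2"
  using cos_double_sin[of "a / 2"] by simp

lemma one_minus_cos_le: "1 - cos (a::real) \<le> a\<^sup>2 / 2"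
proof -
  have "\<bar>sin (a / 2)\<bar> \<le> \<bar>a / 2\<bar>" by (rule abs_sin_x_le_abs_x)
  then have "(sin (a / 2))\<^sup>2 \<le> (a / 2)\<^sup>2" by (simp only: abs_le_square_iff)
  then show ?thesis by (simp add: one_minus_cos_eq power_divide)
qed

lemma abs_sin_add_le: "\<bar>sin (a + b)\<bar> \<le> \<bar>sin a\<bar> + \<bar>sin (b :: real)\<bar>"
proof -
  have "\<bar>sin (a + b)\<bar> \<le> \<bar>sin a * cos b\<bar> + \<bar>cos a * sin b\<bar>" unfolding sin_add by (rule abs_triangle_ineq)
  also have "\<dots> \<le> \<bar>sin a\<bar> * 1 + 1 * \<bar>sin b\<bar>" unfolding abs_mult by (intro add_mono mult_mono) auto
  finally show ?thesis by simp
qed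

text \<open>
  From \<open>sin a \<ge> a cos a\<close> at \<open>a = s / 2\<close> and the duplication formula.
\<close>

lemma half_le_sin:
  fixes s :: real
  assumes "0 \<le> s" "s \<le> pi / 2"
  shows "s / 2 \<le> sin s"
proof -
  have *: "a * cos a \<le> sin a" if "0 \<le> a" "a \<le> pi" for a :: real
  proof -
    have "(\<lambda>a. sin a - a * cos a) 0 \<le> (\<lambda>a. sin a - a * cos a) a"
    proof (rule DERIV_nonneg_imp_nondecreasing[OF that(1)])
      fix y assume "0 \<le> y" "y \<le> a"
      then have "((\<lambda>a. sin a - a * cos a) has_real_derivative y * sin y) (at y) \<and> 0 \<le> y * sin y"
        using that by (auto intro!: derivative_eq_intros mult_nonneg_nonneg sin_ge_zero)
      then show "\<exists>z. ((\<lambda>a. sin a - a * cos a) has_real_derivative z) (at y) \<and> 0 \<le> z" by blast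
    qed
    then show ?thesis by simp
  qed
  have "0 \<le> cos s" using assms by (intro cos_ge_zero) auto
  moreover have "cos s = 2 * (cos (s / 2))\<^sup>2 - 1" using cos_double_cos[of "s / 2"] by simp
  ultimately have c: "1 / 2 \<le> (cos (s / 2))\<^sup>2" by simp
  have "0 \<le> cos (s / 2)" using assms by (intro cos_ge_zero) auto
  have "s * (1 / 2) \<le> s * (cos (s / 2))\<^sup>2" using c assms(1) by (rule mult_left_mono)
  also have "\<dots> = 2 * (s / 2 * cos (s / 2)) * cos (s / 2)" by (simp add: power2_eq_square)
  also have "\<dots> \<le> 2 * sin (s / 2) * cos (s / 2)"
    using *[of "s / 2"] assms \<open>0 \<le> cos (s / 2)\<close> by (intro mult_right_mono mult_left_mono) auto
  also have "\<dots> = sin s" using sin_double[of "s / 2"] by simp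
  finally show ?thesis by simp
qed

lemma abs_le_4_sin_half:
  fixes s :: real
  assumes "\<bar>s\<bar> \<le> pi"
  shows "\<bar>s\<bar> \<le> 4 * \<bar>sin (s / 2)\<bar>"
proof -
  have "\<bar>s\<bar> / 2 / 2 \<le> sin (\<bar>s\<bar> / 2)" using assms by (intro half_le_sin) auto
  also have "\<dots> \<le> \<bar>sin (\<bar>s\<bar> / 2)\<bar>" by simp
  also have "\<dots> = \<bar>sin (s / 2)\<bar>" by (cases "s \<ge> 0") auto
  finally show ?thesis by simp
qed

lemma integral_circle_gaussian_le:
  assumes "a > 0"
  shows "(\<integral>s. exp (- a * s\<^sup>2) \<partial>circle) \<le> 1 / sqrt a"
proof -
  define \<sigma> where "\<sigma> = sqrt (1 / (2 * a))"
  have \<sigma>: "\<sigma> > 0" "\<sigma>\<^sup>2 = 1 / (2 * a)" using assms by (auto simp: \<sigma>_def)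
  have nd: "exp (- a * s\<^sup>2) = sqrt (pi / a) * normal_density 0 \<sigma> s" for s
    using assms by (simp add: normal_density_def \<sigma> real_sqrt_divide field_simps)
  have int: "integrable lborel (\<lambda>s. exp (- a * s\<^sup>2))"
    unfolding nd using \<sigma> by (intro integrable_mult_right integrable_normal_density)
  have "(\<integral>s. exp (- a * s\<^sup>2) \<partial>circle) = (\<integral>s. (indicator {-pi..pi} s / (2 * pi)) *\<^sub>R exp (- a * s\<^sup>2) \<partial>lborel)"
    by (rule integral_circle) measurable
  also have "\<dots> \<le> (\<integral>s. (1 / (2 * pi)) * exp (- a * s\<^sup>2) \<partial>lborel)"
  proof (rule integral_mono)
    show "integrable lborel (\<lambda>s. (1 / (2 * pi)) * exp (- a * s\<^sup>2))" by (intro integrable_mult_right int)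
    then show "integrable lborel (\<lambda>s. (indicator {-pi..pi} s / (2 * pi)) *\<^sub>R exp (- a * s\<^sup>2))"
      by (rule Bochner_Integration.integrable_bound) (auto simp: indicator_def)
  qed (auto simp: indicator_def)
  also have "\<dots> = sqrt (pi / a) / (2 * pi)"
    unfolding nd integral_mult_right_zero using \<sigma> integral_normal_density[of \<sigma> 0] by simp
  also have "\<dots> \<le> 1 / sqrt a"
  proof -
    have "sqrt pi \<le> 2 * pi" using pi_ge_two by (intro real_le_lsqrt) (auto simp: power2_eq_square)
    then show ?thesis using assms by (simp add: real_sqrt_divide field_simps)
  qed
  finally show ?thesis .
qed

lemma integral_torus_gaussian_le:
  assumes "a > 0"
  shows "(\<integral>t. exp (- a * norm2 (t :: 'd::finite \<Rightarrow> real)) \<partial>torus) \<le> (1 / sqrt a) ^ CARD('d)"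
proof -
  have "exp (- a * norm2 (t :: 'd \<Rightarrow> real)) = (\<Prod>i\<in>UNIV. exp (- a * (t i)\<^sup>2))" for t
    by (simp add: norm2_def sum_distrib_left exp_sum[symmetric] sum_negf)
  then have "(\<integral>t. exp (- a * norm2 (t :: 'd::finite \<Rightarrow> real)) \<partial>torus) = (\<Prod>i\<in>(UNIV :: 'd set). \<integral>s. exp (- a * s\<^sup>2) \<partial>circle)"
  proof (simp only:, intro integral_torus_prod circle.integrable_const_bound[where B = 1])
    show "AE s in circle. norm (exp (- a * s\<^sup>2)) \<le> 1" using assms by auto
  qed measurable
  also have "\<dots> \<le> (\<Prod>i\<in>(UNIV :: 'd set). 1 / sqrt a)"
    using assms by (intro prod_mono conjI integral_nonneg_AE integral_circle_gaussian_le) auto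
  finally show ?thesis by simp
qed

lemma AE_torus_le_pi: "AE t in torus. \<forall>i :: 'd::finite. \<bar>t i\<bar> \<le> pi"
proof -
  have "AE s in circle. \<bar>s\<bar> \<le> pi"
    unfolding circle_def by (subst AE_density) (auto simp: indicator_def)
  then have "AE t in torus. \<bar>t i\<bar> \<le> pi" for i :: 'd
    unfolding torus_def by (intro AE_PiM_component) (auto intro: prob_space_circle)
  then show ?thesis by (simp add: AE_all_countable)
qed

lemma measure_torus_box:
  assumes "0 \<le> \<rho>" "\<rho> \<le> pi"
  shows "torus.prob {t :: 'd::finite \<Rightarrow> real. \<forall>i. \<bar>t i\<bar> \<le> \<rho>} = (\<rho> / pi) ^ CARD('d)"
proof -
  have "emeasure circle {-\<rho>..\<rho>} = (\<integral>\<^sup>+s. ennreal (1 / (2 * pi)) * indicator {-\<rho>..\<rho>} s \<partial>lborel)"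
    unfolding circle_def using assms by (subst emeasure_density) (auto intro!: nn_integral_cong simp: indicator_def)
  also have "\<dots> = ennreal (\<rho> / pi)"
    using assms by (subst nn_integral_cmult_indicator) (auto simp: ennreal_mult[symmetric])
  finally have c: "emeasure circle {-\<rho>..\<rho>} = ennreal (\<rho> / pi)" .
  have "{t :: 'd \<Rightarrow> real. \<forall>i. \<bar>t i\<bar> \<le> \<rho>} = PiE UNIV (\<lambda>_. {-\<rho>..\<rho>})" by (auto simp: PiE_UNIV_domain abs_le_iff minus_le_iff)
  then have "emeasure torus {t :: 'd \<Rightarrow> real. \<forall>i. \<bar>t i\<bar> \<le> \<rho>} = (\<Prod>i\<in>(UNIV :: 'd set). emeasure circle {-\<rho>..\<rho>})"
    unfolding torus_def by (simp only:) (rule circles.emeasure_PiM, auto)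
  also have "\<dots> = ennreal ((\<rho> / pi) ^ CARD('d))" using assms by (simp add: c ennreal_power)
  finally show ?thesis using assms by (simp add: measure_def)
qed

definition char_fn :: "(int ^ 'd) pmf \<Rightarrow> ('d::finite \<Rightarrow> real) \<Rightarrow> real" where
  "char_fn p t = expect p (\<lambda>v. cos (phase v t))"

lemma measurable_phase_pair [measurable]:
  "(\<lambda>(t, v). phase v t) \<in> borel_measurable (torus \<Otimes>\<^sub>M measure_pmf p)"
proof -
  have "(\<lambda>tv. real_of_int (snd tv $ i) * fst tv i) \<in> borel_measurable (torus \<Otimes>\<^sub>M measure_pmf p)" for i
    by (intro borel_measurable_times measurable_compose[OF measurable_snd] measurable_compose[OF measurable_fst measurable_component]) auto
  then show ?thesis unfolding phase_def case_prod_beta by (intro borel_measurable_sum)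
qed

lemma measurable_char_fn [measurable]: "char_fn p \<in> borel_measurable torus"
  unfolding char_fn_def
proof (rule measure_pmf.borel_measurable_lebesgue_integral)
  show "(\<lambda>(t, v). cos (phase v t)) \<in> borel_measurable (torus \<Otimes>\<^sub>M measure_pmf p)"
    using measurable_compose[OF measurable_phase_pair borel_measurable_cos]
    by (simp add: case_prod_beta)
qed

lemma abs_char_fn_le: "\<bar>char_fn p t\<bar> \<le> 1"
proof -
  have "norm (char_fn p t) \<le> expect p (\<lambda>v. norm (cos (phase v t)))"
    unfolding char_fn_def by (rule integral_norm_bound)
  also have "\<dots> \<le> expect p (\<lambda>v. 1)"
    by (intro integral_mono integrable_pmf_bounded[where B = 1]) auto
  finally show ?thesis by simp
qed

lemma expectation_cos_shift:
  assumes "map_pmf uminus p = p"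
  shows "expect p (\<lambda>v. cos (c - phase v t)) = cos c * char_fn p t"
proof -
  have "expect p (\<lambda>v. sin (phase v t)) = expect (map_pmf uminus p) (\<lambda>v. sin (phase v t))"
    by (simp add: assms)
  then have sin0: "expect p (\<lambda>v. sin (phase v t)) = 0" by simp
  have int: "integrable p (\<lambda>v. cos (phase v t))" "integrable p (\<lambda>v. sin (phase v t))"
    by (auto intro!: integrable_pmf_bounded[where B = 1])
  show ?thesis using int sin0 by (simp add: cos_diff char_fn_def)
qed

lemma integrable_torus_bounded:
  assumes "f \<in> borel_measurable torus" "\<And>t. \<bar>f t\<bar> \<le> B"
  shows "integrable torus (f :: ('d::finite \<Rightarrow> real) \<Rightarrow> real)"
  using assms by (intro torus.integrable_const_bound[where B = B]) auto

text \<open>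
  Fourier inversion.  By symmetry \<open>\<phi>\<close> is real and \<open>E (cos (c - X \<cdot> t)) = cos c * \<phi>(t)\<close>, so each step
  of the walk multiplies the integrand by \<open>\<phi>\<close>.
\<close>

lemma walk_prob_fourier:
  fixes p :: "(int ^ 'd) pmf"
  assumes sym: "map_pmf uminus p = p"
  shows "walk_prob p n x = (\<integral>t. char_fn p t ^ n * cos (phase x t) \<partial>torus)"
proof (induction n arbitrary: x)
  case 0
  then show ?case by (simp add: walk_prob_0 integral_torus_cos)
next
  case (Suc n)
  interpret P: pair_sigma_finite torus "measure_pmf p" by standard
  interpret PP: pair_prob_space torus "measure_pmf p" by standard
  let ?f = "\<lambda>t v. char_fn p t ^ n * cos (phase x t - phase v t)"
  have meas: "case_prod ?f \<in> borel_measurable (torus \<Otimes>\<^sub>M measure_pmf p)"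
    using measurable_phase_pair[of p] by (simp add: case_prod_beta)
  have bound: "\<bar>?f t v\<bar> \<le> 1" for t v
    using abs_char_fn_le[of p t] by (auto simp: abs_mult power_abs intro!: mult_le_one power_le_one)
  have int: "integrable (torus \<Otimes>\<^sub>M measure_pmf p) (case_prod ?f)"
    by (rule PP.P.integrable_const_bound[where B = 1]) (use meas bound in auto)
  have "walk_prob p (Suc n) x = expect p (\<lambda>v. \<integral>t. ?f t v \<partial>torus)"
    by (simp add: walk_prob_Suc Suc.IH phase_diff)
  also have "\<dots> = (\<integral>t. expect p (\<lambda>v. ?f t v) \<partial>torus)"
    by (rule P.Fubini_integral[OF int])
  also have "\<dots> = (\<integral>t. char_fn p t ^ Suc n * cos (phase x t) \<partial>torus)"
    by (simp add: expectation_cos_shift[OF sym] algebra_simps)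
  finally show ?case .
qed

lemma integrable_gaussian: "a > 0 \<Longrightarrow> integrable torus (\<lambda>t :: 'd::finite \<Rightarrow> real. exp (- a * norm2 t))"
  by (rule integrable_torus_bounded[where B = 1]) auto

text \<open>
  The right-hand side only sees the positive part of \<open>f\<close>.
\<close>

lemma ennreal_integral_le_nn_integral:
  fixes f :: "'b \<Rightarrow> real"
  assumes "integrable M f"
  shows "ennreal (integral\<^sup>L M f) \<le> (\<integral>\<^sup>+x. ennreal (f x) \<partial>M)"
proof -
  have int: "integrable M (\<lambda>x. max 0 (f x))" using assms by (intro integrable_max) auto
  have "integral\<^sup>L M f \<le> (\<integral>x. max 0 (f x) \<partial>M)" by (intro integral_mono assms int) auto
  then have "ennreal (integral\<^sup>L M f) \<le> ennreal (\<integral>x. max 0 (f x) \<partial>M)" by (rule ennreal_leI)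
  also have "\<dots> = (\<integral>\<^sup>+x. ennreal (max 0 (f x)) \<partial>M)" by (rule nn_integral_eq_integral[symmetric]) (use int in auto)
  also have "\<dots> = (\<integral>\<^sup>+x. ennreal (f x) \<partial>M)" by (intro nn_integral_cong) (auto simp: max_def ennreal_neg)
  finally show ?thesis .
qed

text \<open>
  The full series is \<open>2\<close> for every \<open>k\<close>: it is the expected time that a walk standing still with probability
  one half at each step spends having made exactly \<open>k\<close> moves.  Pascal's rule gives the induction.
\<close>

lemma sum_binomial_half_le: "(\<Sum>n<M. real (n choose k) / 2 ^ n) \<le> 2"
proof (induction k arbitrary: M)
  case 0
  have "(\<Sum>n<M. (1 / 2) ^ n :: real) = (1 - (1/2) ^ M) / (1 - 1/2)" by (simp add: sum_gp_strict)
  also have "\<dots> \<le> 2" by simp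
  finally show ?case by (simp add: power_divide)
next
  case (Suc k)
  show ?case
  proof (cases M)
    case (Suc M')
    let ?S = "\<lambda>M k. \<Sum>n<M. real (n choose k) / 2 ^ n"
    have "?S M (Suc k) = (\<Sum>n<M'. real (Suc n choose Suc k) / 2 ^ Suc n)"
      unfolding Suc sum.lessThan_Suc_shift by simp
    also have "\<dots> = 1 / 2 * ?S M' k + 1 / 2 * ?S M' (Suc k)"
      by (simp add: sum_distrib_left sum.distrib[symmetric] add_divide_distrib)
    also have "?S M' (Suc k) \<le> ?S M (Suc k)" unfolding Suc by simp
    finally show ?thesis using Suc.IH[of M'] by simp
  qed simp
qed

lemma real_vec_0: "real_vec 0 = 0"
  by (simp add: real_vec_def vec_eq_iff)

lemma norm_real_vec_ge_1:
  fixes x :: "int ^ 'd"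
  assumes "x \<noteq> 0"
  shows "1 \<le> norm (real_vec x)"
proof -
  obtain i where "x $ i \<noteq> 0" using assms by (auto simp: vec_eq_iff)
  then have "1 \<le> \<bar>real_vec x $ i\<bar>" by (simp add: real_vec_def)
  also have "\<dots> \<le> norm (real_vec x)" by (rule component_le_norm_cart)
  finally show ?thesis .
qed

section \<open>A lower bound for the Green function\<close>

locale lattice_step =
  fixes p :: "(int ^ 'd) pmf"
  assumes symm: "map_pmf uminus p = p"
    and reach: "\<And>x. \<exists>n. walk_prob p n x > 0"
    and second_moment: "integrable p (\<lambda>v. (norm (real_vec v))\<^sup>2)"
    and dim: "CARD('d) \<ge> 3"
begin

text \<open>
  Characteristic function of the walk that stays put with probability one half at each step.
  It is nonnegative and has modulus \<open>1\<close> only at \<open>0\<close>, also when the walk itself is periodic.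
\<close>

definition lazy :: "('d \<Rightarrow> real) \<Rightarrow> real" where
  "lazy t = (1 + char_fn p t) / 2"

lemma measurable_lazy [measurable]: "lazy \<in> borel_measurable torus"
  unfolding lazy_def by measurable

lemma lazy_bounds: "0 \<le> lazy t" "lazy t \<le> 1"
  using abs_char_fn_le[of p t] by (auto simp: lazy_def)

lemma one_minus_char_fn: "1 - char_fn p t = expect p (\<lambda>v. 1 - cos (phase v t))"
  unfolding char_fn_def by (subst Bochner_Integration.integral_diff) (auto intro!: integrable_pmf_bounded[where B = 1])

lemma one_minus_char_fn_ge: "pmf p v * (2 * (sin (phase v t / 2))\<^sup>2) \<le> 1 - char_fn p t"
proof -
  have "pmf p v * (1 - cos (phase v t)) = expect p (\<lambda>w. indicator {v} w * (1 - cos (phase v t)))"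
    by (simp add: measure_pmf_single)
  also have "\<dots> \<le> expect p (\<lambda>w. 1 - cos (phase w t))"
  proof (intro integral_mono integrable_pmf_bounded[where B = 2])
    show "\<bar>1 - cos (phase w t)\<bar> \<le> 2" for w using cos_ge_minus_one[of "phase w t"] by simp
    show "\<bar>indicator {v} w * (1 - cos (phase v t))\<bar> \<le> 2" for w
      using cos_ge_minus_one[of "phase v t"] by (simp add: indicator_def)
  qed (auto simp: indicator_def)
  finally show ?thesis unfolding one_minus_char_fn one_minus_cos_eq .
qed

text \<open>
  \<open>\<bar>sin\<bar>\<close> is subadditive, and each single step \<open>v\<close> satisfies the bound because
  \<open>1 - \<phi>\<close> is an average of the functions \<open>2 sin\<^sup>2 (v \<cdot> t / 2)\<close>.
\<close>

lemma abs_sin_phase_le: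
  assumes "set xs \<subseteq> set_pmf p"
  shows "\<exists>K\<ge>0. \<forall>t. \<bar>sin (phase (sum_list xs) t / 2)\<bar> \<le> K * sqrt (1 - char_fn p t)"
  using assms
proof (induction xs)
  case Nil
  then show ?case by (auto intro!: exI[of _ 0])
next
  case (Cons v xs)
  then obtain K where K: "K \<ge> 0" "\<And>t. \<bar>sin (phase (sum_list xs) t / 2)\<bar> \<le> K * sqrt (1 - char_fn p t)" by auto
  have pv: "pmf p v > 0" using Cons.prems by (simp add: pmf_positive)
  define K' where "K' = sqrt (1 / (2 * pmf p v))"
  have "\<bar>sin (phase (sum_list (v # xs)) t / 2)\<bar> \<le> (K' + K) * sqrt (1 - char_fn p t)" for t
  proof -
    have "(sin (phase v t / 2))\<^sup>2 \<le> (1 / (2 * pmf p v)) * (1 - char_fn p t)"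
      using one_minus_char_fn_ge[of v t] pv by (simp add: field_simps)
    then have "sqrt ((sin (phase v t / 2))\<^sup>2) \<le> sqrt ((1 / (2 * pmf p v)) * (1 - char_fn p t))"
      by (rule real_sqrt_le_mono)
    then have "\<bar>sin (phase v t / 2)\<bar> \<le> K' * sqrt (1 - char_fn p t)"
      by (simp only: K'_def real_sqrt_mult real_sqrt_abs)
    moreover have "\<bar>sin (phase (sum_list (v # xs)) t / 2)\<bar> \<le> \<bar>sin (phase v t / 2)\<bar> + \<bar>sin (phase (sum_list xs) t / 2)\<bar>"
      using abs_sin_add_le[of "phase v t / 2" "phase (sum_list xs) t / 2"] by (simp add: phase_add add_divide_distrib)
    ultimately show ?thesis using K(2)[of t] by (simp add: algebra_simps)
  qed
  then show ?case using K(1) by (intro exI[of _ "K' + K"]) (auto simp: K'_def)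
qed

lemma reachable_list: "\<exists>xs. set xs \<subseteq> set_pmf p \<and> sum_list xs = x"
  using reach[of x] by (auto simp: walk_prob_pos_iff)

text \<open>
  Every unit vector is a sum of possible steps, so \<open>abs_sin_phase_le\<close> controls \<open>sin (t\<^sub>i / 2)\<close> and thus \<open>t\<^sub>i\<close>.
\<close>

lemma char_fn_quadratic: "\<exists>c>0. \<forall>t. (\<forall>i. \<bar>t i\<bar> \<le> pi) \<longrightarrow> c * norm2 t \<le> 1 - char_fn p t"
proof -
  have "\<exists>K\<ge>0. \<forall>t. \<bar>sin (t i / 2)\<bar> \<le> K * sqrt (1 - char_fn p t)" for i
  proof -
    obtain xs where "set xs \<subseteq> set_pmf p" "sum_list xs = axis i 1" using reachable_list by blast
    then show ?thesis using abs_sin_phase_le[of xs] by (simp add: phase_axis)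
  qed
  then obtain K where K: "\<And>i. K i \<ge> 0" "\<And>i t. \<bar>sin (t i / 2)\<bar> \<le> K i * sqrt (1 - char_fn p t)" by metis
  define D where "D = 1 + (\<Sum>i\<in>UNIV. 16 * (K i)\<^sup>2)"
  have D: "D > 0" unfolding D_def by (intro add_pos_nonneg sum_nonneg) auto
  have "norm2 t \<le> D * (1 - char_fn p t)" if t: "\<forall>i. \<bar>t i\<bar> \<le> pi" for t
  proof -
    have pos: "0 \<le> 1 - char_fn p t" using abs_char_fn_le[of p t] by simp
    have "(t i)\<^sup>2 \<le> 16 * (K i)\<^sup>2 * (1 - char_fn p t)" for i
    proof -
      have "\<bar>t i\<bar> \<le> 4 * \<bar>sin (t i / 2)\<bar>" using t by (intro abs_le_4_sin_half) auto
      also have "\<dots> \<le> 4 * (K i * sqrt (1 - char_fn p t))" using K(2)[of t i] by simp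
      finally have "\<bar>t i\<bar>\<^sup>2 \<le> (4 * (K i * sqrt (1 - char_fn p t)))\<^sup>2" by (intro power_mono) auto
      then show ?thesis using pos by (simp add: power_mult_distrib)
    qed
    then have "norm2 t \<le> (\<Sum>i\<in>UNIV. 16 * (K i)\<^sup>2 * (1 - char_fn p t))" unfolding norm2_def by (intro sum_mono)
    also have "\<dots> = (D - 1) * (1 - char_fn p t)" by (simp add: D_def sum_distrib_right)
    also have "\<dots> \<le> D * (1 - char_fn p t)" using pos by (intro mult_right_mono) auto
    finally show ?thesis .
  qed
  then show ?thesis using D by (intro exI[of _ "1 / D"]) (auto simp: field_simps)
qed

lemma lazy_le_gaussian: "\<exists>c>0. AE t in torus. \<forall>n. lazy t ^ n \<le> exp (- (c * n) * norm2 t)"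
proof -
  obtain c where c: "c > 0" "\<And>t. (\<forall>i. \<bar>t i\<bar> \<le> pi) \<Longrightarrow> c * norm2 t \<le> 1 - char_fn p t" using char_fn_quadratic by blast
  have "lazy t ^ n \<le> exp (- (c / 2 * n) * norm2 t)" if "\<forall>i. \<bar>t i\<bar> \<le> pi" for t n
  proof -
    have "lazy t \<le> 1 + - (c / 2 * norm2 t)" using c(2)[OF that] by (simp add: lazy_def)
    also have "\<dots> \<le> exp (- (c / 2 * norm2 t))" by (rule exp_ge_add_one_self)
    finally have "lazy t ^ n \<le> exp (- (c / 2 * norm2 t)) ^ n" by (intro power_mono lazy_bounds)
    also have "\<dots> = exp (- (c / 2 * n) * norm2 t)" by (simp add: exp_of_nat_mult[symmetric] algebra_simps)
    finally show ?thesis .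
  qed
  then show ?thesis using c(1) AE_torus_le_pi by (intro exI[of _ "c / 2"]) (auto elim!: eventually_mono)
qed

lemma lazy_ge: "\<exists>K>0. \<forall>t. 1 - K * norm2 t \<le> lazy t"
proof -
  define K where "K = 1 + expect p (\<lambda>v. (norm (real_vec v))\<^sup>2)"
  have K: "K > 0" unfolding K_def by (intro add_pos_nonneg integral_nonneg_AE) auto
  have "1 - char_fn p t \<le> K * norm2 t" for t
  proof -
    have "1 - char_fn p t \<le> expect p (\<lambda>v. (norm (real_vec v))\<^sup>2 * norm2 t)"
      unfolding one_minus_char_fn
    proof (intro integral_mono integrable_mult_left second_moment)
      show "integrable p (\<lambda>v. 1 - cos (phase v t))"
        by (rule integrable_pmf_bounded[where B = 2]) (use cos_ge_minus_one in \<open>auto simp: abs_le_iff\<close>)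
      fix v
      have "1 - cos (phase v t) \<le> (phase v t)\<^sup>2 / 2" by (rule one_minus_cos_le)
      also have "\<dots> \<le> (phase v t)\<^sup>2" by simp
      also have "\<dots> \<le> (norm (real_vec v))\<^sup>2 * norm2 t" by (rule phase_squared_le)
      finally show "1 - cos (phase v t) \<le> (norm (real_vec v))\<^sup>2 * norm2 t" .
    qed
    also have "\<dots> = (K - 1) * norm2 t" by (simp add: K_def)
    also have "\<dots> \<le> K * norm2 t" by (intro mult_right_mono) auto
    finally show ?thesis .
  qed
  moreover have "1 - (1 - char_fn p t) \<le> lazy t" for t using abs_char_fn_le[of p t] by (simp add: lazy_def)
  ultimately have "1 - K * norm2 t \<le> lazy t" for t by (meson diff_left_mono order_trans)
  then show ?thesis using K by blast
qed

lemma integrable_lazy_power: "integrable torus (\<lambda>t. lazy t ^ n)"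
  by (rule integrable_torus_bounded[where B = 1]) (use lazy_bounds in \<open>auto simp: power_le_one\<close>)

text \<open>
  Gaussian integrals; the factor \<open>\<bar>t\<bar>\<^sup>2\<close> gains \<open>1 / n\<close> because \<open>s exp (- 2 s) \<le> exp (- s)\<close>.
\<close>

lemma lazy_integral_bounds:
  "\<exists>C>0. \<forall>n\<ge>1. (\<integral>t. lazy t ^ n \<partial>torus) \<le> C * (1 / sqrt n) ^ CARD('d)
          \<and> integrable torus (\<lambda>t. norm2 t * lazy t ^ n)
          \<and> (\<integral>t. norm2 t * lazy t ^ n \<partial>torus) \<le> C / n * (1 / sqrt n) ^ CARD('d)"
proof -
  obtain c where c: "c > 0" and ae: "AE t in torus. \<forall>n. lazy t ^ n \<le> exp (- (c * n) * norm2 t)" using lazy_le_gaussian by blast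
  define d where "d = CARD('d)"
  define C1 where "C1 = (1 / sqrt c) ^ d"
  define C2 where "C2 = 2 / c * (1 / sqrt (c / 2)) ^ d"
  have pos: "C1 > 0" "C2 > 0" using c by (auto simp: C1_def C2_def)
  have b1: "(\<integral>t. lazy t ^ n \<partial>torus) \<le> C1 * (1 / sqrt n) ^ d" if n: "n \<ge> 1" for n :: nat
  proof -
    have a: "c * n > 0" using c n by simp
    have "(\<integral>t. lazy t ^ n \<partial>torus) \<le> (\<integral>t. exp (- (c * n) * norm2 t) \<partial>(torus :: ('d \<Rightarrow> real) measure))"
      by (intro integral_mono_AE integrable_lazy_power integrable_gaussian a) (use ae in \<open>auto elim: eventually_mono\<close>)
    also have "\<dots> \<le> (1 / sqrt (c * n)) ^ d" unfolding d_def by (rule integral_torus_gaussian_le[OF a])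
    also have "\<dots> = C1 * (1 / sqrt n) ^ d" by (simp add: C1_def real_sqrt_mult power_divide power_mult_distrib)
    finally show ?thesis .
  qed
  have b2: "integrable torus (\<lambda>t. norm2 t * lazy t ^ n) \<and>
       (\<integral>t. norm2 t * lazy t ^ n \<partial>torus) \<le> C2 / n * (1 / sqrt n) ^ d" if n: "n \<ge> 1" for n :: nat
  proof -
    define a where "a = c * n / 2"
    have a: "a > 0" using c n by (simp add: a_def)
    have pw: "norm2 t * exp (- (2 * a) * norm2 t) \<le> 1 / a * exp (- a * norm2 t)" for t :: "'d \<Rightarrow> real"
    proof -
      have "a * norm2 t \<le> exp (a * norm2 t)" using exp_ge_add_one_self[of "a * norm2 t"] by linarith
      then have "a * norm2 t * exp (- (2 * a) * norm2 t) \<le> exp (a * norm2 t) * exp (- (2 * a) * norm2 t)"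
        by (rule mult_right_mono) simp
      also have "\<dots> = exp (- a * norm2 t)" by (simp add: exp_add[symmetric])
      finally show ?thesis using a by (simp add: field_simps)
    qed
    have ig: "integrable torus (\<lambda>t :: 'd \<Rightarrow> real. 1 / a * exp (- a * norm2 t))"
      by (intro integrable_mult_right integrable_gaussian a)
    have le: "AE t in torus. norm2 t * lazy t ^ n \<le> 1 / a * exp (- a * norm2 t)"
      using ae
    proof eventually_elim
      case (elim t)
      have "norm2 t * lazy t ^ n \<le> norm2 t * exp (- (2 * a) * norm2 t)"
        using elim[rule_format, of n] by (intro mult_left_mono) (auto simp: a_def)
      also note pw
      finally show ?case .
    qed
    have int: "integrable torus (\<lambda>t. norm2 t * lazy t ^ n)"
      using ig by (rule Bochner_Integration.integrable_bound) (use le lazy_bounds a in \<open>auto elim!: eventually_mono simp: abs_mult\<close>)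
    have "(\<integral>t. norm2 t * lazy t ^ n \<partial>torus) \<le> (\<integral>t. 1 / a * exp (- a * norm2 t) \<partial>(torus :: ('d \<Rightarrow> real) measure))"
      by (intro integral_mono_AE int ig le)
    also have "\<dots> = 1 / a * (\<integral>t. exp (- a * norm2 t) \<partial>(torus :: ('d \<Rightarrow> real) measure))" by simp
    also have "\<dots> \<le> 1 / a * (1 / sqrt a) ^ d"
      unfolding d_def using a by (intro mult_left_mono integral_torus_gaussian_le) auto
    also have "\<dots> = C2 / n * (1 / sqrt n) ^ d"
    proof -
      have "a = c / 2 * n" by (simp add: a_def)
      then have "sqrt a = sqrt (c / 2) * sqrt n" by (simp only: real_sqrt_mult)
      then show ?thesis by (simp add: C2_def a_def power_divide power_mult_distrib)
    qed
    finally show ?thesis using int by simp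
  qed
  define C where "C = C1 + C2"
  have Cle: "C1 \<le> C" "C2 \<le> C" "C > 0" using pos by (auto simp: C_def)
  show ?thesis
  proof (intro exI[of _ C] conjI allI impI Cle(3))
    fix n :: nat assume n: "1 \<le> n"
    show "(\<integral>t. lazy t ^ n \<partial>torus) \<le> C * (1 / sqrt n) ^ CARD('d)"
      using b1[OF n] mult_right_mono[OF Cle(1), of "(1 / sqrt n) ^ d"] by (simp add: d_def)
    show "integrable torus (\<lambda>t. norm2 t * lazy t ^ n)" using b2[OF n] by simp
    have "C2 / n * (1 / sqrt n) ^ d \<le> C / n * (1 / sqrt n) ^ d"
      by (intro mult_right_mono divide_right_mono Cle(2)) auto
    then show "(\<integral>t. norm2 t * lazy t ^ n \<partial>torus) \<le> C / n * (1 / sqrt n) ^ CARD('d)"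
      using b2[OF n] by (simp add: d_def)
  qed
qed

text \<open>
  On the box of side of order \<open>1 / sqrt n\<close> Bernoulli's inequality keeps \<open>lazy t ^ n\<close> above one half.
\<close>

lemma lazy_integral_ge: "\<exists>a>0. \<forall>n\<ge>1. a * (1 / sqrt n) ^ CARD('d) \<le> (\<integral>t. lazy t ^ n \<partial>torus)"
proof -
  obtain K where K: "K > 0" "\<And>t. 1 - K * norm2 t \<le> lazy t" using lazy_ge by blast
  define d where "d = CARD('d)"
  have d: "d > 0" using dim by (simp add: d_def)
  \<comment> \<open>chosen such that \<open>K * norm2 t \<le> 1 / (2 n)\<close> on the box \<open>\<bar>t\<^sub>i\<bar> \<le> \<rho> / sqrt n\<close>\<close>
  define \<rho> where "\<rho> = min 1 (sqrt (1 / (2 * K * d)))"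
  have \<rho>: "\<rho> > 0" "\<rho> \<le> 1" using K d by (auto simp: \<rho>_def)
  have "\<rho>\<^sup>2 \<le> (sqrt (1 / (2 * K * d)))\<^sup>2" using \<rho> by (intro power_mono) (auto simp: \<rho>_def)
  then have \<rho>2: "K * d * \<rho>\<^sup>2 \<le> 1 / 2" using K d by (simp add: field_simps)
  have "1 / 2 * (\<rho> / pi) ^ d * (1 / sqrt n) ^ d \<le> (\<integral>t. lazy t ^ n \<partial>torus)" if n: "n \<ge> 1" for n :: nat
  proof -
    define B where "B = {t :: 'd \<Rightarrow> real. \<forall>i. \<bar>t i\<bar> \<le> \<rho> / sqrt n}"
    have sn: "sqrt n \<ge> 1" using n by simp
    have r: "0 \<le> \<rho> / sqrt n" "\<rho> / sqrt n \<le> pi"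
    proof -
      have "\<rho> / sqrt n \<le> 1 / 1" using \<rho> sn by (intro frac_le) auto
      then show "\<rho> / sqrt n \<le> pi" using pi_ge_two by simp
    qed (use \<rho> in auto)
    have mB: "torus.prob B = (\<rho> / sqrt n / pi) ^ d"
      unfolding B_def d_def by (rule measure_torus_box) (use r in auto)
    have pw: "1 / 2 * indicator B t \<le> lazy t ^ n" for t
    proof (cases "t \<in> B")
      case True
      have "norm2 t \<le> (\<Sum>i\<in>(UNIV :: 'd set). (\<rho> / sqrt n)\<^sup>2)"
        unfolding norm2_def
      proof (rule sum_mono)
        fix i
        have "\<bar>t i\<bar> ^ 2 \<le> (\<rho> / sqrt n)\<^sup>2" using True by (intro power_mono) (auto simp: B_def)
        then show "(t i)\<^sup>2 \<le> (\<rho> / sqrt n)\<^sup>2" by simp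
      qed
      also have "\<dots> = d * \<rho>\<^sup>2 / n" by (simp add: d_def power_divide)
      finally have "K * norm2 t \<le> K * (d * \<rho>\<^sup>2 / n)" using K by (intro mult_left_mono) auto
      also have "\<dots> \<le> 1 / (2 * n)" using \<rho>2 n by (simp add: field_simps)
      finally have kn: "K * norm2 t \<le> 1 / (2 * n)" .
      have "1 / 2 \<le> 1 - n * (K * norm2 t)" using kn n by (simp add: field_simps)
      also have "\<dots> = 1 + of_nat n * (- (K * norm2 t))" by simp
      also have "\<dots> \<le> (1 + (- (K * norm2 t))) ^ n"
      proof (rule Bernoulli_inequality)
        have "1 / (2 * n) \<le> (1 :: real)" using n by simp
        with kn show "- 1 \<le> - (K * norm2 t)" by linarith
      qed
      also have "\<dots> \<le> lazy t ^ n"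
      proof (rule power_mono)
        show "1 + - (K * norm2 t) \<le> lazy t" using K(2)[of t] by simp
        have "1 / (2 * n) \<le> (1 :: real)" using n by simp
        with kn show "0 \<le> 1 + - (K * norm2 t)" by linarith
      qed
      finally show ?thesis using True by simp
    qed (use lazy_bounds in auto)
    have "1 / 2 * torus.prob B = (\<integral>t. 1 / 2 * indicator B t \<partial>torus)"
    proof -
      have "torus.prob B > 0 " unfolding mB using \<rho> sn by (auto intro!: zero_less_power divide_pos_pos)
      then have "B \<in> sets torus" using measure_notin_sets by fastforce
      then show ?thesis by simp
    qed
    also have "\<dots> \<le> (\<integral>t. lazy t ^ n \<partial>torus)"
    proof (intro integral_mono integrable_lazy_power pw)
      have "torus.prob B > 0 " unfolding mB using \<rho> sn by (auto intro!: zero_less_power divide_pos_pos)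
      then have "B \<in> sets torus" using measure_notin_sets by fastforce
      then show "integrable torus (\<lambda>t. 1 / 2 * indicator B t :: real)"
        by (intro integrable_torus_bounded[where B = 1]) (auto simp: indicator_def)
    qed
    finally show ?thesis by (simp add: mB power_divide power_mult_distrib mult_ac)
  qed
  then show ?thesis using \<rho> unfolding d_def[symmetric] by (intro exI[of _ "1 / 2 * (\<rho> / pi) ^ d"]) auto
qed

text \<open>
  Summing the geometric series, \<open>\<Sum>k<N. \<phi>\<^sup>k \<le> 2 / (1 - \<phi>) = 1 / (1 - \<chi>) = \<Sum>n. \<chi>\<^sup>n\<close> for \<open>\<chi> = lazy t\<close>, and the integrals of the
  last terms are summable since \<open>d \<ge> 3\<close>.
\<close>

lemma summable_return_prob: "summable (\<lambda>n. walk_prob p (Suc n) 0)"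
proof -
  obtain C where C: "C > 0" "\<And>n. n \<ge> 1 \<Longrightarrow> (\<integral>t. lazy t ^ n \<partial>torus) \<le> C * (1 / sqrt n) ^ CARD('d)"
    using lazy_integral_bounds by blast
  have summ: "summable (\<lambda>n. \<integral>t. lazy t ^ n \<partial>torus)"
  proof (rule summable_comparison_test_ev)
    show "\<forall>\<^sub>F n in sequentially. norm (\<integral>t. lazy t ^ n \<partial>torus) \<le> C * (1 / real n powr (3 / 2))"
    proof (rule eventually_sequentiallyI[of 1])
      fix n :: nat assume n: "n \<ge> 1"
      have "norm (\<integral>t. lazy t ^ n \<partial>torus) = (\<integral>t. lazy t ^ n \<partial>torus)"
        using lazy_bounds by (auto intro!: abs_of_nonneg integral_nonneg_AE)
      also have "\<dots> \<le> C * (1 / sqrt n) ^ CARD('d)" by (rule C(2)[OF n])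
      also have "\<dots> \<le> C * (1 / sqrt n) ^ 3"
        using C(1) n dim by (intro mult_left_mono power_decreasing) auto
      also have "(1 / sqrt n) ^ 3 = 1 / real n powr (3 / 2)"
        using n by (simp add: powr_half_sqrt[symmetric] power_divide powr_powr powr_realpow[symmetric])
      finally show "norm (\<integral>t. lazy t ^ n \<partial>torus) \<le> C * (1 / real n powr (3 / 2))" .
    qed
    show "summable (\<lambda>n. C * (1 / real n powr (3 / 2)))"
      using summable_real_powr_iff[of "-3/2"] by (intro summable_mult) (simp add: powr_minus_divide)
  qed
  define T where "T = (\<Sum>n. \<integral>t. lazy t ^ n \<partial>torus)"
  have le: "(\<Sum>k<N. walk_prob p k 0) \<le> T" for N
  proof -
    have int: "integrable torus (\<lambda>t. char_fn p t ^ k)" for k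
      by (rule integrable_torus_bounded[where B = 1]) (use abs_char_fn_le[of p] in \<open>auto simp: power_abs power_le_one\<close>)
    have pw: "ennreal (\<Sum>k<N. char_fn p t ^ k) \<le> (\<Sum>n. ennreal (lazy t ^ n))" for t
    proof (cases "char_fn p t = 1")
      case True
      have "ennreal (\<Sum>k<N. char_fn p t ^ k) = (\<Sum>n<N. ennreal (lazy t ^ n))"
        using True by (simp add: lazy_def ennreal_of_nat_eq_real_of_nat)
      also have "\<dots> \<le> (\<Sum>n. ennreal (lazy t ^ n))" by (rule sum_le_suminf) auto
      finally show ?thesis .
    next
      case False
      then have lt: "char_fn p t < 1" using abs_char_fn_le[of p t] by simp
      then have l1: "norm (lazy t) < 1" using lazy_bounds[of t] by (simp add: lazy_def)
      have "(\<Sum>k<N. char_fn p t ^ k) = (1 - char_fn p t ^ N) / (1 - char_fn p t)"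
        using False sum_gp_strict[of "char_fn p t" N] by simp
      also have "\<dots> \<le> 2 / (1 - char_fn p t)"
      proof (intro divide_right_mono)
        have "\<bar>char_fn p t ^ N\<bar> \<le> 1" using abs_char_fn_le[of p t] by (simp add: power_abs power_le_one)
        then show "1 - char_fn p t ^ N \<le> 2" by linarith
      qed (use lt in auto)
      also have "\<dots> = 1 / (1 - lazy t)" using lt by (simp add: lazy_def field_simps)
      also have "\<dots> = (\<Sum>n. lazy t ^ n)" by (rule suminf_geometric[OF l1, symmetric])
      finally have "ennreal (\<Sum>k<N. char_fn p t ^ k) \<le> ennreal (\<Sum>n. lazy t ^ n)" by (rule ennreal_leI)
      also have "\<dots> = (\<Sum>n. ennreal (lazy t ^ n))"
        using l1 lazy_bounds by (intro suminf_ennreal2[symmetric] summable_geometric) auto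
      finally show ?thesis .
    qed
    have "(\<Sum>k<N. walk_prob p k 0) = (\<integral>t. (\<Sum>k<N. char_fn p t ^ k) \<partial>torus)"
      by (simp add: walk_prob_fourier[OF symm] int)
    also have "ennreal \<dots> \<le> (\<integral>\<^sup>+t. ennreal (\<Sum>k<N. char_fn p t ^ k) \<partial>torus)"
      by (intro ennreal_integral_le_nn_integral Bochner_Integration.integrable_sum int)
    also have "\<dots> \<le> (\<integral>\<^sup>+t. (\<Sum>n. ennreal (lazy t ^ n)) \<partial>torus)" by (intro nn_integral_mono pw)
    also have "\<dots> = (\<Sum>n. \<integral>\<^sup>+t. ennreal (lazy t ^ n) \<partial>torus)" by (rule nn_integral_suminf) measurable
    also have "\<dots> = (\<Sum>n. ennreal (\<integral>t. lazy t ^ n \<partial>torus))"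
      by (intro suminf_cong nn_integral_eq_integral integrable_lazy_power) (use lazy_bounds in auto)
    also have "\<dots> = ennreal T"
      unfolding T_def by (intro suminf_ennreal2 summ) (use lazy_bounds in \<open>auto intro!: integral_nonneg_AE\<close>)
    finally have "ennreal (\<Sum>k<N. walk_prob p k 0) \<le> ennreal T" .
    moreover have "T \<ge> 0" unfolding T_def by (intro suminf_nonneg summ) (use lazy_bounds in \<open>auto intro!: integral_nonneg_AE\<close>)
    ultimately show ?thesis by (simp add: ennreal_le_iff)
  qed
  show ?thesis
  proof (rule bounded_imp_summable[where B = T])
    fix n
    have "(\<Sum>k\<le>n. walk_prob p (Suc k) 0) \<le> (\<Sum>k<Suc (Suc n). walk_prob p k 0)"
      by (subst sum.lessThan_Suc_shift) (simp add: lessThan_Suc_atMost walk_prob_0 del: sum.lessThan_Suc)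
    also note le
    finally show "(\<Sum>k\<le>n. walk_prob p (Suc k) 0) \<le> T" .
  qed simp
qed

sublocale symmetric_transient_walk p
  by unfold_locales (rule summable_return_prob, rule symm)

lemma lazy_power_fourier:
  "(\<integral>t. lazy t ^ n * cos (phase x t) \<partial>torus) = (\<Sum>k\<le>n. real (n choose k) / 2 ^ n * walk_prob p k x)"
proof -
  have int: "integrable torus (\<lambda>t. char_fn p t ^ k * cos (phase x t))" for k
  proof (rule integrable_torus_bounded[where B = 1])
    show "\<bar>char_fn p t ^ k * cos (phase x t)\<bar> \<le> 1" for t
      using abs_char_fn_le[of p t] by (auto simp: abs_mult power_abs intro!: mult_le_one power_le_one)
  qed measurable
  have e: "lazy t ^ n * cos (phase x t) = (\<Sum>k\<le>n. real (n choose k) / 2 ^ n * (char_fn p t ^ k * cos (phase x t)))" for t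
  proof -
    have "lazy t ^ n = (char_fn p t + 1) ^ n / 2 ^ n" by (simp add: lazy_def power_divide add.commute)
    also have "\<dots> = (\<Sum>k\<le>n. real (n choose k) / 2 ^ n * char_fn p t ^ k)"
      unfolding binomial_ring by (simp add: sum_divide_distrib)
    finally show ?thesis by (simp add: sum_distrib_right mult.assoc)
  qed
  show ?thesis unfolding e by (simp add: int walk_prob_fourier[OF symm])
qed

text \<open>
  The lazy walk at time \<open>n\<close> has made a binomial number of moves, so its Green function is twice the original one;
  on a finite window of times only the upper bound survives.
\<close>

lemma green_ge_lazy:
  assumes "x \<noteq> 0"
  shows "(\<Sum>n=N..<2*N. \<integral>t. lazy t ^ n * cos (phase x t) \<partial>torus) \<le> 2 * green p x"
proof -
  have "(\<Sum>n=N..<2*N. \<integral>t. lazy t ^ n * cos (phase x t) \<partial>torus)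
      = (\<Sum>n=N..<2*N. \<Sum>k<2*N. real (n choose k) / 2 ^ n * walk_prob p k x)"
    unfolding lazy_power_fourier
    by (intro sum.cong refl sum.mono_neutral_left) (auto simp: binomial_eq_0)
  also have "\<dots> \<le> (\<Sum>n<2*N. \<Sum>k<2*N. real (n choose k) / 2 ^ n * walk_prob p k x)"
    by (intro sum_mono2) (auto intro!: sum_nonneg)
  also have "\<dots> = (\<Sum>k<2*N. (\<Sum>n<2*N. real (n choose k) / 2 ^ n) * walk_prob p k x)"
    by (subst sum.swap) (simp add: sum_distrib_right)
  also have "\<dots> \<le> (\<Sum>k<2*N. 2 * walk_prob p k x)"
    by (intro sum_mono mult_right_mono sum_binomial_half_le) auto
  also have "\<dots> = 2 * (\<Sum>k<2*N. walk_prob p k x)" by (simp add: sum_distrib_left)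
  also have "(\<Sum>k<2*N. walk_prob p k x) \<le> (\<Sum>k<Suc (2*N). walk_prob p k x)" by simp
  also have "\<dots> = (\<Sum>k<2*N. walk_prob p (Suc k) x)"
    unfolding sum.lessThan_Suc_shift using assms by (simp add: walk_prob_0)
  also have "\<dots> \<le> green p x"
    unfolding green_def by (intro sum_le_suminf summable_walk_prob) auto
  finally show ?thesis by simp
qed

text \<open>
  For \<open>n \<ge> C \<bar>x\<bar>\<^sup>2 / a\<close> the loss from replacing \<open>1\<close> by \<open>cos (x \<cdot> t)\<close> is at most half of \<open>\<integral> lazy\<^sup>n \<ge> a n ^ (- d / 2)\<close>;
  \<open>N\<close> is the least such time up to a bounded error, and \<open>n\<close> runs from \<open>N\<close> to \<open>2 N\<close>.
\<close>

lemma green_lower_bound: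
  "\<exists>c>0. \<forall>x. x \<noteq> 0 \<longrightarrow> c * (1 / norm (real_vec x)) ^ (CARD('d) - 2) \<le> green p x"
proof -
  obtain a where a: "a > 0" "\<And>n. n \<ge> 1 \<Longrightarrow> a * (1 / sqrt n) ^ CARD('d) \<le> (\<integral>t. lazy t ^ n \<partial>torus)"
    using lazy_integral_ge by blast
  obtain C where C: "C > 0" "\<And>n. n \<ge> 1 \<Longrightarrow> integrable torus (\<lambda>t. norm2 t * lazy t ^ n)"
    "\<And>n. n \<ge> 1 \<Longrightarrow> (\<integral>t. norm2 t * lazy t ^ n \<partial>torus) \<le> C / n * (1 / sqrt n) ^ CARD('d)"
    using lazy_integral_bounds by blast
  define d where "d = CARD('d)"
  have d3: "d \<ge> 3" using dim by (simp add: d_def)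
  define D where "D = C / a + 2"
  have D: "D > 0" using a C by (simp add: D_def add_pos_pos)
  define c where "c = a / 4 * (1 / sqrt 2) ^ d * (1 / sqrt D) ^ (d - 2)"
  have c: "c > 0" using a D by (simp add: c_def)
  have "c * (1 / norm (real_vec x)) ^ (d - 2) \<le> green p x" if x: "x \<noteq> 0" for x
  proof -
    define L where "L = norm (real_vec x)"
    have L: "L \<ge> 1" unfolding L_def by (rule norm_real_vec_ge_1[OF x])
    define N where "N = nat \<lceil>C * L\<^sup>2 / a\<rceil> + 1"
    have N1: "N \<ge> 1" by (simp add: N_def)
    have z: "0 \<le> C * L\<^sup>2 / a" using C a by simp
    have NL: "C * L\<^sup>2 / a \<le> N" using z le_of_int_ceiling[of "C * L\<^sup>2 / a"] by (simp add: N_def) linarith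
    have "real N \<le> C * L\<^sup>2 / a + 2" using z of_int_ceiling_le_add_one[of "C * L\<^sup>2 / a"] by (simp add: N_def) linarith
    also have "\<dots> \<le> C * L\<^sup>2 / a + 2 * L\<^sup>2" using L by (simp add: one_le_power)
    also have "\<dots> = D * L\<^sup>2" by (simp add: D_def algebra_simps)
    finally have ND: "real N \<le> D * L\<^sup>2" .
    have term_ge: "a / 2 * (1 / sqrt (2 * N)) ^ d \<le> (\<integral>t. lazy t ^ n * cos (phase x t) \<partial>torus)" if n: "N \<le> n" "n < 2 * N" for n
    proof -
      have n1: "n \<ge> 1" using n N1 by simp
      have ic: "integrable torus (\<lambda>t. lazy t ^ n * cos (phase x t))"
        by (rule integrable_torus_bounded[where B = 1])
           (use lazy_bounds in \<open>auto simp: abs_mult power_le_one intro!: mult_le_one\<close>)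
      have i2: "integrable torus (\<lambda>t. L\<^sup>2 / 2 * (norm2 t * lazy t ^ n))" by (intro integrable_mult_right C(2)[OF n1])
      have "(\<integral>t. lazy t ^ n \<partial>torus) - (\<integral>t. L\<^sup>2 / 2 * (norm2 t * lazy t ^ n) \<partial>torus)
          = (\<integral>t. lazy t ^ n - L\<^sup>2 / 2 * (norm2 t * lazy t ^ n) \<partial>torus)"
        by (rule Bochner_Integration.integral_diff[symmetric]) (intro integrable_lazy_power i2)+
      also have "\<dots> \<le> (\<integral>t. lazy t ^ n * cos (phase x t) \<partial>torus)"
      proof (intro integral_mono Bochner_Integration.integrable_diff integrable_lazy_power i2 ic)
        fix t :: "'d \<Rightarrow> real"
        have "1 - cos (phase x t) \<le> L\<^sup>2 / 2 * norm2 t"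
          using one_minus_cos_le[of "phase x t"] phase_squared_le[of x t] by (simp add: L_def)
        then have "lazy t ^ n * (1 - cos (phase x t)) \<le> lazy t ^ n * (L\<^sup>2 / 2 * norm2 t)"
          using lazy_bounds by (intro mult_left_mono) auto
        then show "lazy t ^ n - L\<^sup>2 / 2 * (norm2 t * lazy t ^ n) \<le> lazy t ^ n * cos (phase x t)"
          by (simp add: algebra_simps)
      qed
      finally have le: "(\<integral>t. lazy t ^ n \<partial>torus) - L\<^sup>2 / 2 * (\<integral>t. norm2 t * lazy t ^ n \<partial>torus)
          \<le> (\<integral>t. lazy t ^ n * cos (phase x t) \<partial>torus)" by simp
      have "L\<^sup>2 / 2 * (\<integral>t. norm2 t * lazy t ^ n \<partial>torus) \<le> L\<^sup>2 / 2 * (C / n * (1 / sqrt n) ^ d)"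
        using C(3)[OF n1] by (intro mult_left_mono) (auto simp: d_def)
      also have "\<dots> = (C * L\<^sup>2 / n) / 2 * (1 / sqrt n) ^ d" by (simp add: mult_ac)
      also have "\<dots> \<le> a / 2 * (1 / sqrt n) ^ d"
      proof (intro mult_right_mono divide_right_mono)
        have "C * L\<^sup>2 / a \<le> n" using NL n by linarith
        then show "C * L\<^sup>2 / n \<le> a" using a n1 by (simp add: field_simps)
      qed auto
      finally have "a / 2 * (1 / sqrt n) ^ d \<le> (\<integral>t. lazy t ^ n * cos (phase x t) \<partial>torus)"
        using le a(2)[OF n1] by (simp add: d_def)
      moreover have "a / 2 * (1 / sqrt (2 * N)) ^ d \<le> a / 2 * (1 / sqrt n) ^ d"
        using a n n1 by (intro mult_left_mono power_mono divide_left_mono) auto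
      ultimately show ?thesis by linarith
    qed
    have "c * (1 / L) ^ (d - 2) = a / 4 * (1 / sqrt 2) ^ d * (1 / (sqrt D * L)) ^ (d - 2)"
      by (simp add: c_def power_mult_distrib power_divide)
    also have "\<dots> \<le> a / 4 * (1 / sqrt 2) ^ d * (1 / sqrt N) ^ (d - 2)"
    proof (intro mult_left_mono power_mono divide_left_mono)
      have "sqrt N \<le> sqrt (D * L\<^sup>2)" using ND by simp
      then show "sqrt N \<le> sqrt D * L" using L by (simp add: real_sqrt_mult)
    qed (use a D L N1 in auto)
    also have "(1 / sqrt N) ^ (d - 2) = N * (1 / sqrt N) ^ d"
    proof -
      have "d = (d - 2) + 2" using d3 by simp
      then have "(1 / sqrt N) ^ d = (1 / sqrt N) ^ (d - 2) * (1 / sqrt N)\<^sup>2" by (metis power_add)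
      then show ?thesis using N1 by (simp add: power_divide)
    qed
    also have "a / 4 * (1 / sqrt 2) ^ d * (N * (1 / sqrt N) ^ d) = 1 / 2 * (\<Sum>n=N..<2*N. a / 2 * (1 / sqrt (2 * N)) ^ d)"
      by (simp add: real_sqrt_mult power_divide power_mult_distrib mult_ac)
    also have "\<dots> \<le> 1 / 2 * (\<Sum>n=N..<2*N. \<integral>t. lazy t ^ n * cos (phase x t) \<partial>torus)"
      by (intro mult_left_mono sum_mono term_ge) auto
    also have "\<dots> \<le> 1 / 2 * (2 * green p x)"
      by (intro mult_left_mono green_ge_lazy x) auto
    finally show ?thesis by (simp add: L_def)
  qed
  then show ?thesis using c unfolding d_def by blast
qed

lemma green_pos: "x \<noteq> 0 \<Longrightarrow> green p x > 0"
proof -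
  assume x: "x \<noteq> 0"
  obtain c where c: "c > 0" "\<And>x. x \<noteq> 0 \<Longrightarrow> c * (1 / norm (real_vec x)) ^ (CARD('d) - 2) \<le> green p x"
    using green_lower_bound by blast
  have "0 < c * (1 / norm (real_vec x)) ^ (CARD('d) - 2)"
    using c(1) norm_real_vec_ge_1[OF x] by (intro mult_pos_pos zero_less_power) auto
  with c(2)[OF x] show ?thesis by linarith
qed

lemma green_zero_pos: "green p 0 > 0"
proof -
  obtain x :: "int ^ 'd" where x: "x \<noteq> 0" by (metis axis_eq_0_iff zero_neq_one)
  have "0 < green p x * green p (- x)" using green_pos[of x] green_pos[of "- x"] x by simp
  also have "\<dots> \<le> green p 0 * (1 + green p 0)" by (rule green_mult_green_uminus_le)
  finally show ?thesis using green_nonneg[of 0] by (auto simp: zero_less_mult_iff)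
qed

end

section \<open>The covariance norm\<close>

lemma real_vec_add: "real_vec (x + y) = real_vec x + real_vec y"
  by (simp add: real_vec_def vec_eq_iff)

lemma matrix_inv_right_inverse: "invertible A \<Longrightarrow> A ** matrix_inv A = mat 1"
  unfolding matrix_inv_def invertible_def by (rule someI_ex[THEN conjunct1])

lemma finite_card_norm_ball:
  fixes R :: real
  assumes "R \<ge> 0"
  shows "finite {x :: int ^ 'd::finite. norm (real_vec x) \<le> R}"
    and "real (card {x :: int ^ 'd. norm (real_vec x) \<le> R}) \<le> (2 * R + 1) ^ CARD('d)"
proof -
  define S where "S = {- \<lfloor>R\<rfloor>..\<lfloor>R\<rfloor>}"
  define F where "F = (PiE (UNIV :: 'd set) (\<lambda>_. S))"
  have finF: "finite F" unfolding F_def S_def by (rule finite_PiE) auto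
  have sub: "{x :: int ^ 'd. norm (real_vec x) \<le> R} \<subseteq> vec_lambda ` F"
  proof
    fix x :: "int ^ 'd" assume x: "x \<in> {x. norm (real_vec x) \<le> R}"
    have "x $ i \<in> S" for i
    proof -
      have "\<bar>real_vec x $ i\<bar> \<le> R" using x component_le_norm_cart[of "real_vec x" i] by auto
      then have "of_int \<bar>x $ i\<bar> \<le> R" by (simp add: real_vec_def)
      then have "\<bar>x $ i\<bar> \<le> \<lfloor>R\<rfloor>" by (simp add: le_floor_iff)
      then show ?thesis by (auto simp: S_def)
    qed
    then have "vec_nth x \<in> F" by (auto simp: F_def PiE_UNIV_domain)
    then show "x \<in> vec_lambda ` F" by (metis image_eqI vec_nth_inverse)
  qed
  then show "finite {x :: int ^ 'd. norm (real_vec x) \<le> R}" using finF finite_subset by blast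
  have "card {x :: int ^ 'd. norm (real_vec x) \<le> R} \<le> card (vec_lambda ` F)"
    using sub finF by (intro card_mono) auto
  also have "\<dots> \<le> card F" by (rule card_image_le[OF finF])
  also have "\<dots> = card S ^ CARD('d)" unfolding F_def by (simp add: card_PiE)
  finally have "real (card {x :: int ^ 'd. norm (real_vec x) \<le> R}) \<le> real (card S) ^ CARD('d)"
    by (metis of_nat_le_iff of_nat_power)
  also have "\<dots> \<le> (2 * R + 1) ^ CARD('d)"
  proof (rule power_mono)
    have "real (card S) = 2 * of_int \<lfloor>R\<rfloor> + 1" using assms by (simp add: S_def)
    then show "real (card S) \<le> 2 * R + 1" using of_int_floor_le[of R] by linarith
  qed simp
  finally show "real (card {x :: int ^ 'd. norm (real_vec x) \<le> R}) \<le> (2 * R + 1) ^ CARD('d)" .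
qed

context lattice_step
begin

text \<open>
  By symmetry the steps are centred, so this is the covariance matrix (see \<open>covariance_eq\<close> below).
\<close>

definition covar :: "real ^ 'd ^ 'd" where
  "covar = (\<chi> i j. expect p (\<lambda>v. real_vec v $ i * real_vec v $ j))"

lemma integrable_coordinate_product: "integrable p (\<lambda>v. real_vec v $ i * real_vec v $ j)"
  using second_moment
proof (rule Bochner_Integration.integrable_bound)
  show "AE v in p. norm (real_vec v $ i * real_vec v $ j) \<le> norm ((norm (real_vec v))\<^sup>2)"
    by (intro AE_I2) (auto simp: abs_mult power2_eq_square intro!: mult_mono component_le_norm_cart)
qed auto

lemma inner_covar:
  "y \<bullet> (covar *v z) = expect p (\<lambda>v. (y \<bullet> real_vec v) * (z \<bullet> real_vec v))"
proof -
  have "y \<bullet> (covar *v z) = (\<Sum>i\<in>UNIV. \<Sum>j\<in>UNIV. y $ i * z $ j * expect p (\<lambda>v. real_vec v $ i * real_vec v $ j))"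
    by (simp add: inner_vec_def matrix_vector_mult_def covar_def sum_distrib_left mult_ac)
  also have "\<dots> = expect p (\<lambda>v. \<Sum>i\<in>UNIV. \<Sum>j\<in>UNIV. y $ i * z $ j * (real_vec v $ i * real_vec v $ j))"
    using integrable_coordinate_product by (simp add: Bochner_Integration.integral_sum)
  also have "(\<lambda>v. \<Sum>i\<in>UNIV. \<Sum>j\<in>UNIV. y $ i * z $ j * (real_vec v $ i * real_vec v $ j)) = (\<lambda>v. (y \<bullet> real_vec v) * (z \<bullet> real_vec v))"
    by (simp add: inner_vec_def sum_product mult_ac)
  finally show ?thesis .
qed

lemma integrable_inner_product: "integrable p (\<lambda>v. (y \<bullet> real_vec v) * (z \<bullet> real_vec v))"
proof (rule Bochner_Integration.integrable_bound)
  show "integrable p (\<lambda>v. norm y * norm z * (norm (real_vec v))\<^sup>2)" by (intro integrable_mult_right second_moment)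
  show "AE v in p. norm ((y \<bullet> real_vec v) * (z \<bullet> real_vec v)) \<le> norm (norm y * norm z * (norm (real_vec v))\<^sup>2)"
  proof (intro AE_I2)
    fix v
    have "\<bar>y \<bullet> real_vec v\<bar> * \<bar>z \<bullet> real_vec v\<bar> \<le> (norm y * norm (real_vec v)) * (norm z * norm (real_vec v))"
      by (intro mult_mono Cauchy_Schwarz_ineq2) auto
    then show "norm ((y \<bullet> real_vec v) * (z \<bullet> real_vec v)) \<le> norm (norm y * norm z * (norm (real_vec v))\<^sup>2)"
      by (simp add: abs_mult power2_eq_square mult_ac)
  qed
qed auto

text \<open>
  A vector in the kernel is orthogonal to every possible step, hence to every lattice point.
\<close>

lemma invertible_covar: "invertible covar"
proof -
  have "y = 0" if "covar *v y = 0" for y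
  proof -
    have "expect p (\<lambda>v. (y \<bullet> real_vec v) * (y \<bullet> real_vec v)) = 0"
      using that inner_covar[of y y] by simp
    then have "AE v in p. (y \<bullet> real_vec v) * (y \<bullet> real_vec v) = 0"
      by (subst (asm) integral_nonneg_eq_0_iff_AE[OF integrable_inner_product]) auto
    then have supp: "y \<bullet> real_vec v = 0" if "v \<in> set_pmf p" for v using that by (auto simp: AE_measure_pmf_iff)
    have sl: "set xs \<subseteq> set_pmf p \<Longrightarrow> y \<bullet> real_vec (sum_list xs) = 0" for xs
    proof (induction xs)
      case Nil
      then show ?case by (simp add: inner_vec_def real_vec_def)
    next
      case (Cons v xs)
      then show ?case using supp[of v] by (simp add: real_vec_add inner_add_right)
    qed
    have "y $ i = 0" for i
    proof -
      obtain xs where xs: "set xs \<subseteq> set_pmf p" "sum_list xs = axis i 1" using reachable_list by blast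
      have "real_vec (axis i 1) = axis i 1" by (simp add: real_vec_def axis_def vec_eq_iff)
      then show ?thesis using sl[OF xs(1)] xs(2) by (simp add: inner_axis)
    qed
    then show ?thesis by (simp add: vec_eq_iff)
  qed
  then show ?thesis by (simp add: invertible_left_inverse matrix_left_invertible_ker)
qed

text \<open>
  With \<open>x = Q z\<close> one has \<open>\<bar>x\<bar>\<^sup>2 = E ((x \<cdot> V) (z \<cdot> V))\<close> and \<open>\<parallel>x\<parallel>\<^sup>2 = E ((z \<cdot> V)\<^sup>2)\<close>.  The
  arithmetic-geometric mean inequality with weight \<open>K\<close> leaves half of \<open>\<bar>x\<bar>\<^sup>2\<close> on the right.
\<close>

lemma norm_le_cov_norm:
  "\<exists>K>0. \<forall>x. norm (real_vec x) \<le> K * cov_norm covar x"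
proof -
  define K where "K = 1 + expect p (\<lambda>v. (norm (real_vec v))\<^sup>2)"
  have K: "K > 0" unfolding K_def by (intro add_pos_nonneg integral_nonneg_AE) auto
  have "norm (real_vec x) \<le> sqrt K * cov_norm covar x" for x
  proof -
    define y where "y = real_vec x"
    define z where "z = matrix_inv covar *v y"
    have yz: "covar *v z = y"
      using invertible_covar by (simp add: z_def matrix_vector_mul_assoc matrix_inv_right_inverse)
    let ?E = "expect p"
    have zz: "?E (\<lambda>v. (z \<bullet> real_vec v) * (z \<bullet> real_vec v)) = y \<bullet> z"
      using inner_covar[of z z] by (simp add: yz inner_commute)
    have yy: "?E (\<lambda>v. (y \<bullet> real_vec v) * (y \<bullet> real_vec v)) \<le> K * (norm y)\<^sup>2"
    proof -
      have "(y \<bullet> b)\<^sup>2 \<le> (b \<bullet> b) * (y \<bullet> y)" for b using Cauchy_Schwarz_ineq[of y b] by (simp add: mult.commute)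
      then have "?E (\<lambda>v. (y \<bullet> real_vec v) * (y \<bullet> real_vec v)) \<le> ?E (\<lambda>v. (norm (real_vec v))\<^sup>2 * (norm y)\<^sup>2)"
        by (intro integral_mono integrable_inner_product integrable_mult_left second_moment)
           (simp add: power2_norm_eq_inner power2_eq_square[symmetric])
      also have "\<dots> = (K - 1) * (norm y)\<^sup>2" by (simp add: K_def)
      also have "\<dots> \<le> K * (norm y)\<^sup>2" by (intro mult_right_mono) auto
      finally show ?thesis .
    qed
    have "(norm y)\<^sup>2 = ?E (\<lambda>v. (y \<bullet> real_vec v) * (z \<bullet> real_vec v))"
      using inner_covar[of y z] by (simp add: yz power2_norm_eq_inner)
    also have "\<dots> \<le> ?E (\<lambda>v. K / 2 * ((z \<bullet> real_vec v) * (z \<bullet> real_vec v)) + 1 / (2 * K) * ((y \<bullet> real_vec v) * (y \<bullet> real_vec v)))"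
    proof (intro integral_mono Bochner_Integration.integrable_add integrable_mult_right integrable_inner_product)
      fix v
      define a b where "a = y \<bullet> real_vec v" and "b = z \<bullet> real_vec v"
      have "0 \<le> (a - K * b)\<^sup>2 / (2 * K)" using K by simp
      also have "\<dots> = K / 2 * (b * b) + 1 / (2 * K) * (a * a) - a * b"
        using K by (simp add: power2_eq_square field_simps)
      finally show "(y \<bullet> real_vec v) * (z \<bullet> real_vec v) \<le> K / 2 * ((z \<bullet> real_vec v) * (z \<bullet> real_vec v)) + 1 / (2 * K) * ((y \<bullet> real_vec v) * (y \<bullet> real_vec v))"
        by (simp add: a_def b_def)
    qed
    also have "\<dots> = K / 2 * (y \<bullet> z) + 1 / (2 * K) * ?E (\<lambda>v. (y \<bullet> real_vec v) * (y \<bullet> real_vec v))"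
      unfolding zz[symmetric]
      by (subst Bochner_Integration.integral_add) (auto intro!: integrable_inner_product integrable_mult_right simp del: zz)
    also have "\<dots> \<le> K / 2 * (y \<bullet> z) + 1 / (2 * K) * (K * (norm y)\<^sup>2)"
      using K yy by (intro add_left_mono mult_left_mono) auto
    also have "\<dots> = K / 2 * (y \<bullet> z) + (norm y)\<^sup>2 / 2" using K by simp
    finally have "(norm y)\<^sup>2 \<le> K * (y \<bullet> z)" by simp
    then have "norm y \<le> sqrt (K * (y \<bullet> z))" by (simp add: real_le_rsqrt)
    then show ?thesis by (simp add: cov_norm_def y_def[symmetric] z_def[symmetric] real_sqrt_mult)
  qed
  then show ?thesis using K by (intro exI[of _ "sqrt K"]) auto
qed

lemma cov_ball_bounds:
  obtains K where "K > 0"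
    and "\<And>r. r \<ge> 0 \<Longrightarrow> finite (cov_ball covar r)"
    and "\<And>r. r \<ge> 0 \<Longrightarrow> real (card (cov_ball covar r)) \<le> (K * (1 + r)) ^ CARD('d)"
    and "\<And>r x. r \<ge> 0 \<Longrightarrow> x \<in> cov_ball covar r \<Longrightarrow> norm (real_vec x) \<le> K * r"
proof -
  obtain K where K: "K > 0" "\<And>x. norm (real_vec x) \<le> K * cov_norm covar x" using norm_le_cov_norm by blast
  define K' where "K' = 2 * K + 1"
  have K'0: "K' > 0" using K by (simp add: K'_def)
  have "finite (cov_ball covar r) \<and> real (card (cov_ball covar r)) \<le> (K' * (1 + r)) ^ CARD('d)
     \<and> (\<forall>x\<in>cov_ball covar r. norm (real_vec x) \<le> K' * r)" if r: "r \<ge> 0" for r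
  proof (intro conjI ballI)
    have le: "norm (real_vec x) \<le> K * r" if "x \<in> cov_ball covar r" for x
      using K(2)[of x] K(1) that unfolding cov_ball_def by (auto intro: order_trans mult_left_mono)
    then have sub: "cov_ball covar r \<subseteq> {x. norm (real_vec x) \<le> K * r}" by auto
    have Kr: "K * r \<ge> 0" using K r by simp
    show "finite (cov_ball covar r)" using finite_card_norm_ball(1)[OF Kr] sub finite_subset by blast
    have "real (card (cov_ball covar r)) \<le> real (card {x :: int ^ 'd. norm (real_vec x) \<le> K * r})"
      using card_mono[OF finite_card_norm_ball(1)[OF Kr] sub] by simp
    also have "\<dots> \<le> (2 * (K * r) + 1) ^ CARD('d)" by (rule finite_card_norm_ball(2)[OF Kr])
    also have "\<dots> \<le> (K' * (1 + r)) ^ CARD('d)"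
      using K r by (intro power_mono) (auto simp: K'_def algebra_simps)
    finally show "real (card (cov_ball covar r)) \<le> (K' * (1 + r)) ^ CARD('d)" .
    fix x assume "x \<in> cov_ball covar r"
    then have "norm (real_vec x) \<le> K * r" by (rule le)
    also have "\<dots> \<le> K' * r" using K r by (intro mult_right_mono) (auto simp: K'_def)
    finally show "norm (real_vec x) \<le> K' * r" .
  qed
  then show thesis using that[of K'] K'0 by simp
qed

end

section \<open>Deviation bounds\<close>

locale random_walk = lattice_walk M X p + lattice_step p
  for M :: "'a measure" and X :: "nat \<Rightarrow> 'a \<Rightarrow> int ^ 'd" and p :: "(int ^ 'd) pmf"
begin

lemma covariance_eq: "covariance_matrix M (X 1) = covar"
proof -
  have D: "(\<integral>\<omega>. f (X 1 \<omega>) \<partial>M) = expect p f" for f :: "int ^ 'd \<Rightarrow> real"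
  proof -
    have "(\<integral>\<omega>. f (X 1 \<omega>) \<partial>M) = (\<integral>v. f v \<partial>distr M (count_space UNIV) (X 1))"
      by (rule integral_distr[symmetric]) (auto intro: measurable_X)
    then show ?thesis by (simp add: step_distr)
  qed
  have mean: "(\<integral>\<omega>. real_of_int (X 1 \<omega> $ i) \<partial>M) = 0" for i
  proof -
    have "expect p (\<lambda>v. real_of_int (v $ i)) = expect (map_pmf uminus p) (\<lambda>v. real_of_int (v $ i))"
      by (simp add: symm)
    then have "expect p (\<lambda>v. real_of_int (v $ i)) = 0" by simp
    then show ?thesis using D[of "\<lambda>v. real_of_int (v $ i)"] by simp
  qed
  show ?thesis
    using D[of "\<lambda>v. real_of_int (v $ i) * real_of_int (v $ j)" for i j]
    by (simp add: covariance_matrix_def Let_def mean covar_def real_vec_def vec_eq_iff del: One_nat_def)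
qed

text \<open>
  The constants \<open>\<lambda>\<close> and \<open>m\<^sub>x\<close> of the theorem in terms of the Green function.
\<close>

definition g0 where "g0 = green p 0"

definition lam where "lam = 1 / ln (1 + 1 / g0)"

definition m_ratio where "m_ratio x = (if x = 0 then 1 else (green p x)\<^sup>2 / (g0 * (1 + g0)))"

lemma g0_pos: "g0 > 0"
  unfolding g0_def by (rule green_zero_pos)

lemma lam_pos: "lam > 0"
  unfolding lam_def using g0_pos by (simp add: ln_gt_zero)

lemma m_ratio_pos: "m_ratio x > 0"
  using g0_pos green_pos[of x] by (auto simp: m_ratio_def)

lemma lambda_const_eq: "lambda_const M (walk X) = lam"
proof -
  have "1 - avoid_prob M (walk X) 0 = g0 / (1 + g0)"
    by (subst avoid_prob_eq) (unfold_locales, simp add: g0_def)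
  also have "\<dots> = inverse (1 + 1 / g0)" using g0_pos by (simp add: field_simps)
  finally have "1 - avoid_prob M (walk X) 0 = inverse (1 + 1 / g0)" .
  then have "ln (1 - avoid_prob M (walk X) 0) = - ln (1 + 1 / g0)"
    by (simp only: ln_inverse)
  then show ?thesis by (simp add: lambda_const_def lam_def)
qed

lemma m_const_eq: "m_const M (walk X) x = m_ratio x"
proof -
  have a: "1 - avoid_prob M (walk X) y = green p y / (1 + g0)" for y
    by (subst avoid_prob_eq) (unfold_locales, simp add: g0_def)
  have "(h / (1 + g0))\<^sup>2 / (g0 / (1 + g0)) = h\<^sup>2 / (g0 * (1 + g0))" for h
  proof -
    have "1 + g0 \<noteq> 0" "g0 \<noteq> 0" using g0_pos by auto
    then show ?thesis by (simp add: power2_eq_square divide_simps)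
  qed
  then show ?thesis unfolding m_const_def m_ratio_def a by (simp add: g0_def)
qed

abbreviation local_time :: "nat \<Rightarrow> int ^ 'd \<Rightarrow> 'a \<Rightarrow> ereal" where
  "local_time j x \<omega> \<equiv> total_local_time (\<lambda>i. walk X i \<omega>) (walk X j \<omega> + x)"

text \<open>
  The upper and the lower deviation use \<open>\<theta> = \<tau>\<close> and \<open>\<theta> = - \<tau>\<close>.  For small \<open>\<tau>\<close> the exponents are
  \<open>\<plusminus>\<tau> - (1 \<plusminus> e) (\<plusminus>\<tau>) = - e \<tau>\<close> to first order, times \<open>m\<^sub>x \<lambda> L\<close>; the value of \<open>\<tau>\<close> makes all quadratic
  corrections at most three quarters of this.  Two scales \<open>L' \<le> L\<close> are admitted since later \<open>log n\<close> is known
  only to lie between the logarithms of two powers of two.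
\<close>

lemma local_time_deviation:
  assumes x: "x \<noteq> 0" and k: "k \<ge> 1" and e: "0 < e" "e \<le> 1"
    and L: "0 \<le> L'" "L' \<le> L" and k1: "k - 1 \<le> lam * L'" and k2: "(1 - e / 4) * (lam * L) \<le> k - 1"
  defines "\<tau> \<equiv> e / (4 * (1 + g0))"
  shows "prob {\<omega>\<in>space M. ereal k \<le> local_time j 0 \<omega> \<and>
            (ereal ((1 + e) * m_ratio x * lam * L') \<le> local_time j x \<omega> \<or> local_time j x \<omega> \<le> ereal ((1 - e) * m_ratio x * lam * L))}
     \<le> 32 * exp 2 * (k + 1)\<^sup>2 * exp (- (k - 1) / lam - \<tau> * e / 4 * (m_ratio x * lam * L'))"
    (is "prob ?E \<le> _")
proof -
  have g0: "g0 > 0" by (rule g0_pos)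
  have \<tau>: "\<tau> > 0" "\<tau> * (1 + g0) = e / 4" using g0 e by (auto simp: \<tau>_def field_simps)
  have \<tau>g0: "0 < \<tau> * g0" "\<tau> * g0 \<le> e / 4" "\<tau> \<le> e / 4" using \<tau> g0 by (auto simp: algebra_simps)
  have w: "symmetric_transient_walk p" by unfold_locales
  have mx: "m_ratio x = (green p x)\<^sup>2 / (green p 0 * (1 + green p 0))" using x by (simp add: m_ratio_def g0_def)
  have lam: "ln (1 + 1 / g0) = 1 / lam" by (simp add: lam_def)
  define W where "W = m_ratio x * lam * L'"
  have W: "W \<ge> 0" using m_ratio_pos[of x] lam_pos L by (simp add: W_def)
  define W2 where "W2 = m_ratio x * lam * L"
  have W2: "W2 \<ge> W" unfolding W_def W2_def using m_ratio_pos[of x] lam_pos L by (intro mult_left_mono) auto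
  have mk1: "(k - 1) * m_ratio x \<le> W" using k1 m_ratio_pos[of x] mult_right_mono[OF k1, of "m_ratio x"] by (simp add: W_def mult_ac)
  have mk2: "(1 - e / 4) * W2 \<le> (k - 1) * m_ratio x" using k2 m_ratio_pos[of x] mult_right_mono[OF k2, of "m_ratio x"] by (simp add: W2_def mult_ac)
  define B where "B = 16 * exp 1 * (k + 1)\<^sup>2 * exp (1 - (k - 1) / lam - \<tau> * e / 4 * W)"
  have upper: "prob {\<omega>\<in>space M. ereal k \<le> local_time j 0 \<omega> \<and> ereal ((1 + e) * W) \<le> local_time j x \<omega>} \<le> B"
  proof -
    have "prob {\<omega>\<in>space M. ereal k \<le> local_time j 0 \<omega> \<and> ereal ((1 + e) * W) \<le> local_time j x \<omega>}
      \<le> 16 * exp 1 * (k + 1)\<^sup>2 * exp (- (k - 1) * (1 / lam - m_ratio x * \<tau> / (1 - \<tau> * g0)) - (1 + e) * W * ln (1 + \<tau>))"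
      using local_time_pair_tail[OF w x, of \<tau> k j "(1 + e) * W"] \<tau> g0 k e
      by (simp add: g0_def[symmetric] mx[symmetric, folded g0_def] lam)
    also have "\<dots> \<le> B" unfolding B_def
    proof (intro mult_left_mono iffD2[OF exp_le_cancel_iff])
      define q where "q = 1 - \<tau> * g0"
      have q: "q > 0" "q \<le> 1" using \<tau>g0 e by (auto simp: q_def)
      have "(k - 1) * (m_ratio x * \<tau> / q) = (k - 1) * m_ratio x * (\<tau> / q)" by simp
      also have "\<dots> \<le> W * (\<tau> / q)" using mk1 q \<tau> by (intro mult_right_mono) auto
      finally have 1: "(k - 1) * (m_ratio x * \<tau> / q) \<le> W * (\<tau> / q)" .
      have "\<tau> / (1 + \<tau>) \<le> ln (1 + \<tau>)"
        using ln_le_minus_one[of "1 / (1 + \<tau>)"] \<tau> by (simp add: ln_div field_simps)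
      then have 2: "(1 + e) * W * (\<tau> / (1 + \<tau>)) \<le> (1 + e) * W * ln (1 + \<tau>)" using W e by (intro mult_left_mono) auto
      have 3: "\<tau> / q - (1 + e) * (\<tau> / (1 + \<tau>)) \<le> - (\<tau> * e / 4)"
      proof -
        have "\<tau> / q - (1 + e) * (\<tau> / (1 + \<tau>)) = \<tau> * ((1 + \<tau>) - (1 + e) * q) / (q * (1 + \<tau>))"
          using q \<tau> by (simp add: field_simps)
        also have "\<dots> \<le> \<tau> * (- (e / 2)) / (q * (1 + \<tau>))"
        proof (intro divide_right_mono mult_left_mono)
          have "e * (\<tau> * g0) \<le> 1 * (\<tau> * g0)" using e \<tau>g0 by (intro mult_right_mono) auto
          moreover have "1 + \<tau> - (1 + e) * q = \<tau> + \<tau> * g0 + e * (\<tau> * g0) - e" by (simp add: q_def algebra_simps)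
          moreover have "\<tau> + \<tau> * g0 = e / 4" using \<tau>(2) by (simp add: algebra_simps)
          ultimately show "1 + \<tau> - (1 + e) * q \<le> - (e / 2)" using \<tau>g0 by linarith
        qed (use q \<tau> in auto)
        also have "\<dots> \<le> \<tau> * (- (e / 2)) / 2"
        proof (rule divide_left_mono_neg)
          have "q * (1 + \<tau>) \<le> 1 * 2" using q \<tau> \<tau>g0 e by (intro mult_mono) auto
          then show "q * (1 + \<tau>) \<le> 2" by simp
        qed (use q \<tau> e in \<open>auto simp: mult_nonneg_nonpos\<close>)
        finally show ?thesis by simp
      qed
      have "W * (\<tau> / q - (1 + e) * (\<tau> / (1 + \<tau>))) \<le> W * (- (\<tau> * e / 4))" by (rule mult_left_mono[OF 3 W])
      with 1 2 show "- (k - 1) * (1 / lam - m_ratio x * \<tau> / (1 - \<tau> * g0)) - (1 + e) * W * ln (1 + \<tau>) \<le> 1 - (k - 1) / lam - \<tau> * e / 4 * W"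
        unfolding q_def[symmetric] by (simp add: algebra_simps diff_divide_distrib)
    qed auto
    finally show ?thesis .
  qed
  have lower: "prob {\<omega>\<in>space M. ereal k \<le> local_time j 0 \<omega> \<and> local_time j x \<omega> \<le> ereal ((1 - e) * W2)} \<le> B"
  proof -
    have "prob {\<omega>\<in>space M. ereal k \<le> local_time j 0 \<omega> \<and> local_time j x \<omega> \<le> ereal ((1 - e) * W2)}
      \<le> 16 * exp 1 * (k + 1)\<^sup>2 * exp (- (k - 1) * (1 / lam + m_ratio x * \<tau> / (1 + \<tau> * g0)) - ((1 - e) * W2 + 1) * ln (1 - \<tau>))"
      using local_time_pair_tail[OF w x, of "- \<tau>" k j "(1 - e) * W2"] \<tau> g0 k e
      by (simp add: g0_def[symmetric] mx[symmetric, folded g0_def] lam)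
    also have "\<dots> \<le> B" unfolding B_def
    proof (intro mult_left_mono iffD2[OF exp_le_cancel_iff])
      define q where "q = 1 + \<tau> * g0"
      have q: "q \<ge> 1" using \<tau>g0 by (simp add: q_def)
      have t1: "\<tau> \<le> 1 / 4" using \<tau>g0 e by simp
      define l where "l = - ln (1 - \<tau>)"
      have l: "l \<le> \<tau> / (1 - \<tau>)" "l \<ge> 0"
        using ln_le_minus_one[of "1 / (1 - \<tau>)"] \<tau> t1 ln_le_minus_one[of "1 - \<tau>"] by (auto simp: l_def ln_div field_simps)
      have "\<tau> / (1 - \<tau>) \<le> 1" using t1 \<tau> by (simp add: field_simps)
      then have l1: "l \<le> 1" using l by linarith
      have "(1 - e / 4) * W2 * (\<tau> / q) \<le> (k - 1) * m_ratio x * (\<tau> / q)" using mk2 q \<tau> by (intro mult_right_mono) auto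
      then have 1: "(1 - e / 4) * W2 * (\<tau> / q) \<le> (k - 1) * (m_ratio x * \<tau> / q)" by simp
      have "l \<le> \<tau> / (1 - e / 4)"
        using l(1) \<tau> \<tau>g0 e by (intro order_trans[OF l(1)] divide_left_mono mult_pos_pos) auto
      then have "(1 - e) * l \<le> (1 - e) * (\<tau> / (1 - e / 4))" using e by (intro mult_left_mono) auto
      also have "\<dots> = \<tau> * ((1 - e) / (1 - e / 4))" by simp
      also have "\<dots> \<le> \<tau> * (1 - 3 * e / 4)"
      proof (intro mult_left_mono)
        have "1 - e \<le> (1 - 3 * e / 4) * (1 - e / 4)" by (simp add: algebra_simps power2_eq_square)
        then show "(1 - e) / (1 - e / 4) \<le> 1 - 3 * e / 4" using e by (simp add: pos_divide_le_eq)
      qed (use \<tau> in auto)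
      finally have 2: "(1 - e) * l \<le> \<tau> * (1 - 3 * e / 4)" .
      have 3: "\<tau> * (1 - e / 2) \<le> (1 - e / 4) * (\<tau> / q)"
      proof -
        have "(1 - e / 4) * q \<le> (1 - e / 4) * (1 + e / 4)" using \<tau>g0 e by (intro mult_left_mono) (auto simp: q_def)
        also have "\<dots> \<le> 1" by (simp add: algebra_simps)
        finally have "1 - e / 4 \<le> 1 / q" using q by (simp add: field_simps)
        then have "(1 - e / 4) * (1 - e / 4) \<le> (1 - e / 4) * (1 / q)" using e by (intro mult_left_mono) auto
        moreover have "1 - e / 2 \<le> (1 - e / 4) * (1 - e / 4)" by (simp add: algebra_simps)
        ultimately have "\<tau> * (1 - e / 2) \<le> \<tau> * ((1 - e / 4) * (1 / q))" using \<tau> by (intro mult_left_mono) auto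
        then show ?thesis by (simp add: mult_ac)
      qed
      have "(1 - e) * l - (1 - e / 4) * (\<tau> / q) \<le> - (\<tau> * e / 4)" using 2 3 by (simp add: algebra_simps)
      then have "W2 * ((1 - e) * l - (1 - e / 4) * (\<tau> / q)) \<le> W2 * (- (\<tau> * e / 4))" using W W2 by (intro mult_left_mono) auto
      also have "\<dots> \<le> W * (- (\<tau> * e / 4))" using W2 \<tau> e by (intro mult_right_mono_neg) auto
      finally have 4: "(1 - e) * W2 * l - (1 - e / 4) * W2 * (\<tau> / q) \<le> - (\<tau> * e / 4 * W)" by (simp add: algebra_simps)
      have "- (k - 1) * (1 / lam + m_ratio x * \<tau> / q) - ((1 - e) * W2 + 1) * ln (1 - \<tau>)
          = - ((k - 1) / lam) - (k - 1) * (m_ratio x * \<tau> / q) + (1 - e) * W2 * l + l"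
        by (simp add: l_def algebra_simps diff_divide_distrib)
      then show "- (k - 1) * (1 / lam + m_ratio x * \<tau> / (1 + \<tau> * g0)) - ((1 - e) * W2 + 1) * ln (1 - \<tau>) \<le> 1 - (k - 1) / lam - \<tau> * e / 4 * W"
        unfolding q_def[symmetric] using 1 4 l1 by linarith
    qed auto
    finally show ?thesis .
  qed
  have "?E = {\<omega>\<in>space M. ereal k \<le> local_time j 0 \<omega> \<and> ereal ((1 + e) * W) \<le> local_time j x \<omega>} \<union>
            {\<omega>\<in>space M. ereal k \<le> local_time j 0 \<omega> \<and> local_time j x \<omega> \<le> ereal ((1 - e) * W2)}"
    by (auto simp: W_def W2_def mult.assoc)
  also have "prob \<dots> \<le> B + B"
  proof (rule order_trans[OF measure_Un_le add_mono[OF upper lower]])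
    show "{\<omega>\<in>space M. ereal k \<le> local_time j 0 \<omega> \<and> ereal ((1 + e) * W) \<le> local_time j x \<omega>} \<in> sets M" by measurable
    show "{\<omega>\<in>space M. ereal k \<le> local_time j 0 \<omega> \<and> local_time j x \<omega> \<le> ereal ((1 - e) * W2)} \<in> sets M" by measurable
  qed
  also have "B + B = 32 * exp 2 * (k + 1)\<^sup>2 * exp (- (k - 1) / lam - \<tau> * e / 4 * W)"
  proof -
    have "exp (2 :: real) = exp 1 * exp 1" by (simp add: exp_add[symmetric])
    moreover have "exp (1 - (k - 1) / lam - \<tau> * e / 4 * W) = exp 1 * exp (- (k - 1) / lam - \<tau> * e / 4 * W)"
      by (simp add: exp_add[symmetric] diff_divide_distrib)
    moreover have "16 * a * K * (a * b) + 16 * a * K * (a * b) = 32 * (a * a) * K * b" for a b K :: real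
      by (simp add: algebra_simps)
    ultimately show ?thesis unfolding B_def by (simp only:)
  qed
  finally show ?thesis by (simp only: W_def)
qed

text \<open>
  The case \<open>\<theta> = 0\<close> of the estimate for pairs, with an arbitrary second site.
\<close>

lemma local_time_tail:
  assumes k: "k \<ge> 1"
  shows "prob {\<omega>\<in>space M. ereal k \<le> local_time j 0 \<omega>} \<le> 16 * exp 1 * (k + 1)\<^sup>2 * exp (- (k - 1) / lam)"
proof -
  obtain x :: "int ^ 'd" where x: "x \<noteq> 0" by (metis axis_eq_0_iff zero_neq_one)
  have w: "symmetric_transient_walk p" by unfold_locales
  have "ereal 0 \<le> total_local_time s a" for s :: "nat \<Rightarrow> int ^ 'd" and a
    using local_count_le_total[of s 0 a] by (simp add: local_count_def)
  then have "{\<omega>\<in>space M. ereal k \<le> local_time j 0 \<omega>} =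
    {\<omega>\<in>space M. ereal k \<le> total_local_time (\<lambda>i. walk X i \<omega>) (walk X j \<omega>) \<and>
           (if (0 :: real) \<ge> 0 then ereal 0 \<le> total_local_time (\<lambda>i. walk X i \<omega>) (walk X j \<omega> + x)
            else total_local_time (\<lambda>i. walk X i \<omega>) (walk X j \<omega> + x) \<le> ereal 0)}" by simp
  also have "prob \<dots> \<le> 16 * exp 1 * (k + 1)\<^sup>2 * exp (- (k - 1) / lam)"
    using local_time_pair_tail[OF w x green_zero_pos _ k, of 0 j 0] by (simp add: lam_def g0_def)
  finally show ?thesis .
qed

end

section \<open>The Borel-Cantelli argument along powers of two\<close>

text \<open>
  The term \<open>\<kappa> l / R\<close> is split in half: one half absorbs \<open>\<delta> l\<close> because \<open>\<delta> R \<rightarrow> 0\<close>, the other half exceeds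
  \<open>A ln l\<close> because \<open>R ln l / l \<rightarrow> 0\<close>.
\<close>

lemma exp_decay:
  fixes R \<delta> l :: "nat \<Rightarrow> real" and \<kappa> :: real and A :: nat
  assumes R: "\<And>i. R i > 0" and l: "filterlim l at_top sequentially"
    and \<beta>: "(\<lambda>i. R i * (ln (l i) / l i)) \<longlonglongrightarrow> 0" and \<delta>: "(\<lambda>i. \<delta> i * R i) \<longlonglongrightarrow> 0"
    and \<kappa>: "\<kappa> > 0"
  shows "\<forall>\<^sub>F i in sequentially. exp (\<delta> i * l i - \<kappa> * l i / R i) \<le> 1 / l i ^ A"
proof -
  have "\<forall>\<^sub>F i in sequentially. R i * (ln (l i) / l i) < \<kappa> / (2 * real A + 1)"
    using \<beta> by (rule order_tendstoD) (use \<kappa> in auto)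
  moreover have "\<forall>\<^sub>F i in sequentially. \<delta> i * R i < \<kappa> / 2"
    using \<delta> by (rule order_tendstoD) (use \<kappa> in auto)
  moreover have "\<forall>\<^sub>F i in sequentially. l i \<ge> 1"
    using l by (auto simp: filterlim_at_top)
  ultimately show ?thesis
  proof eventually_elim
    case (elim i)
    have l0: "l i > 0" and lnl: "ln (l i) \<ge> 0" using elim(3) by auto
    have "ln (l i) / l i * (2 * A) \<le> ln (l i) / l i * (2 * A + 1)"
      using l0 lnl by (intro mult_left_mono) auto
    also have "\<dots> \<le> \<kappa> / R i" using elim(1) R[of i] by (simp add: field_simps)
    finally have "A * ln (l i) \<le> \<kappa> / 2 * l i / R i" using l0 R[of i] by (simp add: field_simps)
    moreover have "\<delta> i * l i \<le> \<kappa> / 2 * l i / R i"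
    proof -
      have "\<delta> i \<le> \<kappa> / 2 / R i" using elim(2) R[of i] by (simp add: field_simps)
      then have "\<delta> i * l i \<le> \<kappa> / 2 / R i * l i" using l0 by (intro mult_right_mono) auto
      then show ?thesis by simp
    qed
    moreover have "\<kappa> * l i / R i = \<kappa> / 2 * l i / R i + \<kappa> / 2 * l i / R i" by (simp add: field_simps)
    ultimately have "\<delta> i * l i - \<kappa> * l i / R i \<le> - (A * ln (l i))" by linarith
    then have "exp (\<delta> i * l i - \<kappa> * l i / R i) \<le> exp (- (A * ln (l i)))" by simp
    also have "\<dots> = 1 / l i ^ A" using l0 by (simp add: exp_minus exp_of_nat_mult field_simps)
    finally show ?case .
  qed
qed

lemma abs_ratio_minus_one_le:
  fixes t :: ereal
  assumes c: "c > 0" and "ereal ((1 - e) * c) \<le> t" "t \<le> ereal ((1 + e) * c)"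
  shows "\<bar>t / ereal c - 1\<bar> \<le> ereal e"
proof -
  obtain s where s: "t = ereal s" using assms by (cases t) auto
  have "(1 - e) * c \<le> s" "s \<le> (1 + e) * c" using assms by (auto simp: s)
  then have "\<bar>s / c - 1\<bar> \<le> e" using c by (auto simp: abs_le_iff field_simps)
  moreover have "\<bar>t / ereal c - 1\<bar> = ereal \<bar>s / c - 1\<bar>"
    using c by (simp add: s one_ereal_def)
  ultimately show ?thesis by simp
qed

locale heavy_point_setting = random_walk M X p
  for M :: "'a measure" and X :: "nat \<Rightarrow> 'a \<Rightarrow> int ^ 'd" and p :: "(int ^ 'd) pmf" +
  fixes r \<delta> :: "nat \<Rightarrow> real"
  assumes r_pos: "\<And>n. n \<ge> 1 \<Longrightarrow> r n > 0"
    and \<delta>_pos: "\<And>n. n \<ge> 1 \<Longrightarrow> \<delta> n > 0"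
    and \<delta>_decreasing: "\<And>m n. 1 \<le> m \<Longrightarrow> m \<le> n \<Longrightarrow> \<delta> n \<le> \<delta> m"
    and r_increasing: "\<And>m n. 1 \<le> m \<Longrightarrow> m \<le> n \<Longrightarrow> r m \<le> r n"
    and r_doubling: "\<exists>C>0. \<forall>n\<ge>1. r (2 * n) / r n < C"
    and \<beta>_lim: "(\<lambda>n. r n ^ (2 * CARD('d) - 4) * (ln (ln (real n)) / ln (real n))) \<longlonglongrightarrow> 0"
    and \<delta>_lim: "(\<lambda>n. \<delta> n * r n ^ (2 * CARD('d) - 4)) \<longlonglongrightarrow> 0"
begin

text \<open>
  Indices \<open>n\<close> between \<open>2 ^ i\<close> and \<open>2 ^ Suc i\<close> are treated together: \<open>log_scale i\<close> is \<open>ln (2 ^ i)\<close>, and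
  for large \<open>i\<close> all thresholds defining heavy points are at least \<open>threshold i\<close>, whereas the ball is taken
  with the largest radius that occurs.
\<close>

definition log_scale :: "nat \<Rightarrow> real" where "log_scale i = real i * ln 2"

definition threshold :: "nat \<Rightarrow> real" where "threshold i = (1 - \<delta> (2 ^ i)) * lam * log_scale i"

definition radius_pow :: "nat \<Rightarrow> real" where "radius_pow i = r (2 ^ Suc i) ^ (2 * CARD('d) - 4)"

definition punctured_ball :: "nat \<Rightarrow> (int ^ 'd) set" where
  "punctured_ball i = cov_ball covar (r (2 ^ Suc i)) - {0}"

definition too_heavy :: "real \<Rightarrow> nat \<Rightarrow> nat \<Rightarrow> 'a set" where
  "too_heavy e i j = {\<omega>\<in>space M. ereal ((1 + e) * lam * log_scale i) \<le> local_time j 0 \<omega>}"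

definition deviating :: "real \<Rightarrow> nat \<Rightarrow> nat \<Rightarrow> int ^ 'd \<Rightarrow> 'a set" where
  "deviating e i j x = {\<omega>\<in>space M. ereal (threshold i) \<le> local_time j 0 \<omega> \<and>
     (ereal ((1 + e) * m_ratio x * lam * log_scale i) \<le> local_time j x \<omega> \<or>
      local_time j x \<omega> \<le> ereal ((1 - e) * m_ratio x * lam * log_scale (Suc i)))}"

text \<open>
  Each bound in this event is the weakest one for indices between \<open>2 ^ i\<close> and \<open>2 ^ Suc i\<close>: upper deviations are
  measured on the smaller logarithmic scale, lower ones on the larger, so that outside of it
  all these indices satisfy the claimed estimate.  The site \<open>S\<^sub>j\<close> itself needs only the upper bound.
\<close>

definition bad :: "real \<Rightarrow> nat \<Rightarrow> 'a set" where
  "bad e i = (\<Union>j\<in>{..2 ^ Suc i}. too_heavy e i j \<union> (\<Union>x\<in>punctured_ball i. deviating e i j x))"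

definition too_heavy_bound :: "real \<Rightarrow> nat \<Rightarrow> real" where
  "too_heavy_bound e i = 16 * exp 1 * ((1 + e) * lam * log_scale i + 1)\<^sup>2 * exp (1 / lam - (1 + e) * log_scale i)"

definition deviating_bound :: "real \<Rightarrow> nat \<Rightarrow> real" where
  "deviating_bound \<kappa> i = 32 * exp 2 * (lam * log_scale i + 1)\<^sup>2
     * exp (1 / lam - log_scale i + (\<delta> (2 ^ i) * log_scale i - \<kappa> * log_scale i / radius_pow i))"

definition close_at :: "real \<Rightarrow> 'a \<Rightarrow> nat \<Rightarrow> bool" where
  "close_at e \<omega> n \<longleftrightarrow> (\<forall>j\<in>heavy_times (\<lambda>i. walk X i \<omega>) n ((1 - \<delta> n) * lam * ln (real n)).
     \<forall>x\<in>cov_ball covar (r n). \<bar>local_time j x \<omega> / ereal (m_ratio x * lam * ln (real n)) - 1\<bar> \<le> ereal e)"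

lemma ln_2_pow: "ln (real (2 ^ i)) = log_scale i"
  by (simp add: log_scale_def ln_realpow)

lemma log_scale_nonneg: "log_scale i \<ge> 0" and log_scale_mono: "log_scale i \<le> log_scale (Suc i)"
  by (auto simp: log_scale_def)

lemma log_scale_at_top: "filterlim log_scale at_top sequentially"
  unfolding log_scale_def by real_asymp

lemma pow2_at_top: "filterlim (\<lambda>i :: nat. 2 ^ i :: nat) at_top sequentially"
  by (rule filterlim_at_top_mono[OF filterlim_ident]) (auto intro: always_eventually less_imp_le[OF less_exp])

lemma radius_pow_pos: "radius_pow i > 0"
  unfolding radius_pow_def by (intro zero_less_power r_pos) simp

lemma \<delta>_pow2_lim: "(\<lambda>i. \<delta> (2 ^ i)) \<longlonglongrightarrow> 0"
proof (rule real_tendsto_sandwich[OF _ _ tendsto_const])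
  let ?D = "2 * CARD('d) - 4"
  have "(\<lambda>i. \<delta> (2 ^ i) * r (2 ^ i) ^ ?D) \<longlonglongrightarrow> 0" by (rule filterlim_compose[OF \<delta>_lim pow2_at_top])
  then have "(\<lambda>i. \<delta> (2 ^ i) * r (2 ^ i) ^ ?D / r 1 ^ ?D) \<longlonglongrightarrow> 0 / r 1 ^ ?D"
    by (rule tendsto_divide) (use r_pos[of 1] in auto)
  then show "(\<lambda>i. \<delta> (2 ^ i) * r (2 ^ i) ^ ?D / r 1 ^ ?D) \<longlonglongrightarrow> 0" by simp
  show "\<forall>\<^sub>F i in sequentially. \<delta> (2 ^ i) \<le> \<delta> (2 ^ i) * r (2 ^ i) ^ ?D / r 1 ^ ?D"
  proof (intro always_eventually allI)
    fix i
    have "r 1 ^ ?D \<le> r (2 ^ i) ^ ?D" using r_pos[of 1] r_increasing[of 1 "2 ^ i"] by (intro power_mono) auto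
    then have "\<delta> (2 ^ i) * r 1 ^ ?D \<le> \<delta> (2 ^ i) * r (2 ^ i) ^ ?D"
      using \<delta>_pos[of "2 ^ i"] by (intro mult_left_mono) auto
    then show "\<delta> (2 ^ i) \<le> \<delta> (2 ^ i) * r (2 ^ i) ^ ?D / r 1 ^ ?D" using r_pos[of 1] by (simp add: pos_le_divide_eq)
  qed
  show "\<forall>\<^sub>F i in sequentially. 0 \<le> \<delta> (2 ^ i)" using \<delta>_pos by (auto intro!: always_eventually less_imp_le)
qed

text \<open>
  Doubling the index multiplies the radius by a bounded factor only.
\<close>

lemma radius_pow_le: "\<exists>C>0. \<forall>i. radius_pow i \<le> C * r (2 ^ i) ^ (2 * CARD('d) - 4)"
proof -
  obtain C where C: "C > 0" "\<And>n. n \<ge> 1 \<Longrightarrow> r (2 * n) / r n < C" using r_doubling by blast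
  have "radius_pow i \<le> C ^ (2 * CARD('d) - 4) * r (2 ^ i) ^ (2 * CARD('d) - 4)" for i
  proof -
    have "r (2 * 2 ^ i) \<le> C * r (2 ^ i)" using C(2)[of "2 ^ i"] r_pos[of "2 ^ i"] by (simp add: pos_divide_less_eq)
    then have "r (2 ^ Suc i) ^ (2 * CARD('d) - 4) \<le> (C * r (2 ^ i)) ^ (2 * CARD('d) - 4)"
      using r_pos[of "2 * 2 ^ i"] by (intro power_mono) auto
    then show ?thesis by (simp add: radius_pow_def power_mult_distrib)
  qed
  then show ?thesis using C(1) by (intro exI[of _ "C ^ (2 * CARD('d) - 4)"]) auto
qed

lemma radius_pow_\<beta>_lim: "(\<lambda>i. radius_pow i * (ln (log_scale i) / log_scale i)) \<longlonglongrightarrow> 0"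
  and radius_pow_\<delta>_lim: "(\<lambda>i. \<delta> (2 ^ i) * radius_pow i) \<longlonglongrightarrow> 0"
proof -
  let ?D = "2 * CARD('d) - 4"
  obtain C where C: "C > 0" "\<And>i. radius_pow i \<le> C * r (2 ^ i) ^ ?D" using radius_pow_le by blast
  show "(\<lambda>i. radius_pow i * (ln (log_scale i) / log_scale i)) \<longlonglongrightarrow> 0"
  proof (rule real_tendsto_sandwich[OF _ _ tendsto_const])
    have "(\<lambda>i. r (2 ^ i) ^ ?D * (ln (ln (real (2 ^ i))) / ln (real (2 ^ i)))) \<longlonglongrightarrow> 0"
      by (rule filterlim_compose[OF \<beta>_lim pow2_at_top])
    then have "(\<lambda>i. r (2 ^ i) ^ ?D * (ln (log_scale i) / log_scale i)) \<longlonglongrightarrow> 0" by (simp only: ln_2_pow)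
    from tendsto_mult_right_zero[OF this, of C]
    show "(\<lambda>i. C * (r (2 ^ i) ^ ?D * (ln (log_scale i) / log_scale i))) \<longlonglongrightarrow> 0" .
    have ev: "\<forall>\<^sub>F i in sequentially. 1 \<le> log_scale i" using log_scale_at_top by (auto simp: filterlim_at_top)
    show "\<forall>\<^sub>F i in sequentially. radius_pow i * (ln (log_scale i) / log_scale i) \<le> C * (r (2 ^ i) ^ ?D * (ln (log_scale i) / log_scale i))"
      using ev
    proof eventually_elim
      case (elim i)
      have "radius_pow i * (ln (log_scale i) / log_scale i) \<le> (C * r (2 ^ i) ^ ?D) * (ln (log_scale i) / log_scale i)"
        using elim by (intro mult_right_mono C(2)) auto
      then show ?case by (simp only: mult.assoc)
    qed
    show "\<forall>\<^sub>F i in sequentially. 0 \<le> radius_pow i * (ln (log_scale i) / log_scale i)"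
      using ev
    proof eventually_elim
      case (elim i)
      then show ?case using less_imp_le[OF radius_pow_pos[of i]] by (intro mult_nonneg_nonneg divide_nonneg_nonneg) auto
    qed
  qed
  show "(\<lambda>i. \<delta> (2 ^ i) * radius_pow i) \<longlonglongrightarrow> 0"
  proof (rule real_tendsto_sandwich[OF _ _ tendsto_const])
    have "(\<lambda>i. \<delta> (2 ^ i) * r (2 ^ i) ^ ?D) \<longlonglongrightarrow> 0" by (rule filterlim_compose[OF \<delta>_lim pow2_at_top])
    from tendsto_mult_right_zero[OF this, of C]
    show "(\<lambda>i. C * (\<delta> (2 ^ i) * r (2 ^ i) ^ ?D)) \<longlonglongrightarrow> 0" .
    show "\<forall>\<^sub>F i in sequentially. \<delta> (2 ^ i) * radius_pow i \<le> C * (\<delta> (2 ^ i) * r (2 ^ i) ^ ?D)"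
    proof (intro always_eventually allI)
      fix i
      have "\<delta> (2 ^ i) * radius_pow i \<le> \<delta> (2 ^ i) * (C * r (2 ^ i) ^ ?D)"
        using \<delta>_pos[of "2 ^ i"] by (intro mult_left_mono C(2)) auto
      then show "\<delta> (2 ^ i) * radius_pow i \<le> C * (\<delta> (2 ^ i) * r (2 ^ i) ^ ?D)" by (simp only: mult_ac)
    qed
    show "\<forall>\<^sub>F i in sequentially. 0 \<le> \<delta> (2 ^ i) * radius_pow i"
      using \<delta>_pos radius_pow_pos by (intro always_eventually allI mult_nonneg_nonneg less_imp_le) auto
  qed
qed

lemma eventually_threshold:
  assumes e: "0 < e"
  shows "\<forall>\<^sub>F i in sequentially. threshold i \<ge> 1 \<and> (1 - e / 4) * (lam * log_scale (Suc i)) \<le> threshold i - 1"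
proof -
  have "\<forall>\<^sub>F i in sequentially. \<delta> (2 ^ i) < min (e / 8) (1 / 2)"
    using \<delta>_pow2_lim by (rule order_tendstoD) (use e in auto)
  moreover have "\<forall>\<^sub>F i in sequentially. 2 / lam + (1 + lam * ln 2) / (lam * e / 8) \<le> log_scale i"
    using log_scale_at_top by (auto simp: filterlim_at_top)
  ultimately show ?thesis
  proof eventually_elim
    case (elim i)
    have ls: "log_scale (Suc i) = log_scale i + ln 2" by (simp add: log_scale_def algebra_simps)
    have pos: "2 / lam > 0" "(1 + lam * ln 2) / (lam * e / 8) > 0" using lam_pos e by (auto intro!: divide_pos_pos add_pos_pos)
    have l2: "2 \<le> lam * log_scale i"
    proof -
      have "2 / lam \<le> log_scale i" using elim(2) pos by linarith
      then show ?thesis using lam_pos by (simp add: field_simps)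
    qed
    have le: "1 + lam * ln 2 \<le> e / 8 * (lam * log_scale i)"
    proof -
      have "(1 + lam * ln 2) / (lam * e / 8) \<le> log_scale i" using elim(2) pos by linarith
      then show ?thesis using lam_pos e by (simp add: pos_divide_le_eq mult_ac)
    qed
    have "1 / 2 * (lam * log_scale i) \<le> (1 - \<delta> (2 ^ i)) * (lam * log_scale i)" using elim(1) l2 by (intro mult_right_mono) auto
    then have "1 \<le> threshold i" using l2 by (simp add: threshold_def mult.assoc)
    have "(1 - e / 8) * (lam * log_scale i) \<le> (1 - \<delta> (2 ^ i)) * (lam * log_scale i)" using elim(1) l2 by (intro mult_right_mono) auto
    then have 1: "(1 - e / 8) * (lam * log_scale i) \<le> threshold i" by (simp add: threshold_def mult.assoc)
    have "(1 - e / 4) * (lam * log_scale (Suc i)) = (1 - e / 8) * (lam * log_scale i) - e / 8 * (lam * log_scale i) + (1 - e / 4) * (lam * ln 2)"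
      by (simp add: ls algebra_simps)
    also have "(1 - e / 4) * (lam * ln 2) \<le> 1 * (lam * ln 2)" using e lam_pos by (intro mult_right_mono) auto
    finally have "(1 - e / 4) * (lam * log_scale (Suc i)) \<le> threshold i - 1" using 1 le by linarith
    with \<open>1 \<le> threshold i\<close> show ?case by simp
  qed
qed

lemma m_ratio_lower: "\<exists>c>0. \<forall>i. \<forall>x\<in>punctured_ball i. c / radius_pow i \<le> m_ratio x"
proof -
  obtain c0 where c0: "c0 > 0" "\<And>x. x \<noteq> 0 \<Longrightarrow> c0 * (1 / norm (real_vec x)) ^ (CARD('d) - 2) \<le> green p x"
    using green_lower_bound by blast
  obtain K where K: "K > 0"
    and finK: "\<And>r. r \<ge> 0 \<Longrightarrow> finite (cov_ball covar r)"
    and cardK: "\<And>r. r \<ge> 0 \<Longrightarrow> real (card (cov_ball covar r)) \<le> (K * (1 + r)) ^ CARD('d)"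
    and normK: "\<And>r x. r \<ge> 0 \<Longrightarrow> x \<in> cov_ball covar r \<Longrightarrow> norm (real_vec x) \<le> K * r"
    by (rule cov_ball_bounds) blast
  let ?D = "2 * CARD('d) - 4"
  define c where "c = c0\<^sup>2 / K ^ ?D / (g0 * (1 + g0))"
  have D2: "?D = (CARD('d) - 2) * 2" by simp
  have "c / radius_pow i \<le> m_ratio x" if x: "x \<in> cov_ball covar (r (2 ^ Suc i))" "x \<noteq> 0" for i x
  proof -
    define \<rho> where "\<rho> = r (2 ^ Suc i)"
    have \<rho>: "\<rho> > 0" unfolding \<rho>_def by (rule r_pos) simp
    have n1: "1 \<le> norm (real_vec x)" by (rule norm_real_vec_ge_1[OF x(2)])
    have nx: "norm (real_vec x) \<le> K * \<rho>" using normK[of \<rho> x] \<rho> x by (simp add: \<rho>_def)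
    have "c0 * (1 / (K * \<rho>)) ^ (CARD('d) - 2) \<le> c0 * (1 / norm (real_vec x)) ^ (CARD('d) - 2)"
      using c0 n1 nx K \<rho> by (intro mult_left_mono power_mono divide_left_mono mult_pos_pos) auto
    also have "\<dots> \<le> green p x" by (rule c0(2)[OF x(2)])
    finally have "(c0 * (1 / (K * \<rho>)) ^ (CARD('d) - 2))\<^sup>2 \<le> (green p x)\<^sup>2"
      using c0 K \<rho> by (intro power_mono) auto
    moreover have "(c0 * (1 / (K * \<rho>)) ^ (CARD('d) - 2))\<^sup>2 = c0\<^sup>2 / K ^ ?D / radius_pow i"
      unfolding radius_pow_def \<rho>_def[symmetric] D2 by (simp add: power_mult_distrib power_divide flip: power_mult)
    ultimately have "c0\<^sup>2 / K ^ ?D / radius_pow i \<le> (green p x)\<^sup>2" by simp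
    then have "c0\<^sup>2 / K ^ ?D / radius_pow i / (g0 * (1 + g0)) \<le> (green p x)\<^sup>2 / (g0 * (1 + g0))"
      using g0_pos by (intro divide_right_mono) auto
    moreover have "c / radius_pow i = c0\<^sup>2 / K ^ ?D / radius_pow i / (g0 * (1 + g0))"
      unfolding c_def by (simp only: divide_divide_eq_left mult_ac)
    ultimately show ?thesis using x(2) by (simp only: m_ratio_def if_False)
  qed
  moreover have "c > 0" using c0 K g0_pos by (simp add: c_def)
  ultimately show ?thesis unfolding punctured_ball_def by (intro exI[of _ c]) simp
qed

lemma bad_sets: "bad e i \<in> sets M"
proof -
  obtain K where K: "K > 0"
    and finK: "\<And>r. r \<ge> 0 \<Longrightarrow> finite (cov_ball covar r)"
    and cardK: "\<And>r. r \<ge> 0 \<Longrightarrow> real (card (cov_ball covar r)) \<le> (K * (1 + r)) ^ CARD('d)"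
    and normK: "\<And>r x. r \<ge> 0 \<Longrightarrow> x \<in> cov_ball covar r \<Longrightarrow> norm (real_vec x) \<le> K * r"
    by (rule cov_ball_bounds) blast
  have "r (2 ^ Suc i) \<ge> 0" by (intro less_imp_le r_pos one_le_power) simp
  then have f: "finite (cov_ball covar (r (2 ^ Suc i)) - {0})" using finK by auto
  have "too_heavy e i j \<in> sets M" "deviating e i j x \<in> sets M" for j x
    unfolding too_heavy_def deviating_def by measurable
  then show ?thesis unfolding bad_def punctured_ball_def
    by (intro sets.finite_UN[OF finite_atMost] sets.Un sets.finite_UN[OF f])
qed

text \<open>
  The union bound over \<open>j\<close> and over the ball, with \<open>m\<^sub>x \<ge> c / radius_pow i\<close>.
\<close>

lemma prob_bad_le:
  assumes e: "0 < e" "e \<le> 1"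
  shows "\<exists>\<kappa>>0. \<exists>K>0. \<forall>\<^sub>F i in sequentially. prob (bad e i) \<le>
     3 * exp (log_scale i) * (too_heavy_bound e i + (K * (1 + r (2 ^ Suc i))) ^ CARD('d) * deviating_bound \<kappa> i)"
proof -
  obtain c where c: "c > 0" "\<And>i x. x \<in> punctured_ball i \<Longrightarrow> c / radius_pow i \<le> m_ratio x" using m_ratio_lower by blast
  obtain K where K: "K > 0"
    and finK: "\<And>r. r \<ge> 0 \<Longrightarrow> finite (cov_ball covar r)"
    and cardK: "\<And>r. r \<ge> 0 \<Longrightarrow> real (card (cov_ball covar r)) \<le> (K * (1 + r)) ^ CARD('d)"
    and normK: "\<And>r x. r \<ge> 0 \<Longrightarrow> x \<in> cov_ball covar r \<Longrightarrow> norm (real_vec x) \<le> K * r"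
    by (rule cov_ball_bounds) blast
  define \<tau> where "\<tau> = e / (4 * (1 + g0))"
  have \<tau>: "\<tau> > 0" using e g0_pos by (simp add: \<tau>_def)
  define \<kappa> where "\<kappa> = \<tau> * e / 4 * (c * lam)"
  have \<kappa>: "\<kappa> > 0" using \<tau> e c lam_pos by (simp add: \<kappa>_def)
  have "\<forall>\<^sub>F i in sequentially. 1 / lam \<le> log_scale i" using log_scale_at_top by (auto simp: filterlim_at_top)
  with eventually_threshold[OF e(1)]
  have "\<forall>\<^sub>F i in sequentially. prob (bad e i) \<le>
     3 * exp (log_scale i) * (too_heavy_bound e i + (K * (1 + r (2 ^ Suc i))) ^ CARD('d) * deviating_bound \<kappa> i)"
  proof eventually_elim
    case (elim i)
    let ?B = "punctured_ball i" and ?T1 = "too_heavy_bound e i" and ?T2 = "deviating_bound \<kappa> i"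
    let ?A1 = "too_heavy e i" and ?A2 = "deviating e i" and ?V = "(K * (1 + r (2 ^ Suc i))) ^ CARD('d)"
    have T: "?T1 \<ge> 0" "?T2 \<ge> 0" by (auto simp: too_heavy_bound_def deviating_bound_def)
    have r0: "r (2 ^ Suc i) \<ge> 0" by (intro less_imp_le r_pos one_le_power) simp
    have finB: "finite ?B" using finK[OF r0] by (simp add: punctured_ball_def)
    have "card ?B \<le> card (cov_ball covar (r (2 ^ Suc i)))" unfolding punctured_ball_def by (rule card_Diff1_le)
    then have cardB: "real (card ?B) \<le> ?V" using cardK[OF r0] by linarith
    have sets: "?A1 j \<in> sets M" "?A2 j x \<in> sets M" for j x unfolding too_heavy_def deviating_def by measurable
    have L1: "1 \<le> lam * log_scale i" using elim(2) lam_pos by (simp add: field_simps)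
    have p1: "prob (?A1 j) \<le> ?T1" for j
    proof -
      have ge: "1 \<le> (1 + e) * lam * log_scale i"
      proof -
        have "1 * (lam * log_scale i) \<le> (1 + e) * (lam * log_scale i)" using e L1 by (intro mult_right_mono) auto
        then show ?thesis using L1 by (simp add: mult.assoc)
      qed
      have "- ((1 + e) * lam * log_scale i - 1) / lam = 1 / lam - (1 + e) * log_scale i"
        using lam_pos by (simp add: field_simps)
      then show ?thesis using local_time_tail[OF ge, of j] unfolding too_heavy_def too_heavy_bound_def by simp
    qed
    have p2: "prob (?A2 j x) \<le> ?T2" if x: "x \<in> ?B" for j x
    proof -
      have x0: "x \<noteq> 0" using x by (simp add: punctured_ball_def)
      have kl: "threshold i \<le> lam * log_scale i"
        using \<delta>_pos[of "2 ^ i"] L1 mult_right_mono[of "1 - \<delta> (2 ^ i)" 1 "lam * log_scale i"] by (simp add: threshold_def mult.assoc)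
      have "prob (?A2 j x) \<le> 32 * exp 2 * (threshold i + 1)\<^sup>2 * exp (- (threshold i - 1) / lam - \<tau> * e / 4 * (m_ratio x * lam * log_scale i))"
        unfolding deviating_def \<tau>_def
        by (rule local_time_deviation[OF x0 _ e log_scale_nonneg log_scale_mono]) (use elim(1) kl in auto)
      also have "\<dots> \<le> ?T2" unfolding deviating_bound_def
      proof (intro mult_mono mult_left_mono power_mono iffD2[OF exp_le_cancel_iff])
        have "- (threshold i - 1) / lam = 1 / lam - log_scale i + \<delta> (2 ^ i) * log_scale i"
          using lam_pos by (simp add: threshold_def field_simps)
        moreover have "\<kappa> * log_scale i / radius_pow i \<le> \<tau> * e / 4 * (m_ratio x * lam * log_scale i)"
        proof -
          have "\<kappa> * log_scale i / radius_pow i = \<tau> * e / 4 * ((c / radius_pow i) * (lam * log_scale i))" by (simp add: \<kappa>_def)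
          also have "\<dots> \<le> \<tau> * e / 4 * (m_ratio x * (lam * log_scale i))"
            using c(2)[of x i] x \<tau> e L1 by (intro mult_left_mono mult_right_mono) (auto simp: punctured_ball_def)
          finally show ?thesis by (simp only: mult.assoc)
        qed
        ultimately show "- (threshold i - 1) / lam - \<tau> * e / 4 * (m_ratio x * lam * log_scale i) \<le> 1 / lam - log_scale i + (\<delta> (2 ^ i) * log_scale i - \<kappa> * log_scale i / radius_pow i)"
          by linarith
      qed (use kl elim(1) in auto)
      finally show ?thesis .
    qed
    have pj: "prob (?A1 j \<union> (\<Union>x\<in>?B. ?A2 j x)) \<le> ?T1 + ?V * ?T2" for j
    proof -
      have "prob (\<Union>x\<in>?B. ?A2 j x) \<le> (\<Sum>x\<in>?B. prob (?A2 j x))"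
        by (rule finite_measure_subadditive_finite[OF finB]) (use sets in auto)
      also have "\<dots> \<le> (\<Sum>x\<in>?B. ?T2)" by (intro sum_mono p2)
      also have "\<dots> = real (card ?B) * ?T2" by simp
      also have "\<dots> \<le> ?V * ?T2" by (rule mult_right_mono[OF cardB T(2)])
      finally have "prob (\<Union>x\<in>?B. ?A2 j x) \<le> ?V * ?T2" .
      moreover have "prob (?A1 j \<union> (\<Union>x\<in>?B. ?A2 j x)) \<le> prob (?A1 j) + prob (\<Union>x\<in>?B. ?A2 j x)"
        by (intro measure_Un_le sets sets.finite_UN finB)
      ultimately show ?thesis using p1[of j] by linarith
    qed
    have "bad e i = (\<Union>j\<in>{..2 ^ Suc i}. ?A1 j \<union> (\<Union>x\<in>?B. ?A2 j x))"
      unfolding bad_def ..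
    then have "prob (bad e i) \<le> (\<Sum>j\<in>{..2 ^ Suc i}. prob (?A1 j \<union> (\<Union>x\<in>?B. ?A2 j x)))"
      by (simp only:) (rule finite_measure_subadditive_finite, auto intro!: sets sets.finite_UN finB)
    also have "\<dots> \<le> (\<Sum>j\<in>{..2 ^ Suc i :: nat}. ?T1 + ?V * ?T2)" by (intro sum_mono pj)
    also have "\<dots> = (2 ^ Suc i + 1) * (?T1 + ?V * ?T2)" by simp
    also have "\<dots> \<le> (3 * exp (log_scale i)) * (?T1 + ?V * ?T2)"
    proof (rule mult_right_mono)
      have "exp (log_scale i) = 2 ^ i" unfolding ln_2_pow[symmetric] by simp
      moreover have "(1 :: real) \<le> 2 ^ i" by simp
      ultimately show "2 ^ Suc i + 1 \<le> 3 * exp (log_scale i)" by simp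
      show "0 \<le> ?T1 + ?V * ?T2" using T K r0 by simp
    qed
    finally show ?case .
  qed
  with \<kappa> K show ?thesis by blast
qed

text \<open>
  The ball and the prefactor contribute at most \<open>(log_scale i) ^ (d + 2)\<close>, so \<open>exp_decay\<close> with exponent \<open>d + 4\<close>
  leaves \<open>1 / (log_scale i)\<^sup>2\<close>, which is summable because \<open>log_scale i\<close> is linear in \<open>i\<close>.
\<close>

lemma summable_bad:
  assumes e: "0 < e" "e \<le> 1"
  shows "summable (\<lambda>i. prob (bad e i))"
proof -
  obtain \<kappa> K where \<kappa>: "\<kappa> > 0" and K: "K > 0" and ev: "\<forall>\<^sub>F i in sequentially. prob (bad e i) \<le>
     3 * exp (log_scale i) * (too_heavy_bound e i + (K * (1 + r (2 ^ Suc i))) ^ CARD('d) * deviating_bound \<kappa> i)"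
    using prob_bad_le[OF e] by blast
  define d where "d = CARD('d)"
  define C1 where "C1 = 48 * exp 1 * exp (1 / lam)"
  define C2 where "C2 = 96 * exp 2 * exp (1 / lam) * (3 * K) ^ d * (lam + 1)\<^sup>2"
  have dec: "\<forall>\<^sub>F i in sequentially. exp (\<delta> (2 ^ i) * log_scale i - \<kappa> * log_scale i / radius_pow i) \<le> 1 / log_scale i ^ (d + 4)"
    by (rule exp_decay[OF radius_pow_pos log_scale_at_top radius_pow_\<beta>_lim radius_pow_\<delta>_lim \<kappa>])
  have "((\<lambda>x. ((1 + e) * lam * x + 1)\<^sup>2 * exp (- e * x) * x\<^sup>2) \<longlongrightarrow> 0) at_top"
    using e lam_pos by real_asymp
  then have "(\<lambda>i. ((1 + e) * lam * log_scale i + 1)\<^sup>2 * exp (- e * log_scale i) * (log_scale i)\<^sup>2) \<longlonglongrightarrow> 0"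
    by (rule filterlim_compose[OF _ log_scale_at_top])
  then have dec1: "\<forall>\<^sub>F i in sequentially. ((1 + e) * lam * log_scale i + 1)\<^sup>2 * exp (- e * log_scale i) * (log_scale i)\<^sup>2 < 1"
    by (rule order_tendstoD) simp
  have R1: "\<forall>\<^sub>F i in sequentially. radius_pow i * (ln (log_scale i) / log_scale i) < 1"
    using radius_pow_\<beta>_lim by (rule order_tendstoD) simp
  have l3: "\<forall>\<^sub>F i in sequentially. exp 1 \<le> log_scale i" using log_scale_at_top by (auto simp: filterlim_at_top)
  have main: "\<forall>\<^sub>F i in sequentially. norm (prob (bad e i)) \<le> (C1 + C2) / (ln 2)\<^sup>2 * (1 / real i ^ 2)"
    using ev dec dec1 R1 l3
  proof eventually_elim
    case (elim i)
    have l1: "log_scale i \<ge> 1" using elim(5) exp_ge_add_one_self[of "1 :: real"] by linarith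
    define r' where "r' = r (2 ^ Suc i)"
    have r0: "r' > 0" unfolding r'_def by (rule r_pos) simp
    have "1 \<le> ln (log_scale i)" using elim(5) l1 by (simp add: ln_ge_iff)
    then have "radius_pow i * (1 / log_scale i) \<le> radius_pow i * (ln (log_scale i) / log_scale i)"
      using radius_pow_pos[of i] l1 by (intro mult_left_mono divide_right_mono) auto
    with elim(4) have "radius_pow i * (1 / log_scale i) \<le> 1" by linarith
    then have Rl: "radius_pow i \<le> log_scale i" using l1 by (simp add: field_simps)
    have "r' \<le> 1 + radius_pow i"
    proof (cases "r' \<le> 1")
      case True
      then show ?thesis using radius_pow_pos[of i] by linarith
    next
      case False
      then have "r' ^ 1 \<le> r' ^ (2 * CARD('d) - 4)" using dim by (intro power_increasing) auto
      then show ?thesis by (simp add: radius_pow_def r'_def)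
    qed
    then have "1 + r' \<le> 3 * log_scale i" using Rl l1 by linarith
    then have "(K * (1 + r')) ^ d \<le> (K * (3 * log_scale i)) ^ d" using K r0 by (intro power_mono mult_left_mono) auto
    then have b1: "(K * (1 + r')) ^ d \<le> (3 * K) ^ d * log_scale i ^ d" by (simp add: power_mult_distrib mult_ac)
    have "lam * log_scale i + 1 \<le> (lam + 1) * log_scale i" using l1 by (simp add: algebra_simps)
    then have "(lam * log_scale i + 1)\<^sup>2 \<le> ((lam + 1) * log_scale i)\<^sup>2" using lam_pos l1 by (intro power_mono) auto
    then have b2: "(lam * log_scale i + 1)\<^sup>2 \<le> (lam + 1)\<^sup>2 * (log_scale i)\<^sup>2" by (simp add: power_mult_distrib)
    have s1: "3 * exp (log_scale i) * (16 * exp 1 * ((1 + e) * lam * log_scale i + 1)\<^sup>2 * exp (1 / lam - (1 + e) * log_scale i)) \<le> C1 / (log_scale i)\<^sup>2"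
    proof -
      have "exp (log_scale i) * exp (1 / lam - (1 + e) * log_scale i) = exp (1 / lam) * exp (- e * log_scale i)"
        by (simp add: exp_add[symmetric] algebra_simps)
      then have "3 * exp (log_scale i) * (16 * exp 1 * ((1 + e) * lam * log_scale i + 1)\<^sup>2 * exp (1 / lam - (1 + e) * log_scale i))
         = C1 * (((1 + e) * lam * log_scale i + 1)\<^sup>2 * exp (- e * log_scale i))"
        by (simp add: C1_def mult_ac)
      also have "\<dots> \<le> C1 * (1 / (log_scale i)\<^sup>2)"
        using elim(3) l1 by (intro mult_left_mono) (auto simp: C1_def pos_le_divide_eq)
      finally show ?thesis by simp
    qed
    have s2: "3 * exp (log_scale i) * ((K * (1 + r')) ^ d * (32 * exp 2 * (lam * log_scale i + 1)\<^sup>2 * exp (1 / lam - log_scale i + (\<delta> (2 ^ i) * log_scale i - \<kappa> * log_scale i / radius_pow i)))) \<le> C2 / (log_scale i)\<^sup>2"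
    proof -
      define E where "E = exp (\<delta> (2 ^ i) * log_scale i - \<kappa> * log_scale i / radius_pow i)"
      have "exp (log_scale i) * exp (1 / lam - log_scale i + (\<delta> (2 ^ i) * log_scale i - \<kappa> * log_scale i / radius_pow i)) = exp (1 / lam) * E"
        by (simp add: E_def exp_add[symmetric] algebra_simps)
      then have "3 * exp (log_scale i) * ((K * (1 + r')) ^ d * (32 * exp 2 * (lam * log_scale i + 1)\<^sup>2 * exp (1 / lam - log_scale i + (\<delta> (2 ^ i) * log_scale i - \<kappa> * log_scale i / radius_pow i))))
        = 96 * exp 2 * exp (1 / lam) * ((K * (1 + r')) ^ d * ((lam * log_scale i + 1)\<^sup>2 * E))"
        by (simp add: mult_ac)
      also have "\<dots> \<le> 96 * exp 2 * exp (1 / lam) * (((3 * K) ^ d * log_scale i ^ d) * (((lam + 1)\<^sup>2 * (log_scale i)\<^sup>2) * (1 / log_scale i ^ (d + 4))))"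
        using b1 b2 elim(2) K r0 l1 by (intro mult_left_mono mult_mono) (auto simp: E_def)
      also have "\<dots> = C2 * (log_scale i ^ d * (log_scale i)\<^sup>2 * (1 / log_scale i ^ (d + 4)))"
        by (simp add: C2_def mult_ac)
      also have "log_scale i ^ d * (log_scale i)\<^sup>2 * (1 / log_scale i ^ (d + 4)) = 1 / (log_scale i)\<^sup>2"
        using l1 by (simp add: power_add power2_eq_square power4_eq_xxxx)
      finally show ?thesis by simp
    qed
    have "prob (bad e i) \<le> C1 / (log_scale i)\<^sup>2 + C2 / (log_scale i)\<^sup>2"
      using elim(1) s1 s2 by (simp add: distrib_left r'_def d_def too_heavy_bound_def deviating_bound_def)
    also have "\<dots> = (C1 + C2) / (ln 2)\<^sup>2 * (1 / real i ^ 2)"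
      by (simp add: log_scale_def power_mult_distrib add_divide_distrib mult_ac)
    finally show ?case by simp
  qed
  show ?thesis
    by (rule summable_comparison_test_ev[OF main]) (intro summable_mult, simp add: inverse_power_summable flip: inverse_eq_divide)
qed

lemma deviation_eventually_le:
  assumes e: "0 < e" "e \<le> 1"
  shows "AE \<omega> in M. \<forall>\<^sub>F n in sequentially. close_at e \<omega> n"
proof -
  have "AE \<omega> in M. \<forall>\<^sub>F i in sequentially. \<omega> \<in> space M - bad e i"
    by (rule borel_cantelli_AE1[OF bad_sets _ summable_bad[OF e]]) (simp add: emeasure_eq_measure)
  then show ?thesis
  proof (rule AE_mp, intro AE_I2 impI)
    fix \<omega> assume \<omega>: "\<omega> \<in> space M" and ev: "\<forall>\<^sub>F i in sequentially. \<omega> \<in> space M - bad e i"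
    have "\<forall>\<^sub>F i in sequentially. \<delta> (2 ^ i) < e" using \<delta>_pow2_lim by (rule order_tendstoD) (rule e(1))
    with ev eventually_threshold[OF e(1)]
    have "\<forall>\<^sub>F i in sequentially. \<omega> \<notin> bad e i \<and> threshold i \<ge> 1 \<and> \<delta> (2 ^ i) < e"
      by eventually_elim auto
    then obtain i0 where i0: "\<And>i. i \<ge> i0 \<Longrightarrow> \<omega> \<notin> bad e i" "\<And>i. i \<ge> i0 \<Longrightarrow> threshold i \<ge> 1" "\<And>i. i \<ge> i0 \<Longrightarrow> \<delta> (2 ^ i) < e"
      by (auto simp: eventually_sequentially)
    show "\<forall>\<^sub>F n in sequentially. close_at e \<omega> n"
      unfolding close_at_def
    proof (rule eventually_sequentiallyI[of "2 ^ (i0 + 1)"], intro ballI)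
      fix n j x assume n: "2 ^ (i0 + 1) \<le> n" and j: "j \<in> heavy_times (\<lambda>i. walk X i \<omega>) n ((1 - \<delta> n) * lam * ln (real n))"
        and x: "x \<in> cov_ball covar (r n)"
      have "(2 :: nat) ^ 1 \<le> 2 ^ (i0 + 1)" by (rule power_increasing) auto
      then have "(2 :: nat) ^ 1 \<le> n" using n by (rule order_trans)
      then have n2: "2 \<le> n" by simp
      obtain i where i: "2 ^ i \<le> n" "n < 2 ^ Suc i"
        using ex_power_ivl1[of 2 n] n2 by auto
      have ii: "i \<ge> i0"
      proof -
        have "(2 :: nat) ^ (i0 + 1) < 2 ^ Suc i" using n i(2) by (rule le_less_trans)
        then show ?thesis by simp
      qed
      define Ln where "Ln = ln (real n)"
      have ln1: "log_scale i \<le> Ln" unfolding Ln_def ln_2_pow[symmetric] using i n2 by (intro ln_mono) (simp_all flip: of_nat_power)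
      have ln2: "Ln \<le> log_scale (Suc i)" unfolding Ln_def ln_2_pow[symmetric] using i n2 by (intro ln_mono) (simp_all flip: of_nat_power)
      have k1: "threshold i \<ge> 1" and \<delta>e: "\<delta> (2 ^ i) < e" and nb: "\<omega> \<notin> bad e i" using i0 ii by auto
      have li: "log_scale i > 0" using k1 log_scale_nonneg[of i] by (cases "log_scale i = 0") (auto simp: threshold_def)
      have Ln: "Ln > 0" using li ln1 by linarith
      have d1: "1 - \<delta> (2 ^ i) > 0"
      proof (rule ccontr)
        assume "\<not> ?thesis"
        then have "(1 - \<delta> (2 ^ i)) * (lam * log_scale i) \<le> 0" using lam_pos li by (intro mult_nonpos_nonneg) auto
        then show False using k1 by (simp add: threshold_def mult.assoc)
      qed
      have dn: "\<delta> n \<le> \<delta> (2 ^ i)" using i by (intro \<delta>_decreasing) auto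
      have jn: "j \<le> 2 ^ Suc i" and heavy: "ereal ((1 - \<delta> n) * lam * Ln) \<le> local_time j 0 \<omega>"
        using j i by (auto simp: heavy_times_def Ln_def)
      have "(1 - \<delta> (2 ^ i)) * (lam * log_scale i) \<le> (1 - \<delta> n) * (lam * Ln)"
        using d1 dn ln1 lam_pos li by (intro mult_mono) auto
      then have "threshold i \<le> (1 - \<delta> n) * lam * Ln" by (simp add: threshold_def mult.assoc)
      then have hk: "ereal (threshold i) \<le> local_time j 0 \<omega>" using heavy order_trans ereal_less_eq(3) by blast
      show "\<bar>local_time j x \<omega> / ereal (m_ratio x * lam * ln (real n)) - 1\<bar> \<le> ereal e"
      proof (rule abs_ratio_minus_one_le)
        show "m_ratio x * lam * ln (real n) > 0" using m_ratio_pos[of x] lam_pos Ln by (simp add: Ln_def)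
        have ml: "m_ratio x * lam > 0" using m_ratio_pos[of x] lam_pos by simp
        have up: "(1 + e) * m_ratio x * lam * log_scale i \<le> (1 + e) * (m_ratio x * lam * Ln)"
        proof -
          have "(1 + e) * (m_ratio x * lam) * log_scale i \<le> (1 + e) * (m_ratio x * lam) * Ln" using e ml ln1 by (intro mult_left_mono) auto
          then show ?thesis by (simp add: mult.assoc)
        qed
        show "local_time j x \<omega> \<le> ereal ((1 + e) * (m_ratio x * lam * ln (real n)))"
        proof (cases "x = 0")
          case True
          have "\<not> ereal ((1 + e) * lam * log_scale i) \<le> local_time j 0 \<omega>"
            using nb jn \<omega> unfolding bad_def too_heavy_def by blast
          then have "local_time j x \<omega> \<le> ereal ((1 + e) * m_ratio x * lam * log_scale i)" using True by (simp add: m_ratio_def not_le less_imp_le)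
          then show ?thesis using up unfolding Ln_def by (meson ereal_less_eq(3) order_trans)
        next
          case False
          have xb: "x \<in> punctured_ball i"
            using x False r_increasing[of n "2 ^ Suc i"] i n2 by (auto simp: cov_ball_def punctured_ball_def)
          have "\<not> ereal ((1 + e) * m_ratio x * lam * log_scale i) \<le> local_time j x \<omega>"
            using nb jn \<omega> xb hk unfolding bad_def deviating_def by blast
          then have "local_time j x \<omega> \<le> ereal ((1 + e) * m_ratio x * lam * log_scale i)" by (simp add: not_le less_imp_le)
          then show ?thesis using up unfolding Ln_def by (meson ereal_less_eq(3) order_trans)
        qed
        show "ereal ((1 - e) * (m_ratio x * lam * ln (real n))) \<le> local_time j x \<omega>"
        proof (cases "x = 0")
          case True
          have "(1 - e) * (lam * Ln) \<le> (1 - \<delta> n) * (lam * Ln)" using dn \<delta>e lam_pos Ln by (intro mult_right_mono) auto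
          then have "ereal ((1 - e) * (m_ratio x * lam * Ln)) \<le> ereal ((1 - \<delta> n) * lam * Ln)" using True by (simp add: m_ratio_def mult.assoc)
          also note heavy
          finally show ?thesis using True by (simp add: Ln_def)
        next
          case False
          have xb: "x \<in> punctured_ball i"
            using x False r_increasing[of n "2 ^ Suc i"] i n2 by (auto simp: cov_ball_def punctured_ball_def)
          have "\<not> local_time j x \<omega> \<le> ereal ((1 - e) * m_ratio x * lam * log_scale (Suc i))"
            using nb jn \<omega> xb hk unfolding bad_def deviating_def by blast
          then have lt: "ereal ((1 - e) * m_ratio x * lam * log_scale (Suc i)) \<le> local_time j x \<omega>" by (simp add: not_le less_imp_le)
          have "(1 - e) * (m_ratio x * lam) * Ln \<le> (1 - e) * (m_ratio x * lam) * log_scale (Suc i)" using e ml ln2 by (intro mult_left_mono) auto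
          then have "(1 - e) * (m_ratio x * lam * Ln) \<le> (1 - e) * m_ratio x * lam * log_scale (Suc i)" by (simp add: mult.assoc)
          then show ?thesis using lt unfolding Ln_def by (meson ereal_less_eq(3) order_trans)
        qed
      qed
    qed
  qed
qed

lemma deviation_limit:
  "AE \<omega> in M. (\<lambda>n. sup0 (heavy_times (\<lambda>i. walk X i \<omega>) n ((1 - \<delta> n) * lam * ln (real n)))
      (\<lambda>j. SUP x\<in>cov_ball covar (r n). \<bar>local_time j x \<omega> / ereal (m_ratio x * lam * ln (real n)) - 1\<bar>)) \<longlonglongrightarrow> 0"
proof -
  have "AE \<omega> in M. \<forall>q. \<forall>\<^sub>F n in sequentially. close_at (1 / Suc q) \<omega> n"
    unfolding AE_all_countable by (intro allI deviation_eventually_le) auto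
  then show ?thesis
  proof (rule AE_mp, intro AE_I2 impI)
    fix \<omega> assume *: "\<forall>q. \<forall>\<^sub>F n in sequentially. close_at (1 / Suc q) \<omega> n"
    let ?H = "\<lambda>n. heavy_times (\<lambda>i. walk X i \<omega>) n ((1 - \<delta> n) * lam * ln (real n))"
    let ?f = "\<lambda>n j. SUP x\<in>cov_ball covar (r n). \<bar>local_time j x \<omega> / ereal (m_ratio x * lam * ln (real n)) - 1\<bar>"
    have nonneg: "0 \<le> sup0 (?H n) (?f n)" if n: "n \<ge> 1" for n
    proof (cases "?H n = {}")
      case False
      then obtain j where j: "j \<in> ?H n" by blast
      have "0 \<in> cov_ball covar (r n)" using r_pos[OF n] by (simp add: cov_ball_def cov_norm_def real_vec_0)
      then have "\<bar>local_time j 0 \<omega> / ereal (m_ratio 0 * lam * ln (real n)) - 1\<bar> \<le> ?f n j" by (rule SUP_upper)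
      then have "0 \<le> ?f n j" by (rule order_trans[rotated]) simp
      also have "\<dots> \<le> (SUP j\<in>?H n. ?f n j)" using j by (rule SUP_upper)
      finally show ?thesis using False by (simp add: sup0_def)
    qed (simp add: sup0_def)
    show "(\<lambda>n. sup0 (?H n) (?f n)) \<longlonglongrightarrow> 0"
    proof (rule order_tendstoI)
      fix a :: ereal assume a: "a < 0"
      show "\<forall>\<^sub>F n in sequentially. a < sup0 (?H n) (?f n)"
        by (rule eventually_sequentiallyI[of 1]) (use a nonneg less_le_trans in blast)
    next
      fix a :: ereal assume a: "0 < a"
      obtain b where b: "0 < b" "ereal b < a"
        using a by (metis ereal_dense2 ereal_less(2) )
      obtain q where q: "1 / real (Suc q) < b" using b(1) by (metis nat_approx_posE)
      show "\<forall>\<^sub>F n in sequentially. sup0 (?H n) (?f n) < a"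
        using *[rule_format, of q]
      proof eventually_elim
        case (elim n)
        have "sup0 (?H n) (?f n) \<le> ereal (1 / Suc q)"
          using elim by (auto simp: sup0_def close_at_def intro!: SUP_least)
        also have "\<dots> < a" using q b(2) by (meson ereal_less_eq(3) le_less_trans less_imp_le)
        finally show ?case .
      qed
    qed
  qed
qed

end

section \<open>The hypotheses on the step distribution\<close>

lemma map_pmf_uminus_if_symmetric_step:
  assumes "symmetric_step p"
  shows "map_pmf uminus p = p"
proof (rule pmf_eqI)
  fix x
  have "pmf (map_pmf uminus p) (- (- x)) = pmf p (- x)" by (rule pmf_map_inj') (simp add: inj_def)
  then show "pmf (map_pmf uminus p) x = pmf p x" using assms by (simp add: symmetric_step_def)
qed

lemma integrable_pmf_if_summable_on:
  fixes f :: "'v \<Rightarrow> real"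
  assumes "(\<lambda>x. f x * pmf p x) summable_on UNIV" "\<And>x. f x \<ge> 0"
  shows "integrable (measure_pmf p) f"
proof -
  have "(\<lambda>x. norm (pmf p x * f x)) summable_on UNIV" using assms by (simp add: mult.commute)
  then have "Infinite_Set_Sum.abs_summable_on (\<lambda>x. pmf p x * f x) UNIV"
    by (rule abs_summable_equivalent[THEN iffD1])
  then have "integrable (count_space UNIV) (\<lambda>x. pmf p x *\<^sub>R f x)" by (simp add: abs_summable_on_def)
  then show ?thesis unfolding measure_pmf_eq_density by (subst integrable_density) auto
qed

text \<open>
  In each dimension the required moment dominates the second one up to a constant, since nonzero lattice points have norm
  at least \<open>1\<close>.
\<close>

lemma second_moment_if_moment_condition:
  fixes p :: "(int ^ 'd) pmf"
  assumes mc: "moment_condition p" and d: "CARD('d) \<ge> 3"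
  shows "integrable p (\<lambda>v. (norm (real_vec v))\<^sup>2)"
proof (rule integrable_pmf_if_summable_on)
  let ?n = "\<lambda>v :: int ^ 'd. norm (real_vec v)"
  have n: "?n v = 0 \<or> 1 \<le> ?n v" for v
    using norm_real_vec_ge_1[of v] by (cases "v = 0") (auto simp: real_vec_0)
  consider "CARD('d) = 3" | "CARD('d) = 4" | "CARD('d) \<ge> 5" using d by linarith
  then show "(\<lambda>v. (?n v)\<^sup>2 * pmf p v) summable_on UNIV"
  proof cases
    case 1
    then show ?thesis using mc by (simp add: moment_condition_def)
  next
    case 2
    then have s: "(\<lambda>v. 1 / ln 2 * (?n v ^ 2 * ln (?n v + 1) * pmf p v)) summable_on UNIV"
      using mc by (intro summable_on_cmult_right) (simp add: moment_condition_def)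
    show ?thesis
    proof (rule summable_on_comparison_test[OF s])
      fix v
      have "(?n v)\<^sup>2 * ln 2 \<le> (?n v)\<^sup>2 * ln (?n v + 1)"
        using n[of v]
      proof
        assume "1 \<le> ?n v"
        then show ?thesis by (intro mult_left_mono ln_mono) auto
      qed simp
      then have "(?n v)\<^sup>2 \<le> 1 / ln 2 * ((?n v)\<^sup>2 * ln (?n v + 1))" by (simp add: field_simps)
      then have "(?n v)\<^sup>2 * pmf p v \<le> 1 / ln 2 * ((?n v)\<^sup>2 * ln (?n v + 1)) * pmf p v" by (rule mult_right_mono) simp
      then show "(?n v)\<^sup>2 * pmf p v \<le> 1 / ln 2 * (?n v ^ 2 * ln (?n v + 1) * pmf p v)" by (simp only: mult.assoc)
    qed auto
  next
    case 3
    then have s: "(\<lambda>v. ?n v ^ (CARD('d) - 2) * pmf p v) summable_on UNIV" using mc by (simp add: moment_condition_def)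
    show ?thesis
    proof (rule summable_on_comparison_test[OF s])
      fix v
      have "(?n v)\<^sup>2 \<le> ?n v ^ (CARD('d) - 2)"
        using n[of v]
      proof
        assume "1 \<le> ?n v"
        then show ?thesis using 3 by (intro power_increasing) auto
      qed simp
      then show "(?n v)\<^sup>2 * pmf p v \<le> ?n v ^ (CARD('d) - 2) * pmf p v" by (rule mult_right_mono) simp
    qed auto
  qed
qed auto

text \<open>
  The reachable set is closed under addition, and under negation by symmetry; so it contains its
  differences.
\<close>

lemma (in lattice_walk) reaches_all_if_aperiodic:
  assumes sym: "map_pmf uminus p = p" and aper: "aperiodic M (walk X)"
  shows "\<exists>n. walk_prob p n x > 0"
proof -
  define A where "A = {sum_list xs | xs. set xs \<subseteq> set_pmf p}"
  have reach: "reachable M (walk X) = A"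
    unfolding reachable_def A_def prob_walk walk_prob_pos_iff by auto
  have neg: "- a \<in> A" if a: "a \<in> A" for a
  proof -
    obtain xs where xs: "set xs \<subseteq> set_pmf p" "a = sum_list xs" using a by (auto simp: A_def)
    have "set_pmf p = uminus ` set_pmf p" using sym by (metis set_map_pmf)
    then have "set (map uminus xs) \<subseteq> set_pmf p" using xs by auto
    moreover have "- a = sum_list (map uminus xs)" unfolding xs(2) by (induction xs) auto
    ultimately show ?thesis unfolding A_def by blast
  qed
  have add: "a + b \<in> A" if ab: "a \<in> A" "b \<in> A" for a b
  proof -
    obtain xs ys where "set xs \<subseteq> set_pmf p" "a = sum_list xs" "set ys \<subseteq> set_pmf p" "b = sum_list ys"
      using ab by (auto simp: A_def)
    then have "set (xs @ ys) \<subseteq> set_pmf p \<and> a + b = sum_list (xs @ ys)" by simp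
    then show ?thesis unfolding A_def by blast
  qed
  have "x \<in> {y - z | y z. y \<in> reachable M (walk X) \<and> z \<in> reachable M (walk X)}"
    using aper by (simp add: aperiodic_def)
  then obtain y z where yz: "x = y - z" "y \<in> A" "z \<in> A" unfolding reach by blast
  then have "y + - z \<in> A" by (intro add neg)
  then have "x \<in> A" using yz by simp
  then show ?thesis unfolding reach[symmetric] reachable_def prob_walk by simp
qed

theorem theorem1p2:
  fixes M :: "'a measure"
    and X :: "nat \<Rightarrow> 'a \<Rightarrow> int ^ 'd"
    and p :: "(int ^ 'd) pmf"
    and r \<delta> :: "nat \<Rightarrow> real"
  defines "S \<equiv> walk X"
    and "Q \<equiv> covariance_matrix M (X 1)"
    and "lam \<equiv> lambda_const M (walk X)"
  assumes dim: "CARD('d) \<ge> 3"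
    and prob: "prob_space M"
    and indep: "prob_space.indep_vars M (\<lambda>_. count_space UNIV) X {1..}"
    and distr: "\<And>k. k \<ge> 1 \<Longrightarrow> distr M (count_space UNIV) (X k) = measure_pmf p"
    and sym: "symmetric_step p"
    and aper: "aperiodic M S"
    and moment: "moment_condition p"
    and r_pos: "\<And>n. n \<ge> 1 \<Longrightarrow> r n > 0"
    and \<delta>_pos: "\<And>n. n \<ge> 1 \<Longrightarrow> \<delta> n > 0"
    and \<delta>_decreasing: "\<And>m n. 1 \<le> m \<Longrightarrow> m \<le> n \<Longrightarrow> \<delta> n \<le> \<delta> m"
    and r_increasing: "\<And>m n. 1 \<le> m \<Longrightarrow> m \<le> n \<Longrightarrow> r m \<le> r n"
    and r_regular: "\<And>c::real. c > 0 \<Longrightarrow>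
      \<exists>C>0. \<forall>n::nat. nat \<lfloor>c * real n\<rfloor> \<ge> 1 \<longrightarrow> r (nat \<lfloor>c * real n\<rfloor>) / r n < C"
    and \<beta>_lim: "(\<lambda>n. r n ^ (2 * CARD('d) - 4) * (ln (ln (real n)) / ln (real n))) \<longlonglongrightarrow> 0"
    and \<delta>_lim: "(\<lambda>n. \<delta> n * r n ^ (2 * CARD('d) - 4)) \<longlonglongrightarrow> 0"
  shows "AE \<omega> in M.
    (\<lambda>n. sup0 (heavy_times (\<lambda>k. S k \<omega>) n ((1 - \<delta> n) * lam * ln (real n)))
      (\<lambda>j. SUP x\<in>cov_ball Q (r n).
        \<bar>total_local_time (\<lambda>k. S k \<omega>) (S j \<omega> + x) / ereal (m_const M S x * lam * ln (real n)) - 1\<bar>))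
    \<longlonglongrightarrow> 0"
proof -
  have lam_eq: "lam = lambda_const M (walk X)" by (simp only: lam_def)
  interpret lattice_walk M X p
    by (intro lattice_walk.intro prob lattice_walk_axioms.intro indep distr)
  have symm: "map_pmf uminus p = p" by (rule map_pmf_uminus_if_symmetric_step[OF sym])
  have "\<exists>C>0. \<forall>n\<ge>1. r (2 * n) / r n < C"
  proof -
    obtain C where C: "C > 0" "\<And>n :: nat. nat \<lfloor>2 * real n\<rfloor> \<ge> 1 \<Longrightarrow> r (nat \<lfloor>2 * real n\<rfloor>) / r n < C"
      using r_regular[of 2] by auto
    have "\<lfloor>2 * real n\<rfloor> = int (2 * n)" for n by (simp add: floor_eq_iff)
    then have "nat \<lfloor>2 * real n\<rfloor> = 2 * n" for n by simp
    with C show ?thesis by auto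
  qed
  then interpret heavy_point_setting M X p r \<delta>
    using symm reaches_all_if_aperiodic[OF symm aper[unfolded S_def]] second_moment_if_moment_condition[OF moment dim]
      dim r_pos \<delta>_pos \<delta>_decreasing r_increasing \<beta>_lim \<delta>_lim
    by unfold_locales
  show ?thesis
    using deviation_limit
    unfolding S_def Q_def lam_eq covariance_eq m_const_eq lambda_const_eq .
qed

end
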